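(* Let $k$ be a positive integer and let $\psi:\mathbb{N}\to(0,\infty)$ be a function such that $x\mapsto x^{2k-2}\psi(x)$ is non-increasing on $\mathbb{N}$ and $\sum_{j\ge1}j^{2k-2}\psi(j)=\infty$. Then for every real number $y$ and almost every real linear form $L(\mathbf{x})=\alpha_1x_1+\cdots+\alpha_{2k}x_{2k}$ in $2k$ variables (i.e. for almost every $(\alpha_1,\dots,\alpha_{2k})\in\mathbb{R}^{2k}$), there exist infinitely many integer points $(q_1,\dots,q_{2k})\in\mathbb{Z}^{2k}$ with $(q_1,\dots,q_{2k-1})\neq(0,\dots,0)$ such that $$\gcd(q_{2i-1},q_{2i})=1\ \text{ for all } i=1,\dots,k\quad\text{and}\quad |L(q_1,\dots,q_{2k})-y|\le\psi\Big(\max_{1\le i\le 2k-1}|q_i|\Big).$$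
   Context: $\mathbb{N}=\{1,2,\dots\}$; "almost every" refers to Lebesgue measure. *)

theory Defs
  imports "HOL-Analysis.Analysis"
begin

text \<open>
  Points of \<open>\<real>\<^sup>d\<close> and \<open>\<int>\<^sup>d\<close> (with \<open>d\<close> a natural number that may depend on a variable) are
  functions on the index set \<open>{1..d}\<close>, extended by \<open>undefined\<close> outside it; extensionality
  makes counting integer points meaningful.
\<close>

definition lebesgue_dim :: "nat \<Rightarrow> (nat \<Rightarrow> real) measure" where
  "lebesgue_dim d = completion (\<Pi>\<^sub>M i\<in>{1..d}. lborel)"

definition integer_points :: "nat \<Rightarrow> (nat \<Rightarrow> int) set" where
  "integer_points d = ({1..d} \<rightarrow>\<^sub>E UNIV)"

definition linear_form :: "nat \<Rightarrow> (nat \<Rightarrow> real) \<Rightarrow> (nat \<Rightarrow> int) \<Rightarrow> real" where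
  "linear_form d \<alpha> q = (\<Sum>i=1..d. \<alpha> i * of_int (q i))"

text \<open>The maximum is over a nonempty set only when \<open>m \<ge> 1\<close>.\<close>

definition height :: "nat \<Rightarrow> (nat \<Rightarrow> int) \<Rightarrow> nat" where
  "height m q = nat (Max ((\<lambda>i. \<bar>q i\<bar>) ` {1..m}))"

end

theory Submission
  imports Defs
begin

text \<open>
  The proof is a second moment argument.  Let \<open>H = 4\<^sup>t\<close>, and count the admissible \<open>q\<close> with
  \<open>H \<le> q i < 2 H\<close> for \<open>i < 2 k\<close> whose strip \<open>\<bar>\<alpha> \<cdot> q - y\<bar> \<le> p t\<close> contains \<open>\<alpha>\<close>, where \<open>p t\<close> is
  \<open>\<psi> (2 H)\<close> truncated at a small multiple of \<open>1 / H\<^bsup>2 k - 1\<^esup>\<close>.  Counting coprime pairs shows that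
  the expected number of such \<open>q\<close> at level \<open>t\<close> is, on every set \<open>U\<close> that is a union of
  sufficiently regular pieces, at least a constant times \<open>\<mu>(U) H\<^bsup>2 k - 1\<^esup> p t\<close>; these weights have divergent
  sum by condensation.  The second moment of the total count on a fixed bounded region is at most a
  constant times the square of the sum of the weights.  If the set \<open>V\<close> of points hit by no strip
  from some level on had positive measure, one could approximate it by a regular \<open>U\<close>; the count on
  \<open>U\<close> would then have to be concentrated on the tiny set \<open>U - V\<close>, against the second moment bound.
  So only the first moment has to be understood locally, and no zero-one law is needed.

  Two strips meet in a set governed by the \<open>2 \<times> 2\<close> minors of \<open>q\<close> and \<open>r\<close>.  For \<open>k \<ge> 2\<close> summing the
  inverse of the largest minor suffices, primitivity only serving to exclude parallel vectors.  For
  \<open>k = 1\<close> that sum loses a logarithm, and one uses the location of the strips as well: if \<open>y = 0\<close> a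
  common point near the region forces the minor to be small, and if \<open>y \<noteq> 0\<close> it forces the minor to
  be comparable to \<open>y (r 1 - q 1)\<close>.
\<close>

section \<open>Second moments and limit superior sets\<close>

text \<open>Coordinate 1 is singled out: measures are computed by integrating it first, along lines
  on which a strip is an interval of length \<open>2 * p t / q 1\<close>. Hence \<open>U\<close> has
  to be regular only along these lines, at one dyadic scale for all of them, and the first moment
  has to be uniform only over the other coordinates. The pairs of entries are disjoint, so coprime
  pairs are chosen independently; only the second entry of the last pair is tied to the strip, and
  bounding it requires \<open>\<alpha> d\<close> to stay away from 0. The base 4 (not 2) makes first
  coordinates at different levels differ by at least half the larger \<open>H\<close>, which
  \<open>k = 1\<close>, \<open>y \<noteq> 0\<close> needs. The truncation serves the overlaps inside
  one level: \<open>w t \<le> 1\<close> lets the square of \<open>w t\<close> be absorbed by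
  \<open>w t\<close>, and for \<open>k = 1\<close> it makes error terms small against 1 and
  \<open>\<bar>y\<bar>\<close>. It depends on the region, which is harmless since \<open>p t\<close>
  only has to stay below \<open>\<psi> (2 * H)\<close>.\<close>

lemma limsup_full_measure:
  fixes M :: "'a measure" and E :: "nat \<Rightarrow> 'b \<Rightarrow> 'a set" and S :: "nat \<Rightarrow> 'b set"
  assumes Q: "Q \<in> sets M" "emeasure M Q < \<infinity>"
    and S: "\<And>t. finite (S t)"
    and E: "\<And>t q. E t q \<in> sets M"
    and w: "\<And>t. w t \<ge> (0::real)" "filterlim (\<lambda>N. \<Sum>t<N. w t) at_top sequentially"
    and cross: "\<And>s t. s < t \<Longrightarrow>
      (\<Sum>q\<in>S s. \<Sum>r\<in>S t. measure M (E s q \<inter> E t r \<inter> Q)) \<le> C * (w s * w t)"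
    and same: "\<And>t. (\<Sum>q\<in>S t. \<Sum>r\<in>S t. measure M (E t q \<inter> E t r \<inter> Q)) \<le> C * w t"
    and c: "c > 0" and C: "C \<ge> 0"
    and \<U>: "\<And>U. U \<in> \<U> \<Longrightarrow> U \<in> sets M" "\<And>U. U \<in> \<U> \<Longrightarrow> U \<subseteq> Q"
    and first: "\<And>U. U \<in> \<U> \<Longrightarrow>
      \<forall>\<^sub>F t in sequentially. c * w t * measure M U \<le> (\<Sum>q\<in>S t. measure M (E t q \<inter> U))"
    and dense: "\<And>A \<eta>. A \<in> sets M \<Longrightarrow> A \<subseteq> Q \<Longrightarrow> \<eta> > 0 \<Longrightarrow>
      \<exists>U\<in>\<U>. measure M (sym_diff A U) < \<eta>"
  shows "AE x in M. x \<in> Q \<longrightarrow> (\<forall>T. \<exists>t\<ge>T. \<exists>q\<in>S t. x \<in> E t q)"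
proof -
  have fm: "A \<in> fmeasurable M" if "A \<in> sets M" "A \<subseteq> Q" for A
  proof (rule fmeasurableI)
    show "emeasure M A < \<infinity>" using emeasure_mono[OF that(2) Q(1)] Q(2) by (simp add: less_top le_less_trans)
  qed (use that in auto)
  have null: "{x\<in>Q. \<forall>t\<ge>T. \<forall>q\<in>S t. x \<notin> E t q} \<in> null_sets M" for T
  proof -
    define V where "V = {x\<in>Q. \<forall>t\<ge>T. \<forall>q\<in>S t. x \<notin> E t q}"
    have "V = Q - (\<Union>t\<in>{T..}. \<Union>q\<in>S t. E t q)" by (auto simp: V_def)
    moreover have "(\<Union>t\<in>{T..}. \<Union>q\<in>S t. E t q) \<in> sets M"
      using S E by (intro sets.countable_UN' sets.finite_UN) auto
    ultimately have V: "V \<in> sets M" "V \<subseteq> Q" using Q by auto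
    \<comment> \<open>\<open>K\<close> is a free threshold. On \<open>V\<close> no strip from level
      \<open>T\<close> on is hit, so the count on \<open>U\<close> lives on \<open>U - V\<close>, of
      measure below \<open>\<eta>\<close>. Taking \<open>\<eta> = 1 / (K * K)\<close> and
      \<open>K\<close> large will force \<open>measure M V = 0\<close>.\<close>
    have key: "c * measure M U \<le> 2 * C / K + K * \<eta>"
      if K: "K > 0" and U: "U \<in> \<U>" "measure M (sym_diff V U) < \<eta>" for K \<eta> U
    proof -
      have Us: "U \<in> sets M" "U \<subseteq> Q" using \<U> U by auto
      obtain T0 where T0: "\<And>t. t \<ge> T0 \<Longrightarrow> c * w t * measure M U \<le> (\<Sum>q\<in>S t. measure M (E t q \<inter> U))"
        using first[OF U(1)] by (auto simp: eventually_sequentially)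
      define T' where "T' = max T T0"
      have "\<forall>\<^sub>F N in sequentially. (\<Sum>t<T'. w t) + 1 \<le> (\<Sum>t<N. w t) \<and> T' \<le> N"
        using w(2) by (auto simp: filterlim_at_top eventually_conj eventually_ge_at_top)
      then obtain N where N: "(\<Sum>t<T'. w t) + 1 \<le> (\<Sum>t<N. w t)" "T' \<le> N"
        by (auto simp: eventually_sequentially)
      define L where "L = {T'..<N}"
      define W where "W = (\<Sum>t\<in>L. w t)"
      have "(\<Sum>t<N. w t) = (\<Sum>t<T'. w t) + W"
        unfolding W_def L_def using N(2) by (subst sum.union_disjoint[symmetric]) (auto intro!: sum.cong)
      \<comment> \<open>Enough levels are taken for the same-level contribution \<open>C * W\<close>
        to be absorbed by \<open>C * (W * W)\<close>.\<close>
      with N have W: "W \<ge> 1" by simp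
      define I where "I = (SIGMA t:L. S t)"
      have sumI: "(\<Sum>(t,q)\<in>I. f t q) = (\<Sum>t\<in>L. \<Sum>q\<in>S t. f t q)" for f :: "nat \<Rightarrow> 'b \<Rightarrow> real"
        unfolding I_def using S by (subst sum.Sigma) (auto simp: L_def)
      have finI: "finite I" using S by (auto simp: I_def L_def)
      define Z where "Z = (\<lambda>x. \<Sum>(t,q)\<in>I. indicat_real (E t q \<inter> Q) x)"
      have EQ: "E t q \<inter> Q \<in> fmeasurable M" "E t q \<inter> U \<in> fmeasurable M" for t q
        using E Q Us by (auto intro!: fm)
      have EE: "(E t q \<inter> E s r \<inter> Q) \<in> fmeasurable M" for t q s r
        using E Q by (auto intro!: fm)
      have Z2: "Z x * Z x = (\<Sum>(t,q)\<in>I. \<Sum>(s,r)\<in>I. indicat_real (E t q \<inter> E s r \<inter> Q) x)" for x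
        unfolding Z_def sum_product
        by (auto intro!: sum.cong simp: indicator_def split: prod.split)
      have Zint: "integrable M (\<lambda>x. Z x * Z x)"
        unfolding Z2 using EE by (auto intro!: Bochner_Integration.integrable_sum integrable_real_indicator simp: fmeasurable_def)
      have pair: "(\<Sum>q\<in>S s. \<Sum>r\<in>S t. measure M (E s q \<inter> E t r \<inter> Q)) \<le> C * (w s * w t) + (if s = t then C * w t else 0)" for s t
      proof (cases "s = t")
        case True
        then show ?thesis using same[of t] C w(1)[of t] by (simp add: add_increasing)
      next
        case False
        then consider "s < t" | "t < s" by linarith
        then show ?thesis
        proof cases
          case 1 then show ?thesis using cross by simp
        next
          case 2
          have "(\<Sum>q\<in>S s. \<Sum>r\<in>S t. measure M (E s q \<inter> E t r \<inter> Q)) = (\<Sum>r\<in>S t. \<Sum>q\<in>S s. measure M (E t r \<inter> E s q \<inter> Q))"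
            by (subst sum.swap) (simp add: Int_commute)
          also have "\<dots> \<le> C * (w t * w s)" using cross[OF 2] by simp
          finally show ?thesis using 2 by (simp add: mult.commute)
        qed
      qed
      have "(\<integral>x. Z x * Z x \<partial>M) = (\<Sum>(t,q)\<in>I. \<Sum>(s,r)\<in>I. measure M (E t q \<inter> E s r \<inter> Q))"
        unfolding Z2 using EE E Q
        by (subst Bochner_Integration.integral_sum, force intro!: Bochner_Integration.integrable_sum integrable_real_indicator simp: fmeasurable_def,
          intro sum.cong refl, clarsimp,
          subst Bochner_Integration.integral_sum, force intro!: Bochner_Integration.integrable_sum integrable_real_indicator simp: fmeasurable_def)
          (auto intro!: sum.cong arg_cong[where f="measure M"] dest: sets.sets_into_space)
      also have "\<dots> = (\<Sum>t\<in>L. \<Sum>q\<in>S t. \<Sum>s\<in>L. \<Sum>r\<in>S s. measure M (E t q \<inter> E s r \<inter> Q))"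
        by (simp only: sumI)
      also have "\<dots> = (\<Sum>t\<in>L. \<Sum>s\<in>L. \<Sum>q\<in>S t. \<Sum>r\<in>S s. measure M (E t q \<inter> E s r \<inter> Q))"
        by (intro sum.cong refl sum.swap)
      also have "\<dots> \<le> (\<Sum>t\<in>L. \<Sum>s\<in>L. C * (w t * w s) + (if t = s then C * w s else 0))"
        by (intro sum_mono pair)
      also have "\<dots> = C * (W * W) + C * W"
      proof -
        have "W * W = (\<Sum>t\<in>L. \<Sum>s\<in>L. w t * w s)" unfolding W_def by (rule sum_product)
        moreover have "(\<Sum>s\<in>L. if t = s then C * w s else 0) = C * w t" if "t \<in> L" for t
          using that by (simp add: L_def)
        ultimately show ?thesis
          by (simp add: sum.distrib W_def sum_distrib_left[symmetric] del: sum.delta sum.delta')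
      qed
      also have "\<dots> \<le> C * (W * W) + C * (W * W)"
        using W C by (intro add_left_mono mult_left_mono) auto
      finally have m2: "(\<integral>x. Z x * Z x \<partial>M) \<le> 2 * C * (W * W)" by simp
      have UV: "U - V \<in> fmeasurable M" using Us V by (intro fm) auto
      have "c * W * measure M U \<le> (\<Sum>t\<in>L. \<Sum>q\<in>S t. measure M (E t q \<inter> U))"
        unfolding W_def sum_distrib_left sum_distrib_right
        by (intro sum_mono T0) (auto simp: L_def T'_def)
      also have "\<dots> = (\<Sum>(t,q)\<in>I. measure M (E t q \<inter> U))"
        by (simp only: sumI)
      also have "\<dots> = (\<integral>x. (\<Sum>(t,q)\<in>I. indicat_real (E t q \<inter> U) x) \<partial>M)"
        using EQ E Us
        by (subst Bochner_Integration.integral_sum, force intro!: integrable_real_indicator simp: fmeasurable_def)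
          (auto intro!: sum.cong arg_cong[where f="measure M"] dest: sets.sets_into_space)
      \<comment> \<open>In place of Cauchy-Schwarz: a count above \<open>K * W\<close> is at most
        \<open>Z x * Z x / (K * W)\<close>, any other count is at most \<open>K * W\<close>.\<close>
      also have "\<dots> \<le> (\<integral>x. Z x * Z x / (K * W) + K * W * indicat_real (U - V) x \<partial>M)"
      proof (rule integral_mono)
        show "integrable M (\<lambda>x. \<Sum>(t,q)\<in>I. indicat_real (E t q \<inter> U) x)"
          using EQ by (auto intro!: Bochner_Integration.integrable_sum integrable_real_indicator simp: fmeasurable_def)
        show "integrable M (\<lambda>x. Z x * Z x / (K * W) + K * W * indicat_real (U - V) x)"
          using Zint UV by (auto intro!: Bochner_Integration.integrable_add integrable_real_indicator simp: fmeasurable_def)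
        fix x
        have z: "0 \<le> Z x * Z x / (K * W)" using K W by (intro divide_nonneg_nonneg) auto
        show "(\<Sum>(t,q)\<in>I. indicat_real (E t q \<inter> U) x) \<le> Z x * Z x / (K * W) + K * W * indicat_real (U - V) x"
        proof (cases "x \<in> U - V")
          case True
          then have "(\<Sum>(t,q)\<in>I. indicat_real (E t q \<inter> U) x) = Z x"
            unfolding Z_def using Us by (intro sum.cong refl) (auto simp: indicator_def)
          moreover have "Z x \<le> Z x * Z x / (K * W) + K * W"
          proof (cases "Z x \<le> K * W")
            case True then show ?thesis using z by linarith
          next
            case False
            have KW: "K * W > 0" using K W by simp
            with False have "Z x * (K * W) \<le> Z x * Z x" by (intro mult_left_mono) auto
            then have "Z x \<le> Z x * Z x / (K * W)" using KW by (simp add: pos_le_divide_eq)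
            then show ?thesis using KW by linarith
          qed
          ultimately show ?thesis using True by simp
        next
          case False
          have "(\<Sum>(t,q)\<in>I. indicat_real (E t q \<inter> U) x) = 0"
          proof (intro sum.neutral ballI, clarify)
            fix t q assume "(t, q) \<in> I"
            then have "t \<ge> T" "q \<in> S t" by (auto simp: I_def L_def T'_def)
            then show "indicat_real (E t q \<inter> U) x = 0"
              using False by (auto simp: indicator_def V_def)
          qed
          then show ?thesis using z False by simp
        qed
      qed
      also have "\<dots> = (\<integral>x. Z x * Z x \<partial>M) / (K * W) + K * W * measure M (U - V)"
        using Zint UV Us V
        by (subst Bochner_Integration.integral_add)
          (auto intro!: integrable_real_indicator arg_cong[where f="measure M"] simp: fmeasurable_def dest: sets.sets_into_space)
      also have "\<dots> \<le> 2 * C * (W * W) / (K * W) + K * W * \<eta>"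
      proof (intro add_mono divide_right_mono m2 mult_left_mono)
        have "measure M (U - V) \<le> measure M (sym_diff V U)"
          using Us V by (intro measure_mono_fmeasurable fm) auto
        then show "measure M (U - V) \<le> \<eta>" using U by linarith
      qed (use K W in auto)
      also have "\<dots> = W * (2 * C / K + K * \<eta>)" using W K by (simp add: field_simps)
      finally have "W * (c * measure M U) \<le> W * (2 * C / K + K * \<eta>)" by (simp add: ac_simps)
      then show ?thesis using W by (subst (asm) mult_le_cancel_left_pos) auto
    qed
    define v where "v = measure M V"
    have le: "c * v \<le> (2 * C + 1 + c) / K" if "K \<ge> 1" for K
    proof -
      have K: "K > 0" "K * K \<ge> K" using that by (auto simp: mult_le_cancel_left1)
      have "1 / (K * K) > 0" using K by simp
      then obtain U where U: "U \<in> \<U>" "measure M (sym_diff V U) < 1 / (K * K)"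
        using dense[OF V] by blast
      have "c * v \<le> c * (measure M U + 1 / (K * K))"
      proof -
        have s: "measure M (sym_diff V U) \<le> 1 / (K * K)" using U by simp
        have "v \<le> measure M (U \<union> sym_diff V U)"
          unfolding v_def using V \<U>[OF U(1)] by (intro measure_mono_fmeasurable fm) auto
        also have "\<dots> \<le> measure M U + measure M (sym_diff V U)"
          using V \<U>[OF U(1)] by (intro measure_Un_le) auto
        finally show ?thesis using s c by (intro mult_left_mono) auto
      qed
      also have "\<dots> \<le> 2 * C / K + K * (1 / (K * K)) + c * (1 / (K * K))"
        using key[OF K(1) U] by (simp add: algebra_simps)
      also have "\<dots> \<le> 2 * C / K + 1 / K + c * (1 / K)"
        using K c by (intro add_mono mult_left_mono) (auto simp: field_simps)
      finally show ?thesis by (simp add: add_divide_distrib)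
    qed
    have "v = 0"
    proof (rule ccontr)
      assume "v \<noteq> 0"
      then have v: "c * v > 0" using c by (simp add: v_def zero_less_measure_iff)
      define A where "A = 2 * C + 1 + c"
      have A: "A > 0" using C c by (simp add: A_def)
      have "c * v \<le> A / max 1 (2 * A / (c * v))" using le[of "max 1 (2 * A / (c * v))"] by (simp add: A_def)
      also have "\<dots> \<le> A / (2 * A / (c * v))" using A v by (intro divide_left_mono) auto
      also have "\<dots> = c * v / 2" using A v by (simp add: field_simps)
      finally show False using v by simp
    qed
    then have "emeasure M V = 0" using fm[OF V] by (simp add: v_def emeasure_eq_measure2)
    then show ?thesis using V unfolding V_def by (intro null_setsI)
  qed
  have "(\<Union>T. {x\<in>Q. \<forall>t\<ge>T. \<forall>q\<in>S t. x \<notin> E t q}) \<in> null_sets M"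
    using null by (intro null_sets_UN) auto
  then show ?thesis by (rule AE_I') auto
qed

section \<open>Density of saturated sets\<close>

text \<open>Finite measure of \<open>Q\<close> is what gives countable unions: by continuity from
  above the tail of a union is small inside \<open>Q\<close>, and the remaining \<open>m\<close>
  sets are approximated with error \<open>\<eta> / (2 * (m + 1))\<close> each.\<close>

lemma sigma_algebra_approximable:
  assumes Q: "Q \<in> fmeasurable M" and alg: "algebra (space M) \<A>" and sub: "\<A> \<subseteq> sets M"
  shows "sigma_algebra (space M)
    {A \<in> sets M. \<forall>\<eta>>0. \<exists>U\<in>\<A>. measure M (Q \<inter> sym_diff A U) < (\<eta>::real)}"
    (is "sigma_algebra _ ?P")
proof -
  interpret algebra "space M" \<A> by fact
  have fm: "A \<inter> Q \<in> fmeasurable M" "Q \<inter> A \<in> fmeasurable M" if "A \<in> sets M" for A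
    using fmeasurable_Int_fmeasurable[OF Q that] by (auto simp: Int_commute)
  have cl: "(\<Union>i. A i) \<in> ?P" if A: "range A \<subseteq> ?P" for A :: "nat \<Rightarrow> 'a set"
  proof -
    have As[measurable]: "A i \<in> sets M" for i using A by auto
    have "\<exists>U\<in>\<A>. measure M (Q \<inter> sym_diff (\<Union>i. A i) U) < \<eta>" if \<eta>: "\<eta> > 0" for \<eta> :: real
    proof -
      define F where "F m = Q \<inter> ((\<Union>i. A i) - (\<Union>i<m. A i))" for m
      have "(\<lambda>m. measure M (F m)) \<longlonglongrightarrow> measure M (\<Inter>m. F m)"
      proof (rule Lim_measure_decseq)
        show "range F \<subseteq> sets M" using Q by (auto simp: F_def fmeasurable_def)
        show "decseq F" by (auto simp: F_def decseq_def)
        show "emeasure M (F m) \<noteq> \<infinity>" for m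
          using fm(2)[of "(\<Union>i. A i) - (\<Union>i<m. A i)"] by (auto simp: F_def fmeasurable_def)
      qed
      moreover have "(\<Inter>m. F m) = {}" by (auto simp: F_def)
      ultimately have "\<forall>\<^sub>F m in sequentially. measure M (F m) < \<eta> / 2"
        using \<eta> by (intro order_tendstoD) auto
      then obtain m where m: "measure M (F m) < \<eta> / 2"
        by (auto simp: eventually_sequentially)
      have "\<exists>U\<in>\<A>. measure M (Q \<inter> sym_diff (A i) U) < \<eta> / (2 * (real m + 1))" for i
        using A \<eta> by (auto simp: subset_iff intro!: divide_pos_pos)
      then obtain U where U: "\<And>i. U i \<in> \<A>" "\<And>i. measure M (Q \<inter> sym_diff (A i) (U i)) < \<eta> / (2 * (real m + 1))"
        by metis
      have Us[measurable]: "U i \<in> sets M" for i using U sub by auto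
      have *: "Q \<inter> sym_diff (\<Union>i. A i) (\<Union>i<m. U i) \<subseteq> F m \<union> (\<Union>i<m. Q \<inter> sym_diff (A i) (U i))"
        by (auto simp: F_def)
      have "measure M (Q \<inter> sym_diff (\<Union>i. A i) (\<Union>i<m. U i))
          \<le> measure M (F m \<union> (\<Union>i<m. Q \<inter> sym_diff (A i) (U i)))"
        using Q by (intro measure_mono_fmeasurable *) (auto intro!: fm fmeasurable.Un fmeasurable.finite_UN simp: F_def fmeasurableD)
      also have "\<dots> \<le> measure M (F m) + measure M (\<Union>i<m. Q \<inter> sym_diff (A i) (U i))"
        using Q by (intro measure_Un_le) (auto simp: F_def fmeasurableD)
      also have "measure M (\<Union>i<m. Q \<inter> sym_diff (A i) (U i)) \<le> (\<Sum>i<m. measure M (Q \<inter> sym_diff (A i) (U i)))"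
        using Q by (intro measure_UNION_le) (auto simp: fmeasurableD)
      also have "\<dots> \<le> (\<Sum>i<m. \<eta> / (2 * (real m + 1)))"
        using U(2) by (intro sum_mono less_imp_le) auto
      also have "\<dots> \<le> \<eta> / 2" using \<eta> by (simp add: field_simps)
      finally have "measure M (Q \<inter> sym_diff (\<Union>i. A i) (\<Union>i<m. U i)) < \<eta>" using m by simp
      then show ?thesis using U(1) by (intro bexI[of _ "\<Union>i<m. U i"]) auto
    qed
    then show ?thesis by auto
  qed
  show ?thesis
    unfolding sigma_algebra_iff2
  proof (intro conjI ballI allI impI)
    show "?P \<subseteq> Pow (space M)" using sets.sets_into_space by auto
    show "{} \<in> ?P" by (auto intro!: bexI[of _ "{}"])
    fix A assume A: "A \<in> ?P"
    have "\<exists>U\<in>\<A>. measure M (Q \<inter> sym_diff (space M - A) U) < \<eta>" if "\<eta> > 0" for \<eta>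
    proof -
      obtain U where U: "U \<in> \<A>" "measure M (Q \<inter> sym_diff A U) < \<eta>" using A \<open>\<eta> > 0\<close> by auto
      moreover have "Q \<inter> sym_diff (space M - A) (space M - U) = Q \<inter> sym_diff A U"
        using A U sub sets.sets_into_space[of _ M] by blast
      ultimately show ?thesis by (intro bexI[of _ "space M - U"]) auto
    qed
    then show "space M - A \<in> ?P" using A by auto
  qed (use cl in blast)
qed

text \<open>Nothing is asked of the coordinates other than \<open>i\<close>. Each slice in direction
  \<open>i\<close> is a union of whole dyadic intervals, whose length is the same for all
  slices.\<close>

definition saturated :: "'i set \<Rightarrow> 'i \<Rightarrow> nat \<Rightarrow> ('i \<Rightarrow> real) set \<Rightarrow> bool" where
  "saturated I i n U \<longleftrightarrow> (\<forall>\<alpha>\<in>space (\<Pi>\<^sub>M i\<in>I. lborel). \<forall>y.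
    \<lfloor>2 ^ n * y\<rfloor> = \<lfloor>2 ^ n * \<alpha> i\<rfloor> \<longrightarrow> (\<alpha>(i := y) \<in> U \<longleftrightarrow> \<alpha> \<in> U))"

lemma floor_pow2_mono:
  assumes "\<lfloor>2 ^ n * (y::real)\<rfloor> = \<lfloor>2 ^ n * (z::real)\<rfloor>" "m \<le> n"
  shows "\<lfloor>2 ^ m * y\<rfloor> = \<lfloor>2 ^ m * z\<rfloor>"
proof -
  \<comment> \<open>Dyadic intervals are nested: the coarse index is a quotient of the fine
    one.\<close>
  have *: "\<lfloor>2 ^ m * y\<rfloor> = \<lfloor>2 ^ n * y\<rfloor> div 2 ^ (n - m)" for y :: real
  proof -
    have "2 ^ n = 2 ^ m * (2::real) ^ (n - m)" using assms(2) by (simp flip: power_add)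
    then have "2 ^ m * y = (2 ^ n * y) / of_int (2 ^ (n - m))" by simp
    then show ?thesis by (simp only: floor_divide_real_eq_div zero_le_power zero_le_numeral)
  qed
  show ?thesis using assms(1) by (simp add: *)
qed

lemma saturated_mono: "saturated I i m U \<Longrightarrow> m \<le> n \<Longrightarrow> saturated I i n U"
  unfolding saturated_def using floor_pow2_mono by blast

lemma algebra_saturated:
  assumes "i \<in> I"
  defines "M \<equiv> \<Pi>\<^sub>M i\<in>I. (lborel :: real measure)"
  shows "algebra (space M) {U \<in> sets M. \<exists>n. saturated I i n U}" (is "algebra _ ?A")
proof -
  have upd: "\<alpha>(i := y) \<in> space M" if "\<alpha> \<in> space M" for \<alpha> y
    using that assms(1) by (auto simp: M_def space_PiM PiE_def extensional_def)
  show ?thesis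
    unfolding algebra_iff_Un
  proof (intro conjI ballI)
    show "?A \<subseteq> Pow (space M)" using sets.sets_into_space by auto
    show "{} \<in> ?A" by (auto simp: saturated_def)
    fix U assume U: "U \<in> ?A"
    then show "space M - U \<in> ?A" using upd by (fastforce simp: saturated_def M_def)
    fix V assume V: "V \<in> ?A"
    from U V obtain m n where "saturated I i m U" "saturated I i n V" by auto
    then have "saturated I i (max m n) U" "saturated I i (max m n) V"
      by (auto intro: saturated_mono)
    then have "saturated I i (max m n) (U \<union> V)" by (auto simp: saturated_def)
    then show "U \<union> V \<in> ?A" using U V by auto
  qed
qed

text \<open>The approximable sets form a sigma-algebra, so it is enough that they make every
  coordinate function measurable.\<close>

lemma saturated_dense:
  fixes I :: "'i set"
  defines "M \<equiv> \<Pi>\<^sub>M i\<in>I. (lborel :: real measure)"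
  assumes I: "i \<in> I" and Q: "Q \<in> fmeasurable M" and A: "A \<in> sets M" and \<eta>: "\<eta> > 0"
  shows "\<exists>U n. U \<in> sets M \<and> saturated I i n U \<and> measure M (Q \<inter> sym_diff A U) < \<eta>"
proof -
  define \<A> where "\<A> = {U \<in> sets M. \<exists>n. saturated I i n U}"
  define P where "P = {A \<in> sets M. \<forall>\<eta>>0. \<exists>U\<in>\<A>. measure M (Q \<inter> sym_diff A U) < \<eta>}"
  have saP: "sigma_algebra (space M) P"
    unfolding P_def using Q algebra_saturated[OF I]
    by (intro sigma_algebra_approximable) (auto simp: \<A>_def M_def)
  \<comment> \<open>The same space with the approximable sets as measurable sets. Once the
    coordinates are measurable on it, the identity is measurable from \<open>M'\<close> to
    \<open>M\<close>, so every set of \<open>M\<close> is in \<open>P\<close>.\<close>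
  define M' where "M' = sigma (space M) P"
  interpret P: sigma_algebra "space M" P by (rule saP)
  have sM': "space M' = space M" "sets M' = P"
    unfolding M'_def by (auto simp: P.space_closed)
  have AP: "U \<in> P" if "U \<in> sets M" "saturated I i n U" for U n
    unfolding P_def using that by (auto simp: \<A>_def intro!: bexI[of _ U])
  have upd: "\<alpha>(i := y) \<in> space M" if "\<alpha> \<in> space M" for \<alpha> y
    using that I by (auto simp: M_def space_PiM PiE_def extensional_def)
  have comp: "(\<lambda>\<omega>. \<omega> j) \<in> borel_measurable M" if "j \<in> I" for j
    using measurable_component_singleton[OF that, of "\<lambda>_. lborel :: real measure"] by (simp add: M_def)
  have meas: "(\<lambda>\<omega>. \<omega> j) \<in> measurable M' lborel" if j: "j \<in> I" for j
  proof -
    have "(\<lambda>\<omega>. \<omega> j) \<in> borel_measurable M'"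
    proof (rule borel_measurableI_le)
      fix x :: real
      have ms: "{\<omega>\<in>space M. \<omega> j \<le> z} \<in> sets M" for z
        using comp[OF j] by measurable
      have "{\<omega>\<in>space M. \<omega> j \<le> x} \<in> P"
      proof (cases "j = i")
        case False
        then have "saturated I i 0 {\<omega>\<in>space M. \<omega> j \<le> x}"
          using upd by (auto simp: saturated_def M_def)
        then show ?thesis using AP ms by blast
      next
        case True
        \<comment> \<open>The half-line rounded up to the dyadic grid of level \<open>n\<close>: it
          is saturated, and the intersection over \<open>n\<close> is the half-line itself.\<close>
        define B where "B n = {\<omega>\<in>space M. \<lfloor>2 ^ n * \<omega> i\<rfloor> \<le> \<lfloor>2 ^ n * x\<rfloor>}" for n :: nat
        have "B n \<in> P" for n
        proof (rule AP[of _ n])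
          show "B n \<in> sets M" unfolding B_def using comp[OF I] by measurable
          show "saturated I i n (B n)" using upd by (auto simp: saturated_def M_def B_def)
        qed
        moreover have "{\<omega>\<in>space M. \<omega> j \<le> x} = (\<Inter>n. B n)"
        proof (intro equalityI subsetI)
          fix \<omega> assume "\<omega> \<in> {\<omega>\<in>space M. \<omega> j \<le> x}"
          then show "\<omega> \<in> (\<Inter>n. B n)" using True by (auto simp: B_def intro!: floor_mono mult_left_mono)
        next
          fix \<omega> assume \<omega>: "\<omega> \<in> (\<Inter>n. B n)"
          have "\<omega> i \<le> x"
          proof (rule ccontr)
            assume "\<not> \<omega> i \<le> x"
            then obtain n where n: "inverse (\<omega> i - x) < 2 ^ n"
              using real_arch_pow[of 2 "inverse (\<omega> i - x)"] by auto
            have "2 ^ n * (\<omega> i - x) > 1"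
              using n \<open>\<not> \<omega> i \<le> x\<close> by (simp add: field_simps)
            then have "\<lfloor>2 ^ n * x\<rfloor> < \<lfloor>2 ^ n * \<omega> i\<rfloor>" unfolding right_diff_distrib by linarith
            moreover have "\<omega> \<in> B n" using \<omega> by blast
            ultimately show False by (simp add: B_def)
          qed
          then show "\<omega> \<in> {\<omega>\<in>space M. \<omega> j \<le> x}" using \<omega> True by (auto simp: B_def)
        qed
        ultimately show ?thesis by auto
      qed
      then show "{\<omega> \<in> space M'. \<omega> j \<le> x} \<in> sets M'" by (simp add: sM')
    qed
    then show ?thesis by simp
  qed
  have "(\<lambda>\<omega>. \<lambda>j\<in>I. \<omega> j) \<in> measurable M' M"
    unfolding M_def using meas by (intro measurable_restrict) auto
  then have "(\<lambda>\<omega>. \<lambda>j\<in>I. \<omega> j) -` A \<inter> space M' \<in> sets M'" using A by (rule measurable_sets)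
  moreover have "(\<lambda>\<omega>. \<lambda>j\<in>I. \<omega> j) -` A \<inter> space M' = A"
  proof -
    have "restrict \<omega> I = \<omega>" if "\<omega> \<in> space M" for \<omega>
      using that by (auto simp: M_def space_PiM)
    then show ?thesis using sets.sets_into_space[OF A] by (auto simp: sM')
  qed
  ultimately have "A \<in> P" by (simp add: sM')
  then show ?thesis using \<eta> by (auto simp: P_def \<A>_def)
qed

section \<open>Counting integers\<close>

lemma int_Ico_eq: "{b::int. f \<le> real_of_int b \<and> real_of_int b < f + L} = {\<lceil>f\<rceil>..<\<lceil>f + L\<rceil>}"
  by (auto simp: ceiling_le_iff less_ceiling_iff)

lemma card_int_Ico_bounds:
  assumes "L \<ge> 0"
  shows "real (card {b::int. f \<le> real_of_int b \<and> real_of_int b < f + L}) \<le> L + 1"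
    and "L - 1 \<le> real (card {b::int. f \<le> real_of_int b \<and> real_of_int b < f + L})"
  unfolding int_Ico_eq card_atLeastLessThan_int using assms by linarith+

lemma card_int_Icc_le:
  assumes "r \<ge> 0"
  shows "finite {b::int. \<bar>real_of_int b - z\<bar> \<le> r}"
    and "real (card {b::int. \<bar>real_of_int b - z\<bar> \<le> r}) \<le> 2 * r + 1"
proof -
  have *: "{b::int. \<bar>real_of_int b - z\<bar> \<le> r} = {\<lceil>z - r\<rceil>..\<lfloor>z + r\<rfloor>}"
    by (auto simp: ceiling_le_iff le_floor_iff abs_le_iff)
  show "finite {b::int. \<bar>real_of_int b - z\<bar> \<le> r}" unfolding * by simp
  show "real (card {b::int. \<bar>real_of_int b - z\<bar> \<le> r}) \<le> 2 * r + 1"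
    unfolding * card_atLeastAtMost_int using assms by linarith
qed

lemma card_nonzero_int_le:
  assumes "z \<ge> 0"
  shows "finite {m::int. m \<noteq> 0 \<and> \<bar>real_of_int m\<bar> \<le> z}"
    and "real (card {m::int. m \<noteq> 0 \<and> \<bar>real_of_int m\<bar> \<le> z}) \<le> 2 * z"
proof -
  have "{m::int. m \<noteq> 0 \<and> \<bar>real_of_int m\<bar> \<le> z} = {- \<lfloor>z\<rfloor>..\<lfloor>z\<rfloor>} - {0}"
    by (auto simp: abs_le_iff le_floor_iff minus_le_iff)
  moreover have "card ({- \<lfloor>z\<rfloor>..\<lfloor>z\<rfloor>} - {0}) = nat (2 * \<lfloor>z\<rfloor>)"
    using assms by (subst card_Diff_singleton) auto
  ultimately show "finite {m::int. m \<noteq> 0 \<and> \<bar>real_of_int m\<bar> \<le> z}"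
    and "real (card {m::int. m \<noteq> 0 \<and> \<bar>real_of_int m\<bar> \<le> z}) \<le> 2 * z"
    using assms by simp_all
qed

lemma card_multiples_Ico_le:
  assumes "n > 0" "L \<ge> 0"
  shows "real (card {b::int. f \<le> real_of_int b \<and> real_of_int b < f + L \<and> int n dvd b}) \<le> L / n + 1"
proof -
  let ?C = "{c::int. f / n \<le> real_of_int c \<and> real_of_int c < f / n + L / n}"
  have "{b::int. f \<le> real_of_int b \<and> real_of_int b < f + L \<and> int n dvd b} \<subseteq> (\<lambda>c. int n * c) ` ?C"
    using assms by (auto simp: field_simps elim!: dvdE)
  moreover have "finite ?C" unfolding int_Ico_eq by simp
  ultimately have "card {b::int. f \<le> real_of_int b \<and> real_of_int b < f + L \<and> int n dvd b} \<le> card ?C"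
    by (meson card_image_le card_mono finite_imageI le_trans)
  with card_int_Ico_bounds(1)[of "L / n" "f / n"] assms show ?thesis by simp
qed

text \<open>Induction on the sharper bound \<open>3 / 4 - 1 / N\<close>, which is an equality at
  \<open>N = 2\<close>.\<close>

lemma sum_inverse_squares_le: "(\<Sum>n=2..N. 1 / (real n)\<^sup>2) \<le> 3 / 4"
proof -
  have "(\<Sum>n=2..N. 1 / (real n)\<^sup>2) \<le> 3 / 4 - 1 / real N" if "N \<ge> 2" using that
  proof (induction N rule: dec_induct)
    case (step n)
    have "1 / (real (Suc n))\<^sup>2 \<le> 1 / real n - 1 / real (Suc n)"
    proof -
      have "1 / (real (Suc n))\<^sup>2 \<le> 1 / (real n * real (Suc n))"
        using step by (intro divide_left_mono) (auto simp: power2_eq_square)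
      also have "\<dots> = 1 / real n - 1 / real (Suc n)" using step by (simp add: field_simps)
      finally show ?thesis .
    qed
    then show ?case using step by simp
  qed auto
  moreover have "(\<Sum>n=2..N. 1 / (real n)\<^sup>2) = 0" if "N < 2" using that by simp
  moreover have "0 \<le> 1 / real N" by simp
  ultimately show ?thesis by (cases "N \<ge> 2") linarith+
qed

text \<open>The harmonic sum enters only the error term of the count of coprime pairs, where any
  bound of smaller order than \<open>N\<close> suffices; a square root avoids logarithms.\<close>

lemma sum_inverse_le_sqrt: "(\<Sum>n=1..N. 1 / real n) \<le> 2 * sqrt N"
proof (induction N)
  case (Suc N)
  have "1 / real (Suc N) \<le> 2 * sqrt (Suc N) - 2 * sqrt N"
  proof -
    have s: "sqrt (Suc N) > 0" "sqrt N \<le> sqrt (Suc N)" "sqrt (Suc N) \<ge> 1" by auto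
    have "(sqrt (Suc N) - sqrt N) * (2 * sqrt (Suc N)) \<ge> (sqrt (Suc N) - sqrt N) * (sqrt (Suc N) + sqrt N)"
      using s by (intro mult_left_mono) auto
    also have "(sqrt (Suc N) - sqrt N) * (sqrt (Suc N) + sqrt N) = 1"
      by (simp add: algebra_simps)
    finally have "1 \<le> 2 * (sqrt (Suc N) - sqrt N) * sqrt (Suc N)" by (simp only: ac_simps)
    then have "1 / sqrt (Suc N) \<le> 2 * (sqrt (Suc N) - sqrt N)"
      using s(1) by (simp only: pos_divide_le_eq)
    moreover have "1 / real (Suc N) \<le> 1 / sqrt (Suc N)"
    proof -
      have "sqrt (Suc N) * 1 \<le> sqrt (Suc N) * sqrt (Suc N)" using s by (intro mult_left_mono) auto
      then show ?thesis by (intro divide_left_mono) auto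
    qed
    ultimately show ?thesis by simp
  qed
  then show ?case using Suc by simp
qed simp

text \<open>Pairs with a common divisor are counted divisor by divisor; the main term survives because
  \<open>1/2\<^sup>2 + 1/3\<^sup>2 + \<dots> \<le> 3/4 < 1\<close>.\<close>

lemma card_coprime_pairs_ge:
  fixes H :: nat and L :: real and f :: "int \<Rightarrow> real"
  assumes H: "H > 0" and L: "L \<ge> 0"
  shows "H * L / 4 - (5 * H + 2 * (H + L) * sqrt (2 * H))
    \<le> real (card {(a::int, b::int). H \<le> a \<and> a < 2 * H \<and> f a \<le> b \<and> b < f a + L \<and> coprime a b})"
proof -
  define J where "J a = {b::int. f a \<le> real_of_int b \<and> real_of_int b < f a + L}" for a
  define A where "A = (SIGMA a:{int H..<2 * int H}. J a)"
  define B where "B n = (SIGMA a:{a\<in>{int H..<2 * int H}. int n dvd a}. {b\<in>J a. int n dvd b})" for n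
  define G where "G = {(a::int, b::int). H \<le> a \<and> a < 2 * H \<and> f a \<le> b \<and> b < f a + L \<and> coprime a b}"
  have finJ: "finite (J a)" for a unfolding J_def int_Ico_eq by simp
  have finA: "finite A" and finB: "finite (B n)" for n unfolding A_def B_def using finJ
    by (auto intro!: finite_SigmaI intro: finite_subset[of _ "{int H..<2 * int H}"])
  have finG: "finite G" by (rule finite_subset[OF _ finA]) (auto simp: G_def A_def J_def)
  have sub: "A \<subseteq> G \<union> (\<Union>n\<in>{2..2 * H}. B n)"
  proof safe
    fix a b assume ab: "(a, b) \<in> A" "(a, b) \<notin> (\<Union>n\<in>{2..2 * H}. B n)"
    have a: "int H \<le> a" "a < 2 * int H" using ab by (auto simp: A_def)
    have "coprime a b"
    proof (rule ccontr)
      assume nc: "\<not> coprime a b"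
      define n where "n = nat (gcd a b)"
      \<comment> \<open>The common divisor is at most \<open>a < 2 * H\<close>, hence the range of
        \<open>n\<close> in the union.\<close>
      have g: "gcd a b > 0" "gcd a b \<le> a" using a H by (auto intro!: zdvd_imp_le)
      have "gcd a b \<noteq> 1" using nc by (simp add: coprime_iff_gcd_eq_1)
      then have "n \<in> {2..2 * H}" using g a unfolding n_def atLeastAtMost_iff by linarith
      moreover have "(a, b) \<in> B n" using ab(1) g by (auto simp: A_def B_def n_def)
      ultimately show False using ab(2) by blast
    qed
    then show "(a, b) \<in> G" using ab(1) by (auto simp: A_def G_def J_def)
  qed
  have "H * (L - 1) \<le> (\<Sum>a\<in>{int H..<2 * int H}. real (card (J a)))"
    using sum_mono[of "{int H..<2 * int H}" "\<lambda>_. L - 1" "\<lambda>a. real (card (J a))"]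
      card_int_Ico_bounds(2)[OF L] by (simp add: J_def)
  also have "\<dots> = real (card A)" unfolding A_def using finJ by (simp add: card_SigmaI)
  also have "\<dots> \<le> real (card (G \<union> (\<Union>n\<in>{2..2 * H}. B n)))"
    using sub finG finB by (intro of_nat_mono card_mono) auto
  also have "\<dots> \<le> real (card G + (\<Sum>n\<in>{2..2 * H}. card (B n)))"
    by (intro of_nat_mono order_trans[OF card_Un_le] add_left_mono card_UN_le) auto
  also have "\<dots> = real (card G) + (\<Sum>n\<in>{2..2 * H}. real (card (B n)))" by simp
  also have "(\<Sum>n\<in>{2..2 * H}. real (card (B n))) \<le> (\<Sum>n\<in>{2..2 * H}. (H / n + 1) * (L / n + 1))"
  proof (intro sum_mono)
    fix n assume n: "n \<in> {2..2 * H}"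
    have "{a\<in>{int H..<2 * int H}. int n dvd a} = {b::int. real H \<le> real_of_int b \<and> real_of_int b < real H + H \<and> int n dvd b}"
      by auto
    then have 1: "real (card {a\<in>{int H..<2 * int H}. int n dvd a}) \<le> H / n + 1"
      using card_multiples_Ico_le[of n "real H" "real H"] n by simp
    have 2: "real (card {b\<in>J a. int n dvd b}) \<le> L / n + 1" for a
      using card_multiples_Ico_le[of n L "f a"] n L by (simp add: J_def conj_assoc)
    have "real (card (B n)) = (\<Sum>a\<in>{a\<in>{int H..<2 * int H}. int n dvd a}. real (card {b\<in>J a. int n dvd b}))"
    proof -
      have "finite {a\<in>{int H..<2 * int H}. int n dvd a}" by (rule finite_subset[of _ "{int H..<2 * int H}"]) auto
      then show ?thesis unfolding B_def using finJ by (subst card_SigmaI) auto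
    qed
    also have "\<dots> \<le> (\<Sum>a\<in>{a\<in>{int H..<2 * int H}. int n dvd a}. L / n + 1)" by (intro sum_mono 2)
    also have "\<dots> \<le> (H / n + 1) * (L / n + 1)" using 1 L by (simp add: mult_right_mono)
    finally show "real (card (B n)) \<le> (H / n + 1) * (L / n + 1)" .
  qed
  \<comment> \<open>Expanding separates the main term, of density \<open>1 / n ^ 2\<close>, from the
    boundary errors.\<close>
  also have "(\<Sum>n\<in>{2..2 * H}. (H / n + 1) * (L / n + 1))
      = H * L * (\<Sum>n=2..2 * H. 1 / (real n)\<^sup>2) + (H + L) * (\<Sum>n=2..2 * H. 1 / real n) + (\<Sum>n=2..2 * H. 1)"
    unfolding sum_distrib_left sum.distrib[symmetric]
    by (intro sum.cong refl) (simp add: field_simps power2_eq_square)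
  also have "\<dots> \<le> H * L * (3 / 4) + (H + L) * (2 * sqrt (2 * H)) + 2 * H"
  proof (intro add_mono mult_left_mono sum_inverse_squares_le)
    have "(\<Sum>n=2..2 * H. 1 / real n) \<le> (\<Sum>n=1..2 * H. 1 / real n)" by (intro sum_mono2) auto
    then show "(\<Sum>n=2..2 * H. 1 / real n) \<le> 2 * sqrt (2 * H)"
      using sum_inverse_le_sqrt[of "2 * H"] by simp
  qed (use L in auto)
  finally show ?thesis unfolding G_def by (simp add: algebra_simps)
qed

text \<open>For windows of length \<open>\<kappa> * H\<close> the main term is
  \<open>\<kappa> * H ^ 2 / 4\<close> and the error has order \<open>H\<close> to the power 3/2, so
  half of the main term survives. The threshold for \<open>H\<close> does not depend on
  \<open>f\<close>, because the windows will depend on all the other coordinates.\<close>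

lemma card_coprime_pairs_ge_quadratic:
  fixes \<kappa> :: real
  assumes "\<kappa> > 0"
  shows "\<forall>\<^sub>F H :: nat in sequentially. \<forall>f :: int \<Rightarrow> real. \<kappa> * real H ^ 2 / 8
    \<le> real (card {(a::int, b::int). H \<le> a \<and> a < 2 * H \<and> f a \<le> b \<and> b < f a + \<kappa> * H \<and> coprime a b})"
proof -
  \<comment> \<open>Chosen so that the error is at most \<open>H * s * A\<close> with
    \<open>s = sqrt H\<close>; the 3 is \<open>2 * (3 / 2)\<close>, from
    \<open>sqrt 2 \<le> 3 / 2\<close>.\<close>
  define A where "A = 5 + 3 * (1 + \<kappa>)"
  have "\<forall>\<^sub>F H :: nat in sequentially. max 1 (8 * A / \<kappa>) ^ 2 \<le> real H"
    using filterlim_real_sequentially by (simp add: filterlim_at_top)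
  then show ?thesis
  proof eventually_elim
    case (elim H)
    define s where "s = sqrt H"
    have s: "max 1 (8 * A / \<kappa>) \<le> s" unfolding s_def by (rule real_le_rsqrt) (use elim in simp)
    then have s1: "1 \<le> s" and s2: "A \<le> \<kappa> * s / 8" using assms by (auto simp: field_simps)
    have H: "real H = s * s" by (simp add: s_def)
    have sq: "sqrt (2 * H) \<le> 3 / 2 * s"
      by (rule real_le_lsqrt) (auto simp: s_def power_mult_distrib power2_eq_square)
    have "5 * H + 2 * (H + \<kappa> * H) * sqrt (2 * H) \<le> 5 * H * s + 2 * (H + \<kappa> * H) * (3 / 2 * s)"
      using s1 assms by (intro add_mono mult_left_mono sq) (auto simp: mult_le_cancel_left1)
    also have "\<dots> = H * s * A" by (simp add: A_def algebra_simps)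
    also have "\<dots> \<le> H * s * (\<kappa> * s / 8)" using s1 s2 by (intro mult_left_mono) auto
    also have "\<dots> = \<kappa> * real H ^ 2 / 8" by (simp add: H power2_eq_square)
    finally have "\<kappa> * real H ^ 2 / 8 \<le> H * (\<kappa> * H) / 4 - (5 * H + 2 * (H + \<kappa> * H) * sqrt (2 * H))"
      by (simp add: power2_eq_square)
    moreover have "H > 0" using H s1 by (intro gr0I) auto
    ultimately show ?case
      using card_coprime_pairs_ge[of H "\<kappa> * H"] assms by (meson mult_nonneg_nonneg of_nat_0_le_iff less_imp_le order_trans)
  qed
qed

section \<open>Comparison of sums, and sums of inverse square roots of distances\<close>

lemma sum_le_sum_inj_on:
  fixes f :: "'a \<Rightarrow> real"
  assumes "inj_on \<phi> A" "\<phi> ` A \<subseteq> B" "finite B"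
    and "\<And>x. x \<in> A \<Longrightarrow> f x \<le> g (\<phi> x)" "\<And>b. b \<in> B \<Longrightarrow> 0 \<le> g b"
  shows "sum f A \<le> sum g B"
proof -
  have "sum f A \<le> (\<Sum>x\<in>A. g (\<phi> x))" using assms by (intro sum_mono)
  also have "\<dots> = sum g (\<phi> ` A)" using assms(1) by (simp add: sum.reindex)
  also have "\<dots> \<le> sum g B" using assms by (intro sum_mono2) auto
  finally show ?thesis .
qed

text \<open>The function \<open>sqrt\<close> is odd on the reals, so its increments are positive on
  both sides of 0 and one telescoping sum covers points on either side of the centre. Near 0 the
  increment is \<open>sqrt (x + 1 / 2) + sqrt (1 / 2 - x)\<close>, which is at least 1 by
  subadditivity.\<close>

lemma inverse_sqrt_le_sqrt_increment:
  "1 / sqrt (max 1 \<bar>x\<bar>) \<le> 2 * (sqrt (x + 1 / 2) - sqrt (x - 1 / 2))"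
proof -
  have pos: "1 / sqrt (max 1 x) \<le> 2 * (sqrt (x + 1 / 2) - sqrt (x - 1 / 2))" if x: "x \<ge> 1 / 2" for x :: real
  proof -
    define u where "u = sqrt (x + 1 / 2)"
    define v where "v = sqrt (x - 1 / 2)"
    have uv: "u\<^sup>2 = x + 1 / 2" "v\<^sup>2 = x - 1 / 2" "u > 0" "v \<ge> 0" using x by (auto simp: u_def v_def)
    have "(u + v)\<^sup>2 \<le> 2 * (u\<^sup>2 + v\<^sup>2)" using zero_le_power2[of "u - v"] by (simp add: power2_sum power2_diff)
    also have "\<dots> \<le> 4 * max 1 x" using uv by simp
    finally have "u + v \<le> sqrt (4 * max 1 x)" by (rule real_le_rsqrt)
    then have le: "u + v \<le> 2 * sqrt (max 1 x)" by (simp add: real_sqrt_mult)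
    have "(u - v) * (u + v) = 1" using uv by (simp add: power2_eq_square algebra_simps)
    then have "u - v = 1 / (u + v)" using uv by (simp add: eq_divide_eq)
    also have "1 / (u + v) \<ge> 1 / (2 * sqrt (max 1 x))" using uv le by (intro divide_left_mono) auto
    finally show ?thesis by (simp add: u_def v_def)
  qed
  consider "x \<ge> 1 / 2" | "x \<le> - 1 / 2" | "\<bar>x\<bar> < 1 / 2" by linarith
  then show ?thesis
  proof cases
    case 1 then show ?thesis using pos[of x] by simp
  next
    case 2
    have "sqrt (- x + 1 / 2) = - sqrt (x - 1 / 2)" "sqrt (- x - 1 / 2) = - sqrt (x + 1 / 2)"
      by (simp_all flip: real_sqrt_minus)
    with 2 pos[of "- x"] show ?thesis by simp
  next
    case 3
    have "sqrt (x - 1 / 2) = - sqrt (1 / 2 - x)" by (simp flip: real_sqrt_minus)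
    moreover have "1 \<le> sqrt (x + 1 / 2) + sqrt (1 / 2 - x)"
      using sqrt_add_le_add_sqrt[of "x + 1 / 2" "1 / 2 - x"] 3 by simp
    ultimately show ?thesis using 3 by simp
  qed
qed

text \<open>Subadditivity of \<open>sqrt\<close>; the factor 2 pays for endpoints of opposite sign,
  again with the odd extension.\<close>

lemma sqrt_diff_le:
  assumes "a \<le> b" shows "sqrt b - sqrt a \<le> 2 * sqrt (b - a)"
proof -
  have pos: "sqrt b - sqrt a \<le> sqrt (b - a)" if "0 \<le> a" "a \<le> b" for a b :: real
    using sqrt_add_le_add_sqrt[of a "b - a"] that by simp
  have nn: "sqrt (b - a) \<ge> 0" using assms by simp
  consider "0 \<le> a" | "b \<le> 0" | "a < 0" "0 < b" by linarith
  then show ?thesis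
  proof cases
    case 1 then show ?thesis using pos[of a b] assms nn by linarith
  next
    case 2 then have "sqrt b - sqrt a \<le> sqrt (b - a)" using pos[of "- b" "- a"] assms by (simp add: real_sqrt_minus)
    with nn show ?thesis by linarith
  next
    case 3
    then have "sqrt b \<le> sqrt (b - a)" "sqrt (- a) \<le> sqrt (b - a)" by auto
    then show ?thesis unfolding real_sqrt_minus by linarith
  qed
qed

text \<open>The bound is uniform in \<open>c\<close>, which will be the real point at which a minor
  vanishes and may lie anywhere.\<close>

lemma sum_inverse_sqrt_dist_le:
  "(\<Sum>v\<in>{int n..<2 * int n}. 1 / sqrt (max 1 \<bar>c - real_of_int v\<bar>)) \<le> 4 * sqrt n"
proof -
  define f where "f j = sqrt (real n + real j - c - 1 / 2)" for j :: nat
  have "{int n..<2 * int n} = (\<lambda>j. int n + int j) ` {..<n}"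
  proof (intro equalityI subsetI)
    fix v assume "v \<in> {int n..<2 * int n}"
    then show "v \<in> (\<lambda>j. int n + int j) ` {..<n}" by (intro image_eqI[of _ _ "nat (v - int n)"]) auto
  qed auto
  then have "(\<Sum>v\<in>{int n..<2 * int n}. 1 / sqrt (max 1 \<bar>c - real_of_int v\<bar>))
      = (\<Sum>j<n. 1 / sqrt (max 1 \<bar>c - (real n + real j)\<bar>))"
    by (simp add: sum.reindex inj_on_def)
  also have "\<dots> \<le> (\<Sum>j<n. 2 * (f (Suc j) - f j))"
  proof (intro sum_mono)
    fix j
    show "1 / sqrt (max 1 \<bar>c - (real n + real j)\<bar>) \<le> 2 * (f (Suc j) - f j)"
      using inverse_sqrt_le_sqrt_increment[of "real n + real j - c"]
      by (simp add: f_def abs_minus_commute algebra_simps)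
  qed
  also have "\<dots> = 2 * (f n - f 0)" by (simp only: sum_distrib_left[symmetric] sum_lessThan_telescope)
  also have "\<dots> \<le> 4 * sqrt n"
    using sqrt_diff_le[of "real n + real 0 - c - 1 / 2" "real n + real n - c - 1 / 2"] by (simp add: f_def)
  finally show ?thesis .
qed

section \<open>Slabs in finite products of the Lebesgue measure\<close>

lemma sets_slice:
  assumes "finite I" "A \<in> sets (\<Pi>\<^sub>M i\<in>insert i I. (lborel :: real measure))"
    and "x \<in> space (\<Pi>\<^sub>M i\<in>I. (lborel :: real measure))"
  shows "{z. x(i := z) \<in> A} \<in> sets borel"
proof -
  have "(\<lambda>z. (x, z)) \<in> measurable lborel ((\<Pi>\<^sub>M i\<in>I. (lborel :: real measure)) \<Otimes>\<^sub>M lborel)"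
    using assms(3) by simp
  from measurable_comp[OF this measurable_add_dim[of i I "\<lambda>_. lborel"]]
  have "(\<lambda>z. x(i := z)) \<in> measurable lborel (\<Pi>\<^sub>M i\<in>insert i I. (lborel :: real measure))"
    by (simp add: comp_def)
  from measurable_sets[OF this assms(2)] show ?thesis by (simp add: vimage_def)
qed

lemma emeasure_PiM_insert_slice:
  assumes "finite I" "i \<notin> I" and A: "A \<in> sets (\<Pi>\<^sub>M i\<in>insert i I. (lborel :: real measure))"
  shows "emeasure (\<Pi>\<^sub>M i\<in>insert i I. lborel) A
    = (\<integral>\<^sup>+ x. emeasure lborel {z. x(i := z) \<in> A} \<partial>(\<Pi>\<^sub>M i\<in>I. lborel))"
proof -
  interpret product_sigma_finite "\<lambda>_ :: 'a. lborel :: real measure" ..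
  have "emeasure (\<Pi>\<^sub>M i\<in>insert i I. lborel) A = (\<integral>\<^sup>+ x. indicator A x \<partial>(\<Pi>\<^sub>M i\<in>insert i I. lborel))"
    using A by simp
  also have "\<dots> = (\<integral>\<^sup>+ x. (\<integral>\<^sup>+ z. indicator A (x(i := z)) \<partial>lborel) \<partial>(\<Pi>\<^sub>M i\<in>I. lborel))"
    using assms by (intro product_nn_integral_insert) auto
  also have "\<dots> = (\<integral>\<^sup>+ x. emeasure lborel {z. x(i := z) \<in> A} \<partial>(\<Pi>\<^sub>M i\<in>I. lborel))"
  proof (rule nn_integral_cong)
    fix x assume "x \<in> space (\<Pi>\<^sub>M i\<in>I. (lborel :: real measure))"
    then have s: "{z. x(i := z) \<in> A} \<in> sets borel" using assms by (intro sets_slice)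
    have "(\<integral>\<^sup>+ z. indicator A (x(i := z)) \<partial>lborel) = (\<integral>\<^sup>+ z. indicator {z. x(i := z) \<in> A} z \<partial>lborel)"
      by (intro nn_integral_cong) (simp add: indicator_def)
    with s show "(\<integral>\<^sup>+ z. indicator A (x(i := z)) \<partial>lborel) = emeasure lborel {z. x(i := z) \<in> A}" by simp
  qed
  finally show ?thesis .
qed

lemma emeasure_PiM_box:
  assumes "finite I" "\<rho> \<ge> 0"
  shows "{x \<in> space (\<Pi>\<^sub>M i\<in>I. lborel). \<forall>i\<in>I. \<bar>x i\<bar> \<le> \<rho>} \<in> sets (\<Pi>\<^sub>M i\<in>I. (lborel :: real measure))"
    and "emeasure (\<Pi>\<^sub>M i\<in>I. lborel) {x \<in> space (\<Pi>\<^sub>M i\<in>I. (lborel :: real measure)). \<forall>i\<in>I. \<bar>x i\<bar> \<le> \<rho>}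
      = ennreal ((2 * \<rho>) ^ card I)"
proof -
  interpret product_sigma_finite "\<lambda>_ :: 'a. lborel :: real measure" ..
  have eq: "{x \<in> space (\<Pi>\<^sub>M i\<in>I. (lborel :: real measure)). \<forall>i\<in>I. \<bar>x i\<bar> \<le> \<rho>} = (\<Pi>\<^sub>E i\<in>I. {-\<rho>..\<rho>})"
    by (auto simp: space_PiM PiE_def Pi_def abs_le_iff minus_le_iff)
  show "{x \<in> space (\<Pi>\<^sub>M i\<in>I. lborel). \<forall>i\<in>I. \<bar>x i\<bar> \<le> \<rho>} \<in> sets (\<Pi>\<^sub>M i\<in>I. (lborel :: real measure))"
    unfolding eq using assms by (intro sets_PiM_I_finite) auto
  have "emeasure (\<Pi>\<^sub>M i\<in>I. lborel) (\<Pi>\<^sub>E i\<in>I. {-\<rho>..\<rho>}) = (\<Prod>i\<in>I. ennreal (2 * \<rho>))"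
    using assms by (subst emeasure_PiM) auto
  also have "\<dots> = ennreal ((2 * \<rho>) ^ card I)" using assms by (simp add: ennreal_power)
  finally show "emeasure (\<Pi>\<^sub>M i\<in>I. lborel) {x \<in> space (\<Pi>\<^sub>M i\<in>I. (lborel :: real measure)). \<forall>i\<in>I. \<bar>x i\<bar> \<le> \<rho>}
      = ennreal ((2 * \<rho>) ^ card I)" by (simp only: eq)
qed

lemma emeasure_strip_le:
  assumes "m \<noteq> (0::real)" "\<delta> \<ge> 0"
  shows "emeasure lborel {z. \<bar>z * m - c\<bar> \<le> \<delta>} \<le> ennreal (2 * \<delta> / \<bar>m\<bar>)"
proof -
  have "{z. \<bar>z * m - c\<bar> \<le> \<delta>} \<subseteq> {c / m - \<delta> / \<bar>m\<bar>..c / m + \<delta> / \<bar>m\<bar>}"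
  proof
    fix z assume "z \<in> {z. \<bar>z * m - c\<bar> \<le> \<delta>}"
    moreover have "\<bar>z * m - c\<bar> = \<bar>z - c / m\<bar> * \<bar>m\<bar>" using assms(1) by (simp add: abs_mult[symmetric] algebra_simps)
    ultimately have "\<bar>z - c / m\<bar> \<le> \<delta> / \<bar>m\<bar>" using assms(1) by (simp add: pos_le_divide_eq)
    then show "z \<in> {c / m - \<delta> / \<bar>m\<bar>..c / m + \<delta> / \<bar>m\<bar>}" by (auto simp: abs_le_iff)
  qed
  then have "emeasure lborel {z. \<bar>z * m - c\<bar> \<le> \<delta>} \<le> emeasure lborel {c / m - \<delta> / \<bar>m\<bar>..c / m + \<delta> / \<bar>m\<bar>}"
    by (intro emeasure_mono) auto
  also have "\<dots> = ennreal (2 * \<delta> / \<bar>m\<bar>)" using assms by (subst emeasure_lborel_Icc) auto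
  finally show ?thesis .
qed

text \<open>Integrating coordinate \<open>j\<close> first leaves a set of length at most
  \<open>2 * \<delta> / \<bar>m j\<bar>\<close> over each point of the box in the other
  coordinates.\<close>

lemma emeasure_slab_le:
  fixes I :: "'i set" and m :: "'i \<Rightarrow> real"
  defines "M \<equiv> \<Pi>\<^sub>M i\<in>I. (lborel :: real measure)"
  assumes I: "finite I" and j: "j \<in> I" "m j \<noteq> 0" and \<delta>: "\<delta> \<ge> 0" and \<rho>: "\<rho> \<ge> 0"
  shows "emeasure M {x \<in> space M. (\<forall>i\<in>I. \<bar>x i\<bar> \<le> \<rho>) \<and> \<bar>(\<Sum>i\<in>I. x i * m i) - c\<bar> \<le> \<delta>}
    \<le> ennreal (2 * \<delta> / \<bar>m j\<bar> * (2 * \<rho>) ^ (card I - 1))"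
proof -
  define J where "J = I - {j}"
  have IJ: "I = insert j J" "j \<notin> J" "finite J" using I j by (auto simp: J_def)
  let ?A = "{x \<in> space M. (\<forall>i\<in>I. \<bar>x i\<bar> \<le> \<rho>) \<and> \<bar>(\<Sum>i\<in>I. x i * m i) - c\<bar> \<le> \<delta>}"
  let ?B = "{x \<in> space (\<Pi>\<^sub>M i\<in>J. (lborel :: real measure)). \<forall>i\<in>J. \<bar>x i\<bar> \<le> \<rho>}"
  have A: "?A \<in> sets M" unfolding M_def using I by measurable
  have "emeasure M ?A = (\<integral>\<^sup>+ x. emeasure lborel {z. x(j := z) \<in> ?A} \<partial>(\<Pi>\<^sub>M i\<in>J. lborel))"
    using A IJ unfolding M_def IJ(1) by (intro emeasure_PiM_insert_slice) auto
  also have "\<dots> \<le> (\<integral>\<^sup>+ x. ennreal (2 * \<delta> / \<bar>m j\<bar>) * indicator ?B x \<partial>(\<Pi>\<^sub>M i\<in>J. lborel))"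
  proof (rule nn_integral_mono)
    fix x assume x: "x \<in> space (\<Pi>\<^sub>M i\<in>J. (lborel :: real measure))"
    show "emeasure lborel {z. x(j := z) \<in> ?A} \<le> ennreal (2 * \<delta> / \<bar>m j\<bar>) * indicator ?B x"
    proof (cases "x \<in> ?B")
      case True
      have "(\<Sum>i\<in>I. (x(j := z)) i * m i) = z * m j + (\<Sum>i\<in>J. x i * m i)" for z
        unfolding IJ(1) using IJ by (simp, intro sum.cong) auto
      then have "{z. x(j := z) \<in> ?A} \<subseteq> {z. \<bar>z * m j - (c - (\<Sum>i\<in>J. x i * m i))\<bar> \<le> \<delta>}"
        by (auto simp: algebra_simps)
      then have "emeasure lborel {z. x(j := z) \<in> ?A} \<le> emeasure lborel {z. \<bar>z * m j - (c - (\<Sum>i\<in>J. x i * m i))\<bar> \<le> \<delta>}"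
        by (intro emeasure_mono) auto
      also have "\<dots> \<le> ennreal (2 * \<delta> / \<bar>m j\<bar>)" using j \<delta> by (intro emeasure_strip_le)
      finally show ?thesis using True by simp
    next
      case False
      have "{z. x(j := z) \<in> ?A} = {}"
      proof (intro equals0I, clarify)
        fix z assume *: "\<forall>i\<in>I. \<bar>(x(j := z)) i\<bar> \<le> \<rho>"
        have "\<bar>x i\<bar> \<le> \<rho>" if "i \<in> J" for i using *[rule_format, of i] that IJ by (auto split: if_splits)
        with x False show False by auto
      qed
      then show ?thesis by (simp only: emeasure_empty zero_le)
    qed
  qed
  also have "\<dots> = ennreal (2 * \<delta> / \<bar>m j\<bar>) * ennreal ((2 * \<rho>) ^ card J)"
    using emeasure_PiM_box[OF IJ(3) \<rho>] by (subst nn_integral_cmult_indicator) auto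
  also have "\<dots> = ennreal (2 * \<delta> / \<bar>m j\<bar> * (2 * \<rho>) ^ (card I - 1))"
    using \<delta> \<rho> IJ by (subst ennreal_mult[symmetric]) auto
  finally show ?thesis .
qed

lemma fmeasurable_Icc: "{a..b :: real} \<in> fmeasurable lborel"
  by (auto intro!: fmeasurableI simp: emeasure_lborel_Icc_eq)

text \<open>The centre \<open>c / q1\<close> of the strip may be an endpoint of the piece, but then
  one half of the strip still lies inside. This is why \<open>B\<close> is one-sided and the bound
  is \<open>r / (2 * h)\<close>.\<close>

lemma measure_strip_Ico_ge:
  fixes \<kappa> :: real
  assumes q1: "0 < q1" "q1 < 2 * h" and \<sigma>: "a * q1 \<le> c" "c \<le> (a + \<kappa>) * q1"
    and r: "0 \<le> r" "r / h \<le> \<kappa>"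
  shows "r / (2 * h) \<le> measure lborel {z::real. a \<le> z \<and> z < a + \<kappa> \<and> \<bar>z * q1 - c\<bar> \<le> r}"
proof -
  define z0 where "z0 = c / q1"
  define \<rho> where "\<rho> = r / (2 * h)"
  have h: "h > 0" using q1 by simp
  have z0: "a \<le> z0" "z0 \<le> a + \<kappa>" using \<sigma> q1 by (simp_all add: z0_def pos_le_divide_eq pos_divide_le_eq)
  have \<rho>: "0 \<le> \<rho>" "\<rho> \<le> \<kappa> / 2" using r h by (simp_all add: \<rho>_def)
  have le: "\<bar>z * q1 - c\<bar> \<le> r" if "\<bar>z - z0\<bar> \<le> \<rho>" for z
  proof -
    have "z * q1 - c = (z - z0) * q1" using q1 by (simp add: z0_def algebra_simps)
    then have "\<bar>z * q1 - c\<bar> = \<bar>z - z0\<bar> * q1" using q1 by (simp add: abs_mult)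
    also have "\<dots> \<le> \<rho> * (2 * h)" using that q1 \<rho> by (intro mult_mono) auto
    also have "\<dots> = r" using h by (simp add: \<rho>_def)
    finally show ?thesis .
  qed
  define B where "B = (if z0 \<le> a + \<kappa> / 2 then {z0<..<z0 + \<rho>} else {z0 - \<rho><..<z0})"
  have "B \<subseteq> {z. a \<le> z \<and> z < a + \<kappa> \<and> \<bar>z * q1 - c\<bar> \<le> r}"
    using z0 \<rho> by (auto simp: B_def intro!: le split: if_splits)
  moreover have "{z. a \<le> z \<and> z < a + \<kappa> \<and> \<bar>z * q1 - c\<bar> \<le> r} \<in> fmeasurable lborel"
    by (rule fmeasurableI2[OF fmeasurable_Icc[of a "a + \<kappa>"]]) auto
  moreover have "B \<in> sets lborel" by (simp add: B_def)
  ultimately have "measure lborel B \<le> measure lborel {z. a \<le> z \<and> z < a + \<kappa> \<and> \<bar>z * q1 - c\<bar> \<le> r}"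
    by (intro measure_mono_fmeasurable)
  moreover have "measure lborel B = \<rho>" using \<rho> by (simp add: B_def)
  ultimately show ?thesis by (simp add: \<rho>_def)
qed

text \<open>The hyperplane is a countable union of slabs of thickness 0 in growing boxes.\<close>

lemma AE_PiM_component_nonzero:
  assumes "finite I" "i \<in> I"
  shows "AE x in (\<Pi>\<^sub>M i\<in>I. lborel). x i \<noteq> (0::real)"
proof -
  let ?M = "\<Pi>\<^sub>M i\<in>I. (lborel :: real measure)"
  let ?m = "\<lambda>j. if j = i then 1 else 0 :: real"
  define F where "F n = {x \<in> space ?M. (\<forall>j\<in>I. \<bar>x j\<bar> \<le> real n) \<and> \<bar>(\<Sum>j\<in>I. x j * ?m j) - 0\<bar> \<le> 0}" for n :: nat
  have "F n \<in> null_sets ?M" for n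
  proof (rule null_setsI)
    show "emeasure ?M (F n) = 0"
      using emeasure_slab_le[OF assms, of ?m 0 "real n" 0] unfolding F_def by simp
    show "F n \<in> sets ?M" unfolding F_def using assms by measurable
  qed
  then have "(\<Union>n. F n) \<in> null_sets ?M" by (intro null_sets_UN) auto
  moreover have "{x \<in> space ?M. \<not> x i \<noteq> 0} \<subseteq> (\<Union>n. F n)"
  proof
    fix x assume x: "x \<in> {x \<in> space ?M. \<not> x i \<noteq> 0}"
    obtain n where n: "(\<Sum>j\<in>I. \<bar>x j\<bar>) \<le> real n" using real_arch_simple by blast
    have "\<bar>x j\<bar> \<le> real n" if "j \<in> I" for j
      using member_le_sum[of j I "\<lambda>j. \<bar>x j\<bar>"] that assms(1) n by simp
    moreover have "(\<Sum>j\<in>I. x j * ?m j) = 0"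
      using x by (intro sum.neutral) auto
    ultimately show "x \<in> (\<Union>n. F n)" using x by (auto simp: F_def)
  qed
  ultimately show ?thesis by (rule AE_I')
qed

section \<open>Divergent series\<close>

lemma not_summable_iff_filterlim_at_top:
  fixes u :: "nat \<Rightarrow> real"
  assumes "\<And>n. 0 \<le> u n"
  shows "\<not> summable u \<longleftrightarrow> filterlim (\<lambda>N. \<Sum>t<N. u t) at_top sequentially"
proof
  assume "filterlim (\<lambda>N. \<Sum>t<N. u t) at_top sequentially"
  then have "filterlim (\<lambda>N. \<Sum>t<N. u t) at_infinity sequentially"
    by (rule filterlim_at_top_imp_at_infinity)
  then show "\<not> summable u"
    using summable_LIMSEQ not_tendsto_and_filterlim_at_infinity[OF sequentially_bot] by blast
next
  assume ns: "\<not> summable u"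
  show "filterlim (\<lambda>N. \<Sum>t<N. u t) at_top sequentially"
    unfolding filterlim_at_top eventually_sequentially
  proof
    fix Z
    have "\<exists>N. Z < (\<Sum>t<N. u t)"
      using ns summableI_nonneg_bounded[of u Z] assms by (meson not_less)
    then obtain N where "Z < (\<Sum>t<N. u t)" by blast
    moreover have "(\<Sum>t<N. u t) \<le> (\<Sum>t<n. u t)" if "N \<le> n" for n
      using assms that by (intro sum_mono2) auto
    ultimately show "\<exists>N. \<forall>n\<ge>N. Z \<le> (\<Sum>t<n. u t)" by force
  qed
qed

text \<open>If the truncated series converged, its terms would eventually be below
  \<open>\<epsilon>\<close>, hence equal to those of \<open>u\<close>.\<close>

lemma not_summable_min:
  fixes u :: "nat \<Rightarrow> real"
  assumes u: "\<And>n. 0 \<le> u n" "\<not> summable u" and \<epsilon>: "\<epsilon> > 0"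
  shows "\<not> summable (\<lambda>n. min (u n) \<epsilon>)"
proof
  assume s: "summable (\<lambda>n. min (u n) \<epsilon>)"
  then have "\<forall>\<^sub>F n in sequentially. min (u n) \<epsilon> < \<epsilon>"
    using summable_LIMSEQ_zero \<epsilon> by (intro order_tendstoD)
  then have "\<forall>\<^sub>F n in sequentially. min (u n) \<epsilon> = u n"
    by eventually_elim (auto simp: min_def split: if_splits)
  from summable_cong[OF this] s u(2) show False by simp
qed

text \<open>Cauchy condensation with ratio 4: the block from \<open>2 * 4 ^ N\<close> to
  \<open>2 * 4 ^ Suc N\<close> contains \<open>6 * 4 ^ N\<close> integers. The argument
  \<open>2 * 4 ^ t\<close> is the bound for the height of points of level \<open>t\<close>.\<close>

lemma condensation_4_filterlim:
  fixes f :: "nat \<Rightarrow> real"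
  assumes nonneg: "\<And>n. n \<ge> 1 \<Longrightarrow> 0 \<le> f n"
    and dec: "\<And>m n. 1 \<le> m \<Longrightarrow> m \<le> n \<Longrightarrow> f n \<le> f m"
    and div: "filterlim (\<lambda>N. \<Sum>j=1..N. f j) at_top sequentially"
  shows "\<not> summable (\<lambda>t. 4 ^ t * f (2 * 4 ^ t))"
proof
  let ?u = "\<lambda>t. 4 ^ t * f (2 * 4 ^ t)"
  assume s: "summable ?u"
  have u0: "0 \<le> ?u t" for t using nonneg[of "2 * 4 ^ t"] by simp
  have le: "(\<Sum>j=1..2 * 4 ^ N. f j) \<le> f 1 + f 2 + 6 * (\<Sum>t<N. ?u t)" for N
  proof (induction N)
    case 0
    have "{1..2::nat} = {1, 2}" by auto
    then show ?case by simp
  next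
    case (Suc N)
    have "{1..2 * 4 ^ Suc N} = {1..2 * 4 ^ N} \<union> {2 * 4 ^ N<..2 * 4 ^ Suc N :: nat}" by auto
    then have "(\<Sum>j=1..2 * 4 ^ Suc N. f j) = (\<Sum>j=1..2 * 4 ^ N. f j) + (\<Sum>j\<in>{2 * 4 ^ N<..2 * 4 ^ Suc N}. f j)"
      by (simp only:) (intro sum.union_disjoint, auto)
    also have "(\<Sum>j\<in>{2 * 4 ^ N<..2 * 4 ^ Suc N}. f j) \<le> (\<Sum>j\<in>{2 * 4 ^ N<..2 * 4 ^ Suc N :: nat}. f (2 * 4 ^ N))"
      by (intro sum_mono dec) auto
    also have "\<dots> = 6 * ?u N" by simp
    finally show ?case using Suc by simp
  qed
  obtain N where N: "\<And>n. n \<ge> N \<Longrightarrow> f 1 + f 2 + 6 * suminf ?u + 1 \<le> (\<Sum>j=1..n. f j)"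
    using div unfolding filterlim_at_top eventually_sequentially by meson
  have "N \<le> 2 * 4 ^ N" using power_gt_expt[of 4 N] by simp
  from N[OF this] le[of N] sum_le_suminf[OF s, of "{..<N}"] u0 show False by force
qed

section \<open>Levels of integer points\<close>

text \<open>\<open>p t\<close> stands for the truncated value of \<open>\<psi>\<close>, and the last
  assumption is \<open>w t \<le> 1\<close> for the weight defined below. \<open>R\<close> determines
  the bounded region.\<close>

locale block_coprime_forms =
  fixes k R :: nat and y :: real and p :: "nat \<Rightarrow> real"
  assumes k: "k \<ge> 1" and R: "R \<ge> 1"
    and p_nonneg: "\<And>t. 0 \<le> p t"
    and p_decseq: "\<And>s t. s \<le> t \<Longrightarrow> p t \<le> p s"
    and p_le: "\<And>t. p t * (4 ^ t) ^ (2 * k - 1) \<le> 1"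
begin

definition d :: nat where "d = 2 * k"
definition H :: "nat \<Rightarrow> nat" where "H t = 4 ^ t"
text \<open>Solving for the last entry means dividing a quantity of size at most
  \<open>(\<bar>y\<bar> + 2 * d * R) * H t\<close> by a coordinate of modulus at least
  \<open>1 / R\<close>; the summand 1 leaves room for the window around the solution.\<close>

definition K :: real where "K = R * (\<bar>y\<bar> + 2 * d * R) + 1"
text \<open>The order of the expected number of hits: about \<open>H t ^ d\<close> vectors, each
  with a strip of measure about \<open>p t / H t\<close>.\<close>

definition w :: "nat \<Rightarrow> real" where "w t = p t * H t ^ (d - 1)"

abbreviation M :: "(nat \<Rightarrow> real) measure" where "M \<equiv> \<Pi>\<^sub>M i\<in>{1..d}. lborel"
abbreviation M' :: "(nat \<Rightarrow> real) measure" where "M' \<equiv> \<Pi>\<^sub>M i\<in>{2..d}. lborel"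

text \<open>The projection of \<open>Q\<close> along coordinate 1. The lower bound on the last
  coordinate makes the last entry of \<open>q\<close> solvable within \<open>K * H t\<close>, and
  for \<open>k = 1\<close> it bounds the minors.\<close>

definition Q' :: "(nat \<Rightarrow> real) set" where
  "Q' = {x \<in> space M'. (\<forall>i\<in>{2..d}. \<bar>x i\<bar> \<le> R) \<and> 1 / R \<le> \<bar>x d\<bar>}"

text \<open>The range of coordinate 1 is half-open with integer ends, so membership depends on that
  coordinate through its floor alone.\<close>

definition Q :: "(nat \<Rightarrow> real) set" where
  "Q = {\<alpha> \<in> space M. - real R \<le> \<alpha> 1 \<and> \<alpha> 1 < R \<and> (\<forall>i\<in>{2..d}. \<bar>\<alpha> i\<bar> \<le> R) \<and> 1 / R \<le> \<bar>\<alpha> d\<bar>}"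

definition E :: "nat \<Rightarrow> (nat \<Rightarrow> int) \<Rightarrow> (nat \<Rightarrow> real) set" where
  "E t q = {\<alpha> \<in> space M. \<bar>linear_form d \<alpha> q - y\<bar> \<le> p t}"

text \<open>All entries but the last are positive and of size \<open>H t\<close>, which fixes the
  height up to a factor 2. The bound on the last entry keeps the number of points of order
  \<open>H t ^ d\<close>.\<close>

definition S :: "nat \<Rightarrow> (nat \<Rightarrow> int) set" where
  "S t = {q \<in> integer_points d. (\<forall>i\<in>{1..<d}. H t \<le> q i \<and> q i < 2 * H t) \<and>
    (\<forall>i\<in>{1..k}. gcd (q (2 * i - 1)) (q (2 * i)) = 1) \<and> \<bar>q d\<bar> \<le> K * H t}"

lemma d_ge: "2 \<le> d" and d_simps [simp]: "Suc 0 \<le> d" "0 < d" "d - Suc 0 \<noteq> d"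
  using k by (auto simp: d_def)

lemma H_pos: "0 < H t" and H_ge_1: "1 \<le> H t" by (auto simp: H_def)

lemma insert_1: "{1..d} = insert 1 {2..d}" using d_ge by auto

lemma K_ge_1: "K \<ge> 1" and K_pos: "K > 0" unfolding K_def by (auto intro: add_nonneg_pos)

lemma w_nonneg: "0 \<le> w t" and w_le_1: "w t \<le> 1"
  using p_nonneg[of t] p_le[of t] by (simp_all add: w_def H_def d_def)

lemma S_first:
  assumes "q \<in> S t"
  shows "real (H t) \<le> q 1" "q 1 < 2 * real (H t)" "q 1 > 0"
proof -
  have "int (H t) \<le> q 1" "q 1 < 2 * int (H t)" using assms d_ge by (auto simp: S_def)
  then show "real (H t) \<le> q 1" "q 1 < 2 * real (H t)" "q 1 > 0"
    using H_pos[of t] by linarith+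
qed

lemma finite_S: "finite (S t)"
proof (rule finite_subset)
  let ?N = "max (2 * int (H t)) \<lceil>K * H t\<rceil>"
  show "finite (\<Pi>\<^sub>E i\<in>{1..d}. {- ?N..?N})" by (intro finite_PiE) auto
  show "S t \<subseteq> (\<Pi>\<^sub>E i\<in>{1..d}. {- ?N..?N})"
  proof
    fix q assume q: "q \<in> S t"
    have "q i \<in> {- ?N..?N}" if i: "i \<in> {1..d}" for i
    proof (cases "i = d")
      case True
      have "\<bar>q d\<bar> \<le> \<lceil>K * H t\<rceil>" using q by (simp add: S_def le_ceiling_iff)
      then show ?thesis using True by (auto simp: abs_le_iff max_def)
    next
      case False
      then have "int (H t) \<le> q i" "q i < 2 * int (H t)" using q i by (auto simp: S_def)
      then show ?thesis by (auto simp: max_def)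
    qed
    then show "q \<in> (\<Pi>\<^sub>E i\<in>{1..d}. {- ?N..?N})"
      using q by (auto simp: S_def integer_points_def PiE_def)
  qed
qed

lemma sets_E: "E t q \<in> sets M"
  unfolding E_def linear_form_def by measurable

lemma sets_Q: "Q \<in> sets M"
  unfolding Q_def by measurable

lemma sets_Q': "Q' \<in> sets M'"
proof -
  have "d \<in> {2..d}" using d_ge by simp
  then show ?thesis unfolding Q'_def by measurable
qed

lemma space_upd: "x \<in> space M' \<Longrightarrow> x(1 := z) \<in> space M"
  unfolding insert_1 space_PiM by (rule PiE_fun_upd) auto

lemma Q_upd:
  fixes z :: real
  assumes "x \<in> space M'"
  shows "x(1 := z) \<in> Q \<longleftrightarrow> x \<in> Q' \<and> - real R \<le> z \<and> z < R"
  using assms space_upd[OF assms] d_ge by (auto simp: Q_def Q'_def)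

lemma linear_form_upd:
  "linear_form d (x(1 := z)) q = z * q 1 + (\<Sum>i=2..d. x i * q i)"
proof -
  have "linear_form d (x(1 := z)) q = z * q 1 + (\<Sum>i=2..d. (x(1 := z)) i * q i)"
    unfolding linear_form_def insert_1 by simp
  also have "(\<Sum>i=2..d. (x(1 := z)) i * q i) = (\<Sum>i=2..d. x i * q i)" by (intro sum.cong) auto
  finally show ?thesis .
qed

lemma E_upd:
  assumes "x \<in> space M'"
  shows "x(1 := z) \<in> E t q \<longleftrightarrow> \<bar>z * q 1 + (\<Sum>i=2..d. x i * q i) - y\<bar> \<le> p t"
  using space_upd[OF assms] by (simp add: E_def linear_form_upd del: One_nat_def)

lemma emeasure_slice: "A \<in> sets M \<Longrightarrow>
    emeasure M A = (\<integral>\<^sup>+ x. emeasure lborel {z. x(1 := z) \<in> A} \<partial>M')"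
  unfolding insert_1 by (rule emeasure_PiM_insert_slice) auto

lemma emeasure_Q: "emeasure M Q < \<infinity>"
proof -
  have "emeasure M Q \<le> emeasure M {x \<in> space M. \<forall>i\<in>{1..d}. \<bar>x i\<bar> \<le> real R}"
  proof (intro emeasure_mono)
    show "Q \<subseteq> {x \<in> space M. \<forall>i\<in>{1..d}. \<bar>x i\<bar> \<le> real R}"
      unfolding Q_def insert_1 by auto
  qed (intro emeasure_PiM_box, auto)
  also have "\<dots> < \<infinity>" by (subst emeasure_PiM_box) (auto simp: less_top[symmetric])
  finally show ?thesis .
qed

lemma Q_fmeasurable: "Q \<in> fmeasurable M"
  using sets_Q emeasure_Q by (rule fmeasurableI)

lemma fmeasurable_subset_Q:
  assumes "A \<in> sets M" "A \<subseteq> Q" shows "A \<in> fmeasurable M"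
  using fmeasurableI2[OF Q_fmeasurable assms(2,1)] .

section \<open>First moment\<close>

text \<open>Inverse to cutting a vector into its \<open>k\<close> pairs. The last pair is kept apart
  since its second entry \<open>b\<close> is chosen last, in a window depending on everything
  else.\<close>

definition assemble :: "(nat \<Rightarrow> int \<times> int) \<Rightarrow> int \<Rightarrow> int \<Rightarrow> nat \<Rightarrow> int" where
  "assemble g a b j = (if j = d then b else if j = d - 1 then a
    else if j \<in> {1..d - 2} then (if odd j then fst (g ((j + 1) div 2)) else snd (g (j div 2)))
    else undefined)"

lemma assemble_inj:
  assumes "assemble g a b = assemble g' a' b'"
    and "g \<in> extensional {1..k - 1}" "g' \<in> extensional {1..k - 1}"
  shows "g = g' \<and> a = a' \<and> b = b'"
proof (intro conjI ext)
  have eq: "assemble g a b j = assemble g' a' b' j" for j using assms(1) by simp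
  show "b = b'" using eq[of d] by (simp add: assemble_def)
  show "a = a'" using eq[of "d - 1"] diff_less[OF zero_less_one d_simps(2)]
    by (simp add: assemble_def del: One_nat_def)
  show "g i = g' i" for i
  proof (cases "i \<in> {1..k - 1}")
    case True
    then have "2 * i \<in> {1..d - 2}" "2 * i - 1 \<in> {1..d - 2}" "odd (2 * i - 1)" "(2 * i - 1 + 1) div 2 = i"
      by (auto simp: d_def)
    then show ?thesis
      using eq[of "2 * i"] eq[of "2 * i - 1"] d_ge by (auto simp: assemble_def prod_eq_iff split: if_splits)
  next
    case False
    then show ?thesis using assms by (simp add: extensional_def)
  qed
qed

text \<open>The counted \<open>q\<close> are those whose strip, on the line over \<open>x\<close>,
  is centred in \<open>[a, a + \<kappa>]\<close>. The first \<open>k - 1\<close> pairs are arbitrary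
  coprime pairs; the last pair \<open>(u, v)\<close> is coprime with \<open>v\<close> in a short
  window. Each pair costs a factor 8, the window a factor \<open>\<kappa> / (2 * R)\<close>.\<close>

lemma card_S_slice_ge:
  fixes \<kappa> :: real
  assumes \<kappa>: "\<kappa> > 0" "\<kappa> \<le> 1"
  shows "\<forall>\<^sub>F t in sequentially. \<forall>x\<in>Q'. \<forall>a::real. - real R \<le> a \<and> a + \<kappa> \<le> R \<longrightarrow>
    \<kappa> * (real (H t) ^ d / (2 * R * 8 ^ k)) \<le> real (card {q \<in> S t.
      a * q 1 \<le> y - (\<Sum>i=2..d. x i * q i) \<and> y - (\<Sum>i=2..d. x i * q i) \<le> (a + \<kappa>) * q 1})"
proof -
  \<comment> \<open>Moving \<open>v\<close> by half a window of length \<open>\<mu> * H\<close>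
    changes the form by at most \<open>R * \<mu> * H / 2 = \<kappa> * H / 4\<close>, so the centre
    stays inside the interval.\<close>
  define \<mu> where "\<mu> = \<kappa> / (2 * R)"
  have \<mu>: "\<mu> > 0" using \<kappa> R by (simp add: \<mu>_def)
  have "filterlim H at_top sequentially"
    by (rule filterlim_at_top_mono[OF filterlim_ident])
      (auto simp: H_def intro!: always_eventually less_imp_le power_gt_expt)
  note ev = filterlim_iff[THEN iffD1, OF this, rule_format]
  show ?thesis
    using ev[OF card_coprime_pairs_ge_quadratic[OF \<mu>]] ev[OF card_coprime_pairs_ge_quadratic[OF zero_less_one]]
  proof eventually_elim
    case (elim t)
    let ?H = "H t"
    show ?case
    proof (intro ballI allI impI)
      fix x a assume x: "x \<in> Q'" and a: "- real R \<le> a \<and> a + \<kappa> \<le> R"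
      have xR: "\<bar>x i\<bar> \<le> R" if "i \<in> {2..d}" for i using x that by (auto simp: Q'_def)
      have xd: "1 / R \<le> \<bar>x d\<bar>" "x d \<noteq> 0" using x R by (auto simp: Q'_def)
      define G0 where "G0 = {(u::int, v::int). ?H \<le> u \<and> u < 2 * ?H \<and> ?H \<le> v \<and> v < 2 * ?H \<and> coprime u v}"
      have G0: "real ?H ^ 2 / 8 \<le> real (card G0)"
      proof -
        have "G0 = {(u::int, v::int). ?H \<le> u \<and> u < 2 * ?H \<and> real ?H \<le> v \<and> v < real ?H + 1 * ?H \<and> coprime u v}"
          unfolding G0_def by auto
        then show ?thesis using elim(2)[rule_format, of "\<lambda>_. real ?H"] by simp
      qed
      \<comment> \<open>The real value of the last entry for which the strip is centred at the
        midpoint \<open>a + \<kappa> / 2\<close>; the 0 in \<open>assemble g u 0\<close> is a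
        placeholder that is never read here.\<close>
      define c where "c g u = (y - (\<Sum>i\<in>{2..<d}. x i * assemble g u 0 i) - (a + \<kappa> / 2) * assemble g u 0 1) / x d" for g u
      define F where "F g = {(u::int, v::int). ?H \<le> u \<and> u < 2 * ?H \<and>
        c g u - \<mu> * ?H / 2 \<le> v \<and> v < c g u - \<mu> * ?H / 2 + \<mu> * ?H \<and> coprime u v}" for g
      have F: "\<mu> * real ?H ^ 2 / 8 \<le> real (card (F g))" for g
        unfolding F_def using elim(1)[rule_format, of "\<lambda>u. c g u - \<mu> * ?H / 2"] by simp
      have finF: "finite (F g)" for g
      proof (rule finite_subset)
        let ?J = "\<lambda>u. {v::int. \<bar>real_of_int v - c g u\<bar> \<le> \<mu> * ?H / 2}"
        show "F g \<subseteq> (SIGMA u:{int ?H..<2 * int ?H}. ?J u)"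
          by (auto simp: F_def abs_if)
        show "finite (SIGMA u:{int ?H..<2 * int ?H}. ?J u)"
          using \<mu> by (intro finite_SigmaI card_int_Icc_le) auto
      qed
      have finG0: "finite G0"
        by (rule finite_subset[of _ "{int ?H..<2 * int ?H} \<times> {int ?H..<2 * int ?H}"]) (auto simp: G0_def)
      define P where "P = {1..k - 1} \<rightarrow>\<^sub>E G0"
      have finP: "finite P" unfolding P_def using finG0 by (intro finite_PiE) auto
      define T where "T = {q \<in> S t. a * q 1 \<le> y - (\<Sum>i=2..d. x i * q i) \<and>
        y - (\<Sum>i=2..d. x i * q i) \<le> (a + \<kappa>) * q 1}"
      have in_T: "assemble g u v \<in> T" if g: "g \<in> P" and uv: "(u, v) \<in> F g" for g u v
      proof -
        let ?q = "assemble g u v"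
        have qi: "int ?H \<le> ?q i \<and> ?q i < 2 * int ?H" if i: "i \<in> {1..<d}" for i
        proof (cases "i = d - 1")
          case True then show ?thesis using uv i by (auto simp: assemble_def F_def)
        next
          case False
          then have i2: "i \<in> {1..d - 2}" using i by auto
          show ?thesis
          proof (cases "odd i")
            case True
            then have "(i + 1) div 2 \<in> {1..k - 1}" using i2 by (auto simp: d_def elim!: oddE)
            then have "g ((i + 1) div 2) \<in> G0" using g by (auto simp: P_def)
            then show ?thesis using i2 False True i by (auto simp: assemble_def G0_def)
          next
            case ev: False
            then have "i div 2 \<in> {1..k - 1}" using i2 by (auto simp: d_def elim!: evenE)
            then have "g (i div 2) \<in> G0" using g by (auto simp: P_def)
            then show ?thesis using i2 False ev i by (auto simp: assemble_def G0_def)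
          qed
        qed
        have gcd1: "gcd (?q (2 * i - 1)) (?q (2 * i)) = 1" if i: "i \<in> {1..k}" for i
        proof (cases "i = k")
          case True
          then have "?q (2 * i - 1) = u" "?q (2 * i) = v" using d_ge by (auto simp: assemble_def d_def)
          then show ?thesis using uv by (simp add: F_def coprime_iff_gcd_eq_1)
        next
          case False
          then have i2: "i \<in> {1..k - 1}" using i by auto
          then have "2 * i \<in> {1..d - 2}" "2 * i - 1 \<in> {1..d - 2}" "odd (2 * i - 1)" "(2 * i - 1 + 1) div 2 = i"
            by (auto simp: d_def)
          then have "?q (2 * i - 1) = fst (g i)" "?q (2 * i) = snd (g i)"
            using d_ge by (auto simp: assemble_def)
          moreover have "g i \<in> G0" using g i2 by (auto simp: P_def)
          ultimately show ?thesis by (auto simp: G0_def coprime_iff_gcd_eq_1)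
        qed
        define s where "s = (\<Sum>i\<in>{2..<d}. x i * assemble g u 0 i)"
        have q1: "assemble g u 0 1 = ?q 1" using d_ge by (auto simp: assemble_def)
        have sum: "(\<Sum>i=2..d. x i * ?q i) = s + x d * v"
        proof -
          have "{2..d} = insert d {2..<d}" using d_ge by auto
          then have "(\<Sum>i=2..d. x i * ?q i) = x d * v + (\<Sum>i\<in>{2..<d}. x i * ?q i)"
            by (simp add: assemble_def)
          also have "(\<Sum>i\<in>{2..<d}. x i * ?q i) = s"
            unfolding s_def by (intro sum.cong) (auto simp: assemble_def)
          finally show ?thesis by simp
        qed
        have ceq: "x d * c g u = y - s - (a + \<kappa> / 2) * ?q 1"
          using xd by (simp add: c_def s_def q1 del: One_nat_def)
        have vc: "\<bar>v - c g u\<bar> \<le> \<mu> * ?H / 2" using uv by (auto simp: F_def abs_if)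
        have q1H: "real ?H \<le> ?q 1" "?q 1 < 2 * real ?H" using qi[of 1] d_ge by auto
        have "\<bar>x d * v - x d * c g u\<bar> = \<bar>x d\<bar> * \<bar>v - c g u\<bar>"
          by (simp add: abs_mult[symmetric] right_diff_distrib)
        also have "\<dots> \<le> R * (\<mu> * ?H / 2)" using vc xR[of d] d_ge by (intro mult_mono) auto
        also have "\<dots> = \<kappa> * ?H / 4" using R by (simp add: \<mu>_def)
        also have "\<dots> \<le> \<kappa> / 2 * ?q 1" using mult_left_mono[OF q1H(1), of \<kappa>] \<kappa> by auto
        finally have *: "\<bar>x d * v - x d * c g u\<bar> \<le> \<kappa> / 2 * ?q 1" .
        have T1: "a * ?q 1 \<le> y - (\<Sum>i=2..d. x i * ?q i)"
          and T2: "y - (\<Sum>i=2..d. x i * ?q i) \<le> (a + \<kappa>) * ?q 1"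
          using * unfolding sum ceq distrib_right by linarith+
        have "\<bar>s\<bar> \<le> (\<Sum>i\<in>{2..<d}. real R * (2 * real ?H))"
          unfolding s_def
        proof (rule order_trans[OF sum_abs sum_mono])
          fix i assume i: "i \<in> {2..<d}"
          then have "assemble g u 0 i = ?q i" by (auto simp: assemble_def)
          moreover have "\<bar>real_of_int (?q i)\<bar> \<le> 2 * ?H" using qi[of i] i by auto
          ultimately show "\<bar>x i * assemble g u 0 i\<bar> \<le> real R * (2 * real ?H)"
            using xR[of i] i by (simp add: abs_mult mult_mono)
        qed
        also have "\<dots> = (real d - 2) * R * 2 * ?H" using d_ge by (simp add: of_nat_diff)
        finally have s: "\<bar>s\<bar> \<le> (real d - 2) * R * 2 * ?H" .
        have "\<bar>(a + \<kappa> / 2) * ?q 1\<bar> \<le> real R * (2 * real ?H)"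
          unfolding abs_mult using a \<kappa> q1H by (intro mult_mono) (auto simp: abs_le_iff)
        moreover have "\<bar>y\<bar> \<le> \<bar>y\<bar> * ?H" using H_ge_1[of t] by (simp add: mult_le_cancel_left1)
        ultimately have "\<bar>y - s - (a + \<kappa> / 2) * ?q 1\<bar> \<le> \<bar>y\<bar> * ?H + (real d - 2) * R * 2 * ?H + real R * (2 * real ?H)"
          using s by linarith
        also have "\<dots> \<le> (\<bar>y\<bar> + 2 * d * R) * ?H" by (simp add: algebra_simps)
        finally have "\<bar>x d\<bar> * \<bar>c g u\<bar> \<le> (\<bar>y\<bar> + 2 * d * R) * ?H"
          unfolding abs_mult[symmetric] ceq .
        moreover have "1 / R * \<bar>c g u\<bar> \<le> \<bar>x d\<bar> * \<bar>c g u\<bar>" using xd by (intro mult_right_mono) auto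
        ultimately have "\<bar>c g u\<bar> / R \<le> (\<bar>y\<bar> + 2 * d * R) * ?H" by simp
        then have "\<bar>c g u\<bar> \<le> R * (\<bar>y\<bar> + 2 * d * R) * ?H"
          using R by (simp add: pos_divide_le_eq mult.commute mult.left_commute)
        moreover have "\<mu> * ?H / 2 \<le> ?H"
        proof -
          have "\<mu> \<le> 1" using \<kappa> R unfolding \<mu>_def by (subst pos_divide_le_eq) auto
          then have "\<mu> * ?H \<le> 1 * real ?H" by (intro mult_right_mono) auto
          then show ?thesis by simp
        qed
        moreover have "K * ?H = R * (\<bar>y\<bar> + 2 * d * R) * ?H + ?H" by (simp add: K_def algebra_simps)
        ultimately have "\<bar>real_of_int v\<bar> \<le> K * ?H" using vc by linarith
        then have "\<bar>?q d\<bar> \<le> K * ?H" by (simp add: assemble_def)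
        moreover have "?q \<in> integer_points d"
          using d_ge by (auto simp: integer_points_def PiE_def extensional_def assemble_def)
        ultimately have "?q \<in> S t" using qi gcd1 by (auto simp: S_def)
        then show ?thesis using T1 T2 by (simp add: T_def)
      qed
      have "\<kappa> * (real ?H ^ d / (2 * R * 8 ^ k)) = (real ?H ^ 2 / 8) ^ (k - 1) * (\<mu> * real ?H ^ 2 / 8)"
      proof -
        have "real ?H ^ d = (real ?H ^ 2) ^ (k - 1) * real ?H ^ 2"
        proof -
          have "d = 2 * (k - 1) + 2" using k by (simp add: d_def)
          then show ?thesis by (simp only: power_mult power_add)
        qed
        moreover have "(8::real) ^ k = 8 ^ (k - 1) * 8" using k by (cases k) auto
        ultimately show ?thesis by (simp add: \<mu>_def power_divide mult_ac)
      qed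
      also have "\<dots> \<le> real (card G0) ^ (k - 1) * (\<mu> * real ?H ^ 2 / 8)"
        using G0 \<mu> by (intro mult_right_mono power_mono) auto
      also have "\<dots> = (\<Sum>g\<in>P. \<mu> * real ?H ^ 2 / 8)" by (simp add: P_def card_PiE)
      also have "\<dots> \<le> (\<Sum>g\<in>P. real (card (F g)))" by (intro sum_mono F)
      also have "\<dots> = real (card (SIGMA g:P. F g))" using finP finF by (simp add: card_SigmaI)
      also have "\<dots> \<le> real (card T)"
      proof -
        have "inj_on (\<lambda>(g, u, v). assemble g u v) (SIGMA g:P. F g)"
          using assemble_inj by (fastforce simp: inj_on_def P_def PiE_def)
        moreover have "(\<lambda>(g, u, v). assemble g u v) ` (SIGMA g:P. F g) \<subseteq> T"
          using in_T by auto
        moreover have "finite T" by (rule finite_subset[OF _ finite_S]) (auto simp: T_def)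
        ultimately show ?thesis by (metis card_inj_on_le of_nat_mono)
      qed
      finally show "\<kappa> * (real (H t) ^ d / (2 * R * 8 ^ k)) \<le> real (card {q \<in> S t.
        a * q 1 \<le> y - (\<Sum>i=2..d. x i * q i) \<and> y - (\<Sum>i=2..d. x i * q i) \<le> (a + \<kappa>) * q 1})"
        by (simp only: T_def)
    qed
  qed
qed

text \<open>Each strip centred in the piece keeps length at least \<open>p t / (2 * H t)\<close>
  there. The strips are eventually short compared with \<open>\<kappa>\<close> since
  \<open>p t \<le> 1\<close> while \<open>H t\<close> grows.\<close>

lemma sum_measure_strip_Ico_ge:
  fixes \<kappa> :: real
  assumes \<kappa>: "\<kappa> > 0" "\<kappa> \<le> 1"
  shows "\<forall>\<^sub>F t in sequentially. \<forall>x\<in>Q'. \<forall>a::real. - real R \<le> a \<and> a + \<kappa> \<le> R \<longrightarrow>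
    \<kappa> * w t / (4 * R * 8 ^ k) \<le> (\<Sum>q\<in>S t. measure lborel
      {z. a \<le> z \<and> z < a + \<kappa> \<and> \<bar>z * q 1 - (y - (\<Sum>i=2..d. x i * q i))\<bar> \<le> p t})"
proof -
  have "((\<lambda>t. (1 / 4 :: real) ^ t) \<longlonglongrightarrow> 0)" by (rule LIMSEQ_power_zero) auto
  then have "\<forall>\<^sub>F t in sequentially. (1 / 4 :: real) ^ t < \<kappa>"
    by (rule order_tendstoD(2)[OF _ \<kappa>(1)])
  then show ?thesis
    using card_S_slice_ge[OF \<kappa>]
  proof eventually_elim
    case (elim t)
    have pH: "p t / H t \<le> \<kappa>"
    proof -
      have "1 \<le> real (H t) ^ (d - 1)" using H_ge_1[of t] by (intro one_le_power) simp
      then have "p t * 1 \<le> p t * real (H t) ^ (d - 1)" using p_nonneg[of t] by (intro mult_left_mono)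
      then have "p t \<le> 1" using w_le_1[of t] by (simp add: w_def)
      then have "p t / H t \<le> 1 / H t" by (intro divide_right_mono) auto
      moreover have "(1 / 4) ^ t = 1 / real (H t)" by (simp add: H_def power_one_over)
      ultimately show ?thesis using elim(1) by linarith
    qed
    show ?case
    proof (intro ballI allI impI)
      fix x a assume x: "x \<in> Q'" and a: "- real R \<le> a \<and> a + \<kappa> \<le> R"
      let ?\<sigma> = "\<lambda>q. y - (\<Sum>i=2..d. x i * real_of_int (q i))"
      let ?T = "{q \<in> S t. a * q 1 \<le> ?\<sigma> q \<and> ?\<sigma> q \<le> (a + \<kappa>) * q 1}"
      have "\<kappa> * w t / (4 * R * 8 ^ k) = \<kappa> * (real (H t) ^ d / (2 * R * 8 ^ k)) * (p t / (2 * H t))"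
      proof -
        have "real (H t) ^ d = H t * real (H t) ^ (d - 1)" using d_ge by (simp add: power_eq_if[of _ d])
        moreover have "\<kappa> * (p t * P) / (4 * real R * e) = \<kappa> * (h * P / (2 * real R * e)) * (p t / (2 * h))"
          if "h \<noteq> 0" for h P e :: real
          using that by (simp add: mult_ac)
        ultimately show ?thesis using H_pos[of t] unfolding w_def by (simp add: mult_ac)
      qed
      also have "\<dots> \<le> real (card ?T) * (p t / (2 * H t))"
        using elim(2)[rule_format, OF x a] p_nonneg[of t] by (intro mult_right_mono) simp_all
      also have "\<dots> = (\<Sum>q\<in>?T. p t / (2 * H t))" by simp
      also have "\<dots> \<le> (\<Sum>q\<in>?T. measure lborel {z. a \<le> z \<and> z < a + \<kappa> \<and> \<bar>z * q 1 - ?\<sigma> q\<bar> \<le> p t})"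
      proof (intro sum_mono)
        fix q assume "q \<in> ?T"
        then have "q \<in> S t" and le: "a * q 1 \<le> ?\<sigma> q" "?\<sigma> q \<le> (a + \<kappa>) * q 1" by blast+
        note q1 = S_first[OF this(1)]
        have "0 < real_of_int (q 1)" using q1(3) by linarith
        from measure_strip_Ico_ge[OF this q1(2) le p_nonneg pH]
        show "p t / (2 * H t) \<le> measure lborel {z. a \<le> z \<and> z < a + \<kappa> \<and> \<bar>z * q 1 - ?\<sigma> q\<bar> \<le> p t}" by simp
      qed
      also have "\<dots> \<le> (\<Sum>q\<in>S t. measure lborel {z. a \<le> z \<and> z < a + \<kappa> \<and> \<bar>z * q 1 - ?\<sigma> q\<bar> \<le> p t})"
        using finite_S by (intro sum_mono2) auto
      finally show "\<kappa> * w t / (4 * R * 8 ^ k) \<le> (\<Sum>q\<in>S t. measure lborel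
        {z. a \<le> z \<and> z < a + \<kappa> \<and> \<bar>z * q 1 - ?\<sigma> q\<bar> \<le> p t})" .
    qed
  qed
qed

text \<open>Over each \<open>x\<close> the slice of \<open>U\<close> consists of finitely many
  dyadic intervals of the same length \<open>\<kappa>\<close>. The one-dimensional bound holds on
  each of them from the same level on, so it can be summed and integrated over
  \<open>x\<close>.\<close>

lemma first_moment:
  assumes U: "U \<in> sets M" "U \<subseteq> Q" "saturated {1..d} 1 n U"
  shows "\<forall>\<^sub>F t in sequentially.
    1 / (4 * R * 8 ^ k) * w t * measure M U \<le> (\<Sum>q\<in>S t. measure M (E t q \<inter> U))"
proof -
  define \<kappa> where "\<kappa> = inverse (2 ^ n :: real)"
  have \<kappa>: "\<kappa> > 0" "\<kappa> \<le> 1" by (auto simp: \<kappa>_def inverse_le_1_iff)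
  define c where "c = 1 / (4 * R * 8 ^ k :: real)"
  have c: "c > 0" using R by (simp add: c_def)
  show ?thesis
    using sum_measure_strip_Ico_ge[OF \<kappa>]
  proof eventually_elim
    case (elim t)
    have slice: "ennreal (c * w t) * emeasure lborel {z. x(1 := z) \<in> U}
      \<le> (\<Sum>q\<in>S t. emeasure lborel {z. x(1 := z) \<in> E t q \<inter> U})" if x: "x \<in> space M'" for x
    proof (cases "x \<in> Q'")
      case False
      then have "x(1 := z) \<notin> Q" for z by (simp only: Q_upd[OF x] simp_thms not_False_eq_True)
      then have "{z. x(1 := z) \<in> U} = {}" using U(2) by blast
      then show ?thesis by simp
    next
      case True
      define C where "C j = {z. of_int j * \<kappa> \<le> z \<and> z < of_int j * \<kappa> + \<kappa>}" for j :: int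
      have C: "z \<in> C j \<longleftrightarrow> \<lfloor>2 ^ n * z\<rfloor> = j" for z j
      proof -
        have "z \<in> C j \<longleftrightarrow> of_int j \<le> 2 ^ n * z \<and> 2 ^ n * z < of_int j + 1"
          by (simp add: C_def \<kappa>_def field_simps)
        then show ?thesis by (simp add: floor_eq_iff)
      qed
      define J where "J = {j. \<exists>z\<in>C j. x(1 := z) \<in> U}"
      have U_iff: "x(1 := z) \<in> U \<longleftrightarrow> x(1 := z') \<in> U" if "z \<in> C j" "z' \<in> C j" for z z' j
      proof -
        have "x(1 := z) \<in> space M" by (rule space_upd[OF x])
        moreover have "\<lfloor>2 ^ n * z'\<rfloor> = \<lfloor>2 ^ n * (x(1 := z)) 1\<rfloor>" using that C by simp
        ultimately have "(x(1 := z))(1 := z') \<in> U \<longleftrightarrow> x(1 := z) \<in> U"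
          using U(3) unfolding saturated_def by blast
        then show ?thesis by simp
      qed
      have Ux: "{z. x(1 := z) \<in> U} = (\<Union>j\<in>J. C j)"
      proof (intro equalityI subsetI)
        fix z assume "z \<in> {z. x(1 := z) \<in> U}"
        moreover have "z \<in> C \<lfloor>2 ^ n * z\<rfloor>" by (simp only: C)
        ultimately show "z \<in> (\<Union>j\<in>J. C j)" unfolding J_def by blast
      next
        fix z assume "z \<in> (\<Union>j\<in>J. C j)"
        then obtain j z' where "z \<in> C j" "z' \<in> C j" "x(1 := z') \<in> U" unfolding J_def by blast
        then show "z \<in> {z. x(1 := z) \<in> U}" using U_iff by blast
      qed
      \<comment> \<open>As \<open>R\<close> is a multiple of \<open>\<kappa>\<close>, a dyadic
        interval meeting \<open>[-R, R)\<close> lies within it.\<close>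
      have CR: "- real R \<le> of_int j * \<kappa> \<and> of_int j * \<kappa> + \<kappa> \<le> R" if j: "j \<in> J" for j
      proof -
        obtain z where z: "z \<in> C j" "x(1 := z) \<in> U" using j by (auto simp: J_def)
        then have "x(1 := z) \<in> Q" using U(2) by blast
        then have zR: "- real R \<le> z" "z < R" by (simp_all only: Q_upd[OF x])
        have R2: "real_of_int (2 ^ n * int R) = 2 ^ n * real R" by simp
        have "- real_of_int (2 ^ n * int R) \<le> 2 ^ n * z" "2 ^ n * z < real_of_int (2 ^ n * int R)"
          unfolding R2 using mult_left_mono[OF zR(1), of "2 ^ n"] mult_strict_left_mono[OF zR(2), of "2 ^ n"] by auto
        then have "- (2 ^ n * int R) \<le> j \<and> j < 2 ^ n * int R"
          using C[of z j] z(1) by linarith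
        then have "- (2 ^ n * int R) \<le> j \<and> j + 1 \<le> 2 ^ n * int R" by simp
        then have "- (2 ^ n * real R) \<le> of_int j \<and> of_int j + 1 \<le> 2 ^ n * real R"
          unfolding R2[symmetric] by linarith
        then show ?thesis by (simp add: \<kappa>_def field_simps)
      qed
      have finJ: "finite J"
      proof (rule finite_subset)
        show "J \<subseteq> {- (2 ^ n * int R)..2 ^ n * int R}"
        proof
          fix j assume "j \<in> J"
          then have "- (2 ^ n * real R) \<le> of_int j \<and> of_int j \<le> 2 ^ n * real R"
            using CR[of j] \<kappa> by (simp add: \<kappa>_def field_simps)
          then have "real_of_int (- (2 ^ n * int R)) \<le> of_int j \<and> of_int j \<le> real_of_int (2 ^ n * int R)" by simp
          then show "j \<in> {- (2 ^ n * int R)..2 ^ n * int R}" by (simp only: of_int_le_iff) simp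
        qed
      qed simp
      have disj: "disjoint_family_on C J" using C by (auto simp: disjoint_family_on_def)
      have Cs: "C j \<in> sets lborel" for j unfolding C_def by measurable
      define D where "D q j = {z\<in>C j. \<bar>z * q 1 - (y - (\<Sum>i=2..d. x i * real_of_int (q i)))\<bar> \<le> p t}" for q j
      have Ds: "D q j \<in> sets lborel" for q j unfolding D_def C_def by measurable
      have Df: "emeasure lborel (D q j) = ennreal (measure lborel (D q j))" for q j
      proof -
        have "D q j \<in> fmeasurable lborel"
          by (rule fmeasurableI2[OF fmeasurable_Icc[of "of_int j * \<kappa>" "of_int j * \<kappa> + \<kappa>"]]) (use Ds in \<open>auto simp: D_def C_def\<close>)
        then show ?thesis by (rule emeasure_eq_measure2)
      qed
      have E: "{z. x(1 := z) \<in> E t q \<inter> U} = (\<Union>j\<in>J. D q j)" for q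
      proof -
        have "{z. x(1 := z) \<in> E t q \<inter> U} = {z. x(1 := z) \<in> U} \<inter> {z :: real. \<bar>z * q 1 - (y - (\<Sum>i=2..d. x i * real_of_int (q i)))\<bar> \<le> p t}"
          unfolding Int_iff E_upd[OF x] by (auto simp: diff_diff_eq2)
        then show ?thesis unfolding Ux D_def by auto
      qed
      have "emeasure lborel {z. x(1 := z) \<in> U} = (\<Sum>j\<in>J. emeasure lborel (C j))"
        unfolding Ux using finJ disj Cs by (intro sum_emeasure[symmetric]) auto
      also have "\<dots> = (\<Sum>j\<in>J. ennreal \<kappa>)"
      proof (intro sum.cong refl)
        fix j
        have "C j = {of_int j * \<kappa>..<of_int j * \<kappa> + \<kappa>}" by (auto simp: C_def)
        then show "emeasure lborel (C j) = ennreal \<kappa>" using \<kappa> by simp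
      qed
      finally have "ennreal (c * w t) * emeasure lborel {z. x(1 := z) \<in> U} = (\<Sum>j\<in>J. ennreal (\<kappa> * w t * c))"
        unfolding sum_distrib_left using \<kappa> c w_nonneg[of t]
        by (simp only: sum_distrib_left, intro sum.cong refl, subst ennreal_mult[symmetric]) (auto simp: ac_simps)
      also have "\<dots> \<le> (\<Sum>j\<in>J. \<Sum>q\<in>S t. emeasure lborel (D q j))"
      proof (intro sum_mono)
        fix j assume j: "j \<in> J"
        have "\<kappa> * w t * c \<le> (\<Sum>q\<in>S t. measure lborel (D q j))"
        proof -
          have "D q j = {z. of_int j * \<kappa> \<le> z \<and> z < of_int j * \<kappa> + \<kappa> \<and>
              \<bar>z * q 1 - (y - (\<Sum>i=2..d. x i * real_of_int (q i)))\<bar> \<le> p t}" for q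
            by (auto simp: D_def C_def)
          then show ?thesis using elim[rule_format, OF True CR[OF j]] by (simp only: c_def) simp
        qed
        then show "ennreal (\<kappa> * w t * c) \<le> (\<Sum>q\<in>S t. emeasure lborel (D q j))"
          unfolding Df by (simp only: sum_ennreal measure_nonneg ennreal_leI)
      qed
      also have "\<dots> = (\<Sum>q\<in>S t. \<Sum>j\<in>J. emeasure lborel (D q j))" by (rule sum.swap)
      also have "\<dots> = (\<Sum>q\<in>S t. emeasure lborel {z. x(1 := z) \<in> E t q \<inter> U})"
      proof (intro sum.cong refl)
        fix q
        have "disjoint_family_on (D q) J" using disj by (auto simp: disjoint_family_on_def D_def)
        then show "(\<Sum>j\<in>J. emeasure lborel (D q j)) = emeasure lborel {z. x(1 := z) \<in> E t q \<inter> U}"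
          unfolding E using finJ Ds by (intro sum_emeasure) auto
      qed
      finally show ?thesis .
    qed
    have EU: "E t q \<inter> U \<in> sets M" for q using U sets_E by auto
    have meas: "(\<lambda>x. emeasure lborel {z. x(1 := z) \<in> A}) \<in> borel_measurable M'" if "A \<in> sets M" for A
    proof -
      have "A \<in> sets (\<Pi>\<^sub>M i\<in>insert 1 {2..d}. (lborel :: real measure))" using that by (simp only: insert_1)
      from measurable_sets[OF measurable_add_dim this]
      have "(\<lambda>(x, z). x(1 := z)) -` A \<inter> space (M' \<Otimes>\<^sub>M lborel) \<in> sets (M' \<Otimes>\<^sub>M lborel)" .
      from lborel.measurable_emeasure_Pair[OF this]
      moreover have "Pair x -` ((\<lambda>(x, z). x(1 := z)) -` A \<inter> space (M' \<Otimes>\<^sub>M lborel)) = {z. x(1 := z) \<in> A}"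
        if "x \<in> space M'" for x
        using that by (auto simp: space_pair_measure)
      ultimately show ?thesis by (simp cong: measurable_cong)
    qed
    have "ennreal (c * w t) * emeasure M U = (\<integral>\<^sup>+ x. ennreal (c * w t) * emeasure lborel {z. x(1 := z) \<in> U} \<partial>M')"
      unfolding emeasure_slice[OF U(1)] by (rule nn_integral_cmult[symmetric, OF meas[OF U(1)]])
    also have "\<dots> \<le> (\<integral>\<^sup>+ x. (\<Sum>q\<in>S t. emeasure lborel {z. x(1 := z) \<in> E t q \<inter> U}) \<partial>M')"
      using slice by (rule nn_integral_mono)
    also have "\<dots> = (\<Sum>q\<in>S t. emeasure M (E t q \<inter> U))"
      unfolding emeasure_slice[OF EU] by (rule nn_integral_sum[OF meas[OF EU]])
    also have "\<dots> = (\<Sum>q\<in>S t. ennreal (measure M (E t q \<inter> U)))"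
      using U(2) by (intro sum.cong refl emeasure_eq_measure2 fmeasurable_subset_Q EU) blast
    also have "\<dots> = ennreal (\<Sum>q\<in>S t. measure M (E t q \<inter> U))"
      by (rule sum_ennreal) simp
    finally have "ennreal (c * w t * measure M U) \<le> ennreal (\<Sum>q\<in>S t. measure M (E t q \<inter> U))"
      using emeasure_eq_measure2[OF fmeasurable_subset_Q[OF U(1,2)]] c w_nonneg[of t] by (simp add: ennreal_mult)
    then show ?case unfolding c_def by (subst (asm) ennreal_le_iff) (auto intro!: sum_nonneg)
  qed
qed

section \<open>Pair correlations\<close>

text \<open>Coordinate 1 cancels from \<open>r 1\<close> times the form of \<open>q\<close> minus
  \<open>q 1\<close> times the form of \<open>r\<close>.\<close>

definition pairset :: "(nat \<Rightarrow> int) \<Rightarrow> (nat \<Rightarrow> int) \<Rightarrow> real \<Rightarrow> (nat \<Rightarrow> real) set" where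
  "pairset q r \<delta> = {x \<in> Q'.
    \<bar>(\<Sum>i=2..d. x i * of_int (q i * r 1 - r i * q 1)) - y * of_int (r 1 - q 1)\<bar> \<le> \<delta>}"

lemma sets_pairset: "pairset q r \<delta> \<in> sets M'"
proof -
  have "pairset q r \<delta> = Q' \<inter> {x \<in> space M'.
      \<bar>(\<Sum>i=2..d. x i * of_int (q i * r 1 - r i * q 1)) - y * of_int (r 1 - q 1)\<bar> \<le> \<delta>}"
    by (auto simp: pairset_def Q'_def)
  also have "\<dots> \<in> sets M'" by (intro sets.Int sets_Q') measurable
  finally show ?thesis .
qed

lemma Q'_box: "Q' \<subseteq> {x \<in> space M'. \<forall>i\<in>{2..d}. \<bar>x i\<bar> \<le> real R}"
  by (auto simp: Q'_def)

lemma fmeasurable_pairset: "pairset q r \<delta> \<in> fmeasurable M'"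
  and measure_pairset_le_box: "measure M' (pairset q r \<delta>) \<le> (2 * R) ^ (d - 1)"
proof -
  have "emeasure M' (pairset q r \<delta>) \<le> emeasure M' {x \<in> space M'. \<forall>i\<in>{2..d}. \<bar>x i\<bar> \<le> real R}"
    using Q'_box by (intro emeasure_mono emeasure_PiM_box) (auto simp: pairset_def)
  also have "\<dots> = ennreal ((2 * real R) ^ card {2..d})" by (rule emeasure_PiM_box) auto
  also have "(2 * real R) ^ card {2..d} = (2 * R) ^ (d - 1)" by simp
  finally have *: "emeasure M' (pairset q r \<delta>) \<le> ennreal ((2 * R) ^ (d - 1))" .
  then show "pairset q r \<delta> \<in> fmeasurable M'"
    using sets_pairset by (intro fmeasurableI) (auto simp: le_less_trans)
  show "measure M' (pairset q r \<delta>) \<le> (2 * R) ^ (d - 1)"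
    unfolding measure_def using * by (intro enn2real_leI) auto
qed

lemma measure_pairset_le_slab:
  assumes j: "j \<in> {2..d}" "q j * r 1 - r j * q 1 \<noteq> 0" and \<delta>: "\<delta> \<ge> 0"
  shows "measure M' (pairset q r \<delta>) \<le> 2 * \<delta> / \<bar>of_int (q j * r 1 - r j * q 1)\<bar> * (2 * real R) ^ (d - 2)"
proof -
  let ?m = "\<lambda>i. real_of_int (q i * r 1 - r i * q 1)"
  let ?A = "{x \<in> space M'. (\<forall>i\<in>{2..d}. \<bar>x i\<bar> \<le> real R) \<and> \<bar>(\<Sum>i\<in>{2..d}. x i * ?m i) - y * of_int (r 1 - q 1)\<bar> \<le> \<delta>}"
  have "emeasure M' (pairset q r \<delta>) \<le> emeasure M' ?A"
  proof (rule emeasure_mono)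
    show "pairset q r \<delta> \<subseteq> ?A" using Q'_box by (auto simp: pairset_def)
    show "?A \<in> sets M'" by measurable
  qed
  also have "\<dots> \<le> ennreal (2 * \<delta> / \<bar>?m j\<bar> * (2 * real R) ^ (card {2..d} - 1))"
    using j \<delta> by (intro emeasure_slab_le) (auto simp del: of_int_diff of_int_mult)
  also have "card {2..d} - 1 = d - 2" by simp
  finally show ?thesis unfolding measure_def using \<delta> by (intro enn2real_leI) auto
qed

text \<open>Eliminating the first coordinate from the two inequalities defining a pair of strips leaves
  one inequality in the remaining coordinates, whose coefficients are the \<open>2 \<times> 2\<close> minors of
  \<open>q\<close> and \<open>r\<close>.\<close>

lemma measure_pair_le:
  assumes st: "s \<le> t" and q: "q \<in> S s" and r: "r \<in> S t"
  shows "measure M (E s q \<inter> E t r \<inter> Q) \<le> 2 * p t / H t * measure M' (pairset q r (4 * real (H t) * p s))"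
proof -
  let ?X = "pairset q r (4 * real (H t) * p s)"
  let ?A = "E s q \<inter> E t r \<inter> Q"
  note q1 = S_first[OF q] and r1 = S_first[OF r]
  have Hst: "H s \<le> H t" using st by (simp add: H_def)
  have A: "?A \<in> sets M" using sets_E sets_Q by auto
  have "emeasure M ?A = (\<integral>\<^sup>+ x. emeasure lborel {z. x(1 := z) \<in> ?A} \<partial>M')"
    by (rule emeasure_slice[OF A])
  also have "\<dots> \<le> (\<integral>\<^sup>+ x. ennreal (2 * p t / H t) * indicator ?X x \<partial>M')"
  proof (rule nn_integral_mono)
    fix x assume x: "x \<in> space M'"
    define \<sigma> where "\<sigma> q = (\<Sum>i=2..d. x i * real_of_int (q i))" for q :: "nat \<Rightarrow> int"
    have inA: "x \<in> Q'" "\<bar>z * q 1 + \<sigma> q - y\<bar> \<le> p s" "\<bar>z * r 1 + \<sigma> r - y\<bar> \<le> p t"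
      if "x(1 := z) \<in> ?A" for z
    proof -
      have "x(1 := z) \<in> E s q" "x(1 := z) \<in> E t r" "x(1 := z) \<in> Q" using that by blast+
      then show "x \<in> Q'" "\<bar>z * q 1 + \<sigma> q - y\<bar> \<le> p s" "\<bar>z * r 1 + \<sigma> r - y\<bar> \<le> p t"
        by (simp_all only: E_upd[OF x] Q_upd[OF x] \<sigma>_def)
    qed
    show "emeasure lborel {z. x(1 := z) \<in> ?A} \<le> ennreal (2 * p t / H t) * indicator ?X x"
    proof (cases "\<exists>z. x(1 := z) \<in> ?A")
      case True
      then obtain z where z: "x(1 := z) \<in> ?A" by blast
      note in_z = inA[OF z]
      define \<theta> where "\<theta> = z * q 1 + \<sigma> q - y"
      define \<eta> where "\<eta> = z * r 1 + \<sigma> r - y"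
      have "(\<Sum>i=2..d. x i * of_int (q i * r 1 - r i * q 1)) = r 1 * \<sigma> q - q 1 * \<sigma> r"
        unfolding \<sigma>_def sum_distrib_left sum_subtractf[symmetric]
        by (intro sum.cong refl) (simp add: algebra_simps)
      then have eq: "(\<Sum>i=2..d. x i * of_int (q i * r 1 - r i * q 1)) - y * of_int (r 1 - q 1)
          = r 1 * \<theta> - q 1 * \<eta>"
        by (simp add: \<theta>_def \<eta>_def algebra_simps)
      \<comment> \<open>The radius \<open>4 * H t * p s\<close> comes from two terms of equal size:
        the second also uses \<open>H s \<le> H t\<close> and \<open>p t \<le> p s\<close>.\<close>
      have "\<bar>r 1 * \<theta>\<bar> \<le> 2 * real (H t) * p s"
        unfolding abs_mult using r1 in_z p_nonneg[of s] by (intro mult_mono) (auto simp: \<theta>_def)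
      moreover have "\<bar>q 1 * \<eta>\<bar> \<le> 2 * real (H t) * p s"
        unfolding abs_mult using q1 in_z p_nonneg[of s] p_decseq[OF st] Hst
        by (intro mult_mono) (auto simp: \<eta>_def)
      ultimately have "\<bar>r 1 * \<theta> - q 1 * \<eta>\<bar> \<le> 4 * real (H t) * p s" by linarith
      then have X: "x \<in> ?X" using in_z unfolding pairset_def eq[symmetric] by simp
      \<comment> \<open>On the line over \<open>x\<close> only the strip of the longer vector
        \<open>r\<close> is used, as it has the better length bound.\<close>
      have "{z. x(1 := z) \<in> ?A} \<subseteq> {z :: real. \<bar>z * r 1 - (y - \<sigma> r)\<bar> \<le> p t}"
      proof
        fix z assume "z \<in> {z. x(1 := z) \<in> ?A}"
        then have "\<bar>z * r 1 + \<sigma> r - y\<bar> \<le> p t" using inA(3) by blast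
        then show "z \<in> {z. \<bar>z * r 1 - (y - \<sigma> r)\<bar> \<le> p t}" by (simp add: diff_diff_eq2)
      qed
      then have "emeasure lborel {z. x(1 := z) \<in> ?A} \<le> emeasure lborel {z. \<bar>z * r 1 - (y - \<sigma> r)\<bar> \<le> p t}"
        by (intro emeasure_mono) auto
      also have "\<dots> \<le> ennreal (2 * p t / \<bar>real_of_int (r 1)\<bar>)"
        using r1 p_nonneg by (intro emeasure_strip_le) auto
      also have "\<dots> \<le> ennreal (2 * p t / H t)"
        using r1 p_nonneg[of t] H_pos[of t] by (intro ennreal_leI divide_left_mono mult_pos_pos) auto
      finally show ?thesis using X by simp
    next
      case False
      then have "{z. x(1 := z) \<in> ?A} = {}" by blast
      then show ?thesis by (simp only: emeasure_empty zero_le)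
    qed
  qed
  also have "\<dots> = ennreal (2 * p t / H t) * emeasure M' ?X"
    using sets_pairset by (rule nn_integral_cmult_indicator)
  also have "\<dots> = ennreal (2 * p t / H t * measure M' ?X)"
    unfolding emeasure_eq_measure2[OF fmeasurable_pairset]
    using p_nonneg[of t] by (subst ennreal_mult[symmetric]) auto
  finally show ?thesis unfolding measure_def[of M]
    using p_nonneg[of t] by (intro enn2real_leI) auto
qed

lemma card_S_le: "real (card (S t)) \<le> 3 * K * real (H t) ^ d"
proof -
  define B where "B i = (if i = d then {b::int. \<bar>real_of_int b - 0\<bar> \<le> K * H t} else {int (H t)..<2 * int (H t)})" for i
  have KH: "1 \<le> K * H t"
    using mult_mono[OF K_ge_1, of 1 "real (H t)"] H_ge_1[of t] K_pos by simp
  have finB: "finite (B i)" for i unfolding B_def using card_int_Icc_le(1)[of "K * H t" 0] KH by auto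
  have "S t \<subseteq> (\<Pi>\<^sub>E i\<in>{1..d}. B i)"
    by (auto simp: S_def integer_points_def B_def PiE_def Pi_def extensional_def)
  then have "card (S t) \<le> card (\<Pi>\<^sub>E i\<in>{1..d}. B i)"
    using finB by (intro card_mono finite_PiE) auto
  also have "\<dots> = (\<Prod>i\<in>{1..d}. card (B i))" by (simp add: card_PiE)
  also have "\<dots> = card (B d) * (\<Prod>i\<in>{1..<d}. card (B i))"
  proof -
    have "{1..d} = insert d {1..<d}" using d_ge by auto
    then show ?thesis by simp
  qed
  also have "(\<Prod>i\<in>{1..<d}. card (B i)) = (\<Prod>i\<in>{1..<d}. H t)"
    by (intro prod.cong) (auto simp: B_def)
  finally have "real (card (S t)) \<le> real (card (B d)) * real (H t) ^ (d - 1)"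
    by (simp flip: of_nat_power of_nat_mult)
  also have "\<dots> \<le> (3 * (K * H t)) * real (H t) ^ (d - 1)"
  proof (intro mult_right_mono)
    have "real (card (B d)) \<le> 2 * (K * H t) + 1" unfolding B_def using card_int_Icc_le(2)[of "K * H t" 0] KH by simp
    then show "real (card (B d)) \<le> 3 * (K * H t)" using KH by linarith
  qed auto
  also have "\<dots> = 3 * K * real (H t) ^ d"
    using d_ge by (simp add: power_eq_if[of _ d])
  finally show ?thesis .
qed

lemma power_H_d: "real (H t) ^ d = H t * real (H t) ^ (d - 1)"
  using d_ge by (simp add: power_eq_if[of _ d])

text \<open>For \<open>r = q\<close> all minors vanish and \<open>pairset\<close> gives no saving
  beyond the box, so the sum has only the order of the first moment.\<close>

lemma diagonal_sum:
  "(\<Sum>q\<in>S t. measure M (E t q \<inter> E t q \<inter> Q)) \<le> 6 * K * (2 * real R) ^ (d - 1) * w t"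
proof -
  have "(\<Sum>q\<in>S t. measure M (E t q \<inter> E t q \<inter> Q)) \<le> (\<Sum>q\<in>S t. 2 * p t / H t * (2 * real R) ^ (d - 1))"
  proof (intro sum_mono)
    fix q assume q: "q \<in> S t"
    have "measure M (E t q \<inter> E t q \<inter> Q) \<le> 2 * p t / H t * measure M' (pairset q q (4 * real (H t) * p t))"
      using q by (intro measure_pair_le) auto
    also have "\<dots> \<le> 2 * p t / H t * (2 * real R) ^ (d - 1)"
      using measure_pairset_le_box[of q q "4 * real (H t) * p t"] p_nonneg[of t] by (intro mult_left_mono) auto
    finally show "measure M (E t q \<inter> E t q \<inter> Q) \<le> 2 * p t / H t * (2 * real R) ^ (d - 1)" .
  qed
  also have "\<dots> = real (card (S t)) * (2 * p t / H t * (2 * real R) ^ (d - 1))" by simp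
  also have "\<dots> \<le> 3 * K * real (H t) ^ d * (2 * p t / H t * (2 * real R) ^ (d - 1))"
    using card_S_le p_nonneg[of t] by (intro mult_right_mono) auto
  also have "\<dots> = 6 * K * (2 * real R) ^ (d - 1) * w t"
    using H_pos[of t] unfolding power_H_d by (simp add: w_def)
  finally show ?thesis .
qed

text \<open>The hypothesis is what independence predicts: a typical minor has size
  \<open>H s * H t\<close>, so about \<open>H t ^ d\<close> vectors \<open>r\<close> contribute
  \<open>\<delta> / (H s * H t)\<close> each, with \<open>\<delta> = 4 * H t * p s\<close>.\<close>

lemma pair_sum_le:
  assumes st: "s \<le> t" and B: "\<And>q. q \<in> S s \<Longrightarrow>
      (\<Sum>r\<in>S t - {q}. measure M' (pairset q r (4 * real (H t) * p s))) \<le> B * (4 * real (H t) * p s) * real (H t) ^ (d - 1) / H s"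
    and B0: "B \<ge> 0"
  shows "(\<Sum>q\<in>S s. \<Sum>r\<in>S t - {q}. measure M (E s q \<inter> E t r \<inter> Q)) \<le> 24 * K * B * (w s * w t)"
proof -
  have "(\<Sum>q\<in>S s. \<Sum>r\<in>S t - {q}. measure M (E s q \<inter> E t r \<inter> Q))
      \<le> (\<Sum>q\<in>S s. \<Sum>r\<in>S t - {q}. 2 * p t / H t * measure M' (pairset q r (4 * real (H t) * p s)))"
    using st by (intro sum_mono measure_pair_le) auto
  also have "\<dots> = (\<Sum>q\<in>S s. 2 * p t / H t * (\<Sum>r\<in>S t - {q}. measure M' (pairset q r (4 * real (H t) * p s))))"
    by (simp add: sum_distrib_left)
  also have "\<dots> \<le> (\<Sum>q\<in>S s. 2 * p t / H t * (B * (4 * real (H t) * p s) * real (H t) ^ (d - 1) / H s))"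
    using p_nonneg[of t] by (intro sum_mono mult_left_mono B) auto
  also have "\<dots> = real (card (S s)) * (2 * p t / H t * (B * (4 * real (H t) * p s) * real (H t) ^ (d - 1) / H s))"
    by simp
  also have "\<dots> \<le> 3 * K * real (H s) ^ d * (2 * p t / H t * (B * (4 * real (H t) * p s) * real (H t) ^ (d - 1) / H s))"
    using card_S_le p_nonneg[of t] p_nonneg[of s] B0 by (intro mult_right_mono) auto
  also have "\<dots> = 24 * K * B * (w s * w t)"
    using H_pos[of t] H_pos[of s] unfolding power_H_d[of s] by (simp add: w_def)
  finally show ?thesis .
qed

section \<open>Primitivity, and pair sums for \<open>k \<ge> 2\<close>\<close>

lemma S_coprime:
  assumes "q \<in> S t" shows "coprime (q 1) (q 2)"
proof -
  have "\<forall>i\<in>{1..k}. gcd (q (2 * i - 1)) (q (2 * i)) = 1" using assms by (simp add: S_def)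
  from bspec[OF this, of 1] k show ?thesis by (simp add: coprime_iff_gcd_eq_1)
qed

text \<open>Coprimality of the first pair alone excludes parallel vectors: it gives
  \<open>q 1 dvd r 1\<close> and conversely, and both are positive.\<close>

lemma S_eqI:
  assumes q: "q \<in> S s" and r: "r \<in> S t" and m: "\<And>i. i \<in> {2..d} \<Longrightarrow> q i * r 1 - r i * q 1 = 0"
  shows "q = r"
proof -
  have "q 2 * r 1 = r 2 * q 1" using m[of 2] d_ge by simp
  then have "q 1 dvd q 2 * r 1" "r 1 dvd r 2 * q 1" by (metis dvd_triv_right)+
  then have "q 1 dvd r 1" "r 1 dvd q 1"
    by (simp_all only: coprime_dvd_mult_right_iff[OF S_coprime[OF q]] coprime_dvd_mult_right_iff[OF S_coprime[OF r]])
  then have 1: "q 1 = r 1"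
    using S_first(3)[OF q] S_first(3)[OF r] by (intro zdvd_antisym_nonneg) linarith+
  have "q i = r i" if "i \<in> {2..d}" for i
    using m[OF that] S_first(3)[OF r] unfolding 1 by simp
  with 1 have "q i = r i" if "i \<in> {1..d}" for i using that unfolding insert_1 by blast
  moreover have "q \<in> extensional {1..d}" "r \<in> extensional {1..d}"
    using q r by (auto simp: S_def integer_points_def PiE_def)
  ultimately show ?thesis by (intro extensionalityI) auto
qed

text \<open>The minors are \<open>q 1 * x i\<close>, with \<open>x i\<close> the offset of
  \<open>r i\<close> from the vector parallel to \<open>q\<close> with first entry
  \<open>r 1\<close>. The largest minor is bounded below by a geometric mean of two of them, so its
  inverse is bounded by a product and the sum over \<open>r\<close> factors over the coordinates.
  The exponent 1/2 is summable without a logarithm.\<close>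

lemma pairset_sum_high:
  assumes k2: "k \<ge> 2" and st: "s \<le> t" and q: "q \<in> S s" and \<delta>: "\<delta> \<ge> 0"
  shows "(\<Sum>r\<in>S t - {q}. measure M' (pairset q r \<delta>))
    \<le> 2 * (2 * real R) ^ (d - 2) * (16 * (3 * K) ^ (d - 3) + 3 ^ d) * \<delta> * real (H t) ^ (d - 1) / H s"
proof -
  have d4: "d \<ge> 4" using k2 by (simp add: d_def)
  note q1 = S_first[OF q]
  have Hst: "H s \<le> H t" using st by (simp add: H_def)
  \<comment> \<open>The entries of the real multiple of \<open>q\<close> whose first entry is
    \<open>a\<close>. Since they depend on \<open>a = r 1\<close>, the sum over \<open>r\<close> is
    split according to \<open>a\<close>.\<close>
  define c where "c a i = real_of_int a * q i / q 1" for a i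
  \<comment> \<open>Coordinates 2 and 3 carry the weight: for \<open>d \<ge> 4\<close> both precede
    \<open>d\<close>, so they run through \<open>[H t, 2 * H t)\<close>.\<close>
  define G1 where "G1 a i v = (if i = 2 \<or> i = 3 then 1 / sqrt (max 1 \<bar>c a i - real_of_int v\<bar>) else 1)" for a and i :: nat and v
  \<comment> \<open>Indicator of the vectors within distance 1 of the parallel one. There a nonzero
    integer minor is only known to be at least 1, but at most \<open>3 ^ d\<close> such
    \<open>r\<close> exist for each \<open>a\<close>.\<close>
  define G2 where "G2 a i v = (if i = 1 \<or> \<bar>real_of_int v - c a i\<bar> \<le> 1 then 1 else 0::real)" for a and i :: nat and v
  define B where "B a i = (if i = 1 then {a} else if i = d then {b::int. \<bar>real_of_int b - 0\<bar> \<le> K * H t}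
    else {int (H t)..<2 * int (H t)})" for a and i :: nat
  have KH: "1 \<le> K * H t"
    using mult_mono[OF K_ge_1, of 1 "real (H t)"] H_ge_1[of t] K_pos by simp
  have finB: "finite (B a i)" for a i unfolding B_def using card_int_Icc_le(1)[of "K * H t" 0] KH by auto
  have G: "0 \<le> G1 a i v" "0 \<le> G2 a i v" for a i v by (auto simp: G1_def G2_def)
  define W where "W a r = 1 / H s * (\<Prod>i\<in>{1..d}. G1 a i (r i)) + (\<Prod>i\<in>{1..d}. G2 a i (r i))" for a and r :: "nat \<Rightarrow> int"
  have W0: "0 \<le> W a r" for a r unfolding W_def using G by (intro add_nonneg_nonneg mult_nonneg_nonneg prod_nonneg) auto
  have le_W: "measure M' (pairset q r \<delta>) \<le> 2 * \<delta> * (2 * real R) ^ (d - 2) * W (r 1) r"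
    if r: "r \<in> S t - {q}" for r
  proof -
    define x where "x i = c (r 1) i - r i" for i
    have m: "real_of_int (q i * r 1 - r i * q 1) = q 1 * x i" for i
      using q1 by (simp add: x_def c_def algebra_simps)
    have prod1: "(\<Prod>i\<in>{1..d}. G1 (r 1) i (r i)) = 1 / sqrt (max 1 \<bar>x 2\<bar>) * (1 / sqrt (max 1 \<bar>x 3\<bar>))"
    proof -
      have "(\<Prod>i\<in>{1..d}. G1 (r 1) i (r i)) = (\<Prod>i\<in>{2, 3}. G1 (r 1) i (r i))"
        using d4 by (intro prod.mono_neutral_right) (auto simp: G1_def)
      then show ?thesis by (simp add: G1_def x_def)
    qed
    have "\<exists>j\<in>{2..d}. x j \<noteq> 0 \<and> 1 / \<bar>q 1 * x j\<bar> \<le> W (r 1) r"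
    proof (cases "\<forall>i\<in>{2..d}. \<bar>x i\<bar> \<le> 1")
      case True
      obtain j where j: "j \<in> {2..d}" "q j * r 1 - r j * q 1 \<noteq> 0" using S_eqI[OF q, of r t] r by blast
      then have "1 \<le> \<bar>q j * r 1 - r j * q 1\<bar>" by linarith
      then have "1 \<le> \<bar>real_of_int (q j * r 1 - r j * q 1)\<bar>" by linarith
      moreover have "1 / z \<le> 1" if "1 \<le> z" for z :: real using that by simp
      ultimately have "1 / \<bar>q 1 * x j\<bar> \<le> 1" unfolding m by blast
      moreover have "(\<Prod>i\<in>{1..d}. G2 (r 1) i (r i)) = 1"
      proof (intro prod.neutral ballI)
        fix i assume "i \<in> {1..d}"
        then have "i = 1 \<or> \<bar>x i\<bar> \<le> 1" using True by (auto simp: insert_1)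
        then show "G2 (r 1) i (r i) = 1" by (auto simp: G2_def x_def abs_minus_commute)
      qed
      moreover have "0 \<le> 1 / H s * (\<Prod>i\<in>{1..d}. G1 (r 1) i (r i))" unfolding prod1 by simp
      moreover have "x j \<noteq> 0"
      proof
        assume "x j = 0"
        then have "real_of_int (q j * r 1 - r j * q 1) = 0" unfolding m by simp
        then show False using j(2) by (simp only: of_int_eq_0_iff)
      qed
      ultimately show ?thesis using j(1) unfolding W_def by (intro bexI[of _ j]) auto
    next
      case False
      \<comment> \<open>A single minor that dominates both square roots; if \<open>x 2\<close> and
        \<open>x 3\<close> are both small, any large offset elsewhere serves.\<close>
      have "\<exists>j\<in>{2..d}. max 1 \<bar>x 2\<bar> \<le> \<bar>x j\<bar> \<and> max 1 \<bar>x 3\<bar> \<le> \<bar>x j\<bar>"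
      proof -
        obtain i where i: "i \<in> {2..d}" "\<bar>x i\<bar> > 1" using False by force
        consider "\<bar>x 2\<bar> \<ge> 1" "\<bar>x 2\<bar> \<ge> \<bar>x 3\<bar>" | "\<bar>x 3\<bar> \<ge> 1" "\<bar>x 3\<bar> \<ge> \<bar>x 2\<bar>" | "\<bar>x 2\<bar> \<le> 1" "\<bar>x 3\<bar> \<le> 1"
          by linarith
        then show ?thesis
        proof cases
          case 1 then show ?thesis by (intro bexI[of _ 2]) (use d4 in auto)
        next
          case 2 then show ?thesis by (intro bexI[of _ 3]) (use d4 in auto)
        next
          case 3 then show ?thesis using i by (intro bexI[of _ i]) auto
        qed
      qed
      then obtain j where j: "j \<in> {2..d}" "max 1 \<bar>x 2\<bar> \<le> \<bar>x j\<bar>" "max 1 \<bar>x 3\<bar> \<le> \<bar>x j\<bar>" by blast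
      have "sqrt (max 1 \<bar>x 2\<bar>) * sqrt (max 1 \<bar>x 3\<bar>) \<le> sqrt \<bar>x j\<bar> * sqrt \<bar>x j\<bar>"
        using j by (intro mult_mono) auto
      also have "\<dots> = \<bar>x j\<bar>" by simp
      finally have "H s * (sqrt (max 1 \<bar>x 2\<bar>) * sqrt (max 1 \<bar>x 3\<bar>)) \<le> q 1 * \<bar>x j\<bar>"
        using q1 by (intro mult_mono) auto
      moreover have "0 < H s * (sqrt (max 1 \<bar>x 2\<bar>) * sqrt (max 1 \<bar>x 3\<bar>))"
        using H_pos[of s] by (intro mult_pos_pos) auto
      ultimately have "1 / (q 1 * \<bar>x j\<bar>) \<le> 1 / (H s * (sqrt (max 1 \<bar>x 2\<bar>) * sqrt (max 1 \<bar>x 3\<bar>)))"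
        by (intro frac_le[OF zero_le_one order_refl])
      also have "\<dots> = 1 / H s * (\<Prod>i\<in>{1..d}. G1 (r 1) i (r i))" unfolding prod1 by simp
      also have "\<dots> \<le> W (r 1) r" unfolding W_def using G by (simp add: prod_nonneg)
      finally have "1 / \<bar>q 1 * x j\<bar> \<le> W (r 1) r" using q1 by (simp add: abs_mult)
      moreover have "x j \<noteq> 0" using j by auto
      ultimately show ?thesis using j(1) by blast
    qed
    then obtain j where j: "j \<in> {2..d}" "x j \<noteq> 0" "1 / \<bar>q 1 * x j\<bar> \<le> W (r 1) r" by blast
    have "real_of_int (q j * r 1 - r j * q 1) \<noteq> 0" unfolding m using j q1 by simp
    then have "q j * r 1 - r j * q 1 \<noteq> 0" by (simp only: of_int_eq_0_iff not_False_eq_True)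
    from measure_pairset_le_slab[where \<delta>=\<delta> and q=q and r=r, OF j(1) this \<delta>]
    have "measure M' (pairset q r \<delta>) \<le> 2 * \<delta> * (2 * real R) ^ (d - 2) * (1 / \<bar>q 1 * x j\<bar>)"
      unfolding m by simp
    also have "\<dots> \<le> 2 * \<delta> * (2 * real R) ^ (d - 2) * W (r 1) r"
      using j \<delta> by (intro mult_left_mono) auto
    finally show ?thesis .
  qed
  have "(\<Sum>r\<in>S t - {q}. measure M' (pairset q r \<delta>))
      \<le> (\<Sum>(a, r)\<in>(SIGMA a:{int (H t)..<2 * int (H t)}. \<Pi>\<^sub>E i\<in>{1..d}. B a i). 2 * \<delta> * (2 * real R) ^ (d - 2) * W a r)"
  proof (rule sum_le_sum_inj_on[where \<phi>="\<lambda>r. (r 1, r)"])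
    show "inj_on (\<lambda>r. (r 1, r)) (S t - {q})" by (auto simp: inj_on_def)
    show "(\<lambda>r. (r 1, r)) ` (S t - {q}) \<subseteq> (SIGMA a:{int (H t)..<2 * int (H t)}. \<Pi>\<^sub>E i\<in>{1..d}. B a i)"
      using d_ge by (auto simp: S_def integer_points_def B_def PiE_def Pi_def extensional_def)
    show "finite (SIGMA a:{int (H t)..<2 * int (H t)}. \<Pi>\<^sub>E i\<in>{1..d}. B a i)"
      using finB by (intro finite_SigmaI finite_PiE) auto
  qed (use le_W W0 \<delta> in auto)
  also have "\<dots> = 2 * \<delta> * (2 * real R) ^ (d - 2) * (\<Sum>a\<in>{int (H t)..<2 * int (H t)}. \<Sum>r\<in>(\<Pi>\<^sub>E i\<in>{1..d}. B a i). W a r)"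
  proof -
    have "finite (\<Pi>\<^sub>E i\<in>{1..d}. B a i)" for a using finB by (intro finite_PiE) auto
    then show ?thesis by (subst sum.Sigma[symmetric]) (auto simp: sum_distrib_left)
  qed
  also have "\<dots> \<le> 2 * \<delta> * (2 * real R) ^ (d - 2) * (\<Sum>a\<in>{int (H t)..<2 * int (H t)}.
      1 / H s * (16 * (3 * K) ^ (d - 3) * real (H t) ^ (d - 2)) + 3 ^ d)"
  proof (intro mult_left_mono sum_mono)
    fix a
    have "(\<Sum>r\<in>(\<Pi>\<^sub>E i\<in>{1..d}. B a i). W a r)
        = 1 / H s * (\<Prod>i\<in>{1..d}. \<Sum>v\<in>B a i. G1 a i v) + (\<Prod>i\<in>{1..d}. \<Sum>v\<in>B a i. G2 a i v)"
      unfolding W_def sum.distrib sum_distrib_left[symmetric]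
      using finB by (subst (1 2) prod_sum_PiE) auto
    also have "(\<Prod>i\<in>{1..d}. \<Sum>v\<in>B a i. G2 a i v) \<le> (\<Prod>i\<in>{1..d}. 3)"
    proof (intro prod_mono conjI)
      fix i
      show "0 \<le> (\<Sum>v\<in>B a i. G2 a i v)" using G by (intro sum_nonneg) auto
      show "(\<Sum>v\<in>B a i. G2 a i v) \<le> 3"
      proof (cases "i = 1")
        case True then show ?thesis by (simp add: B_def G2_def)
      next
        case False
        have "(\<Sum>v\<in>B a i. G2 a i v) = real (card {v\<in>B a i. \<bar>real_of_int v - c a i\<bar> \<le> 1})"
          using finB[of a i] False by (simp add: G2_def sum.If_cases Int_def)
        also have "\<dots> \<le> real (card {v. \<bar>real_of_int v - c a i\<bar> \<le> 1})"
          using card_int_Icc_le(1)[of 1 "c a i"] by (intro of_nat_mono card_mono) auto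
        also have "\<dots> \<le> 3" using card_int_Icc_le(2)[of 1 "c a i"] by simp
        finally show ?thesis .
      qed
    qed
    also have "(\<Prod>i\<in>{1..d}. 3::real) = 3 ^ d" by simp
    also have "(\<Prod>i\<in>{1..d}. \<Sum>v\<in>B a i. G1 a i v)
        \<le> (\<Prod>i\<in>{1..d}. if i = 1 then 1 else if i = 2 \<or> i = 3 then 4 * sqrt (H t) else 3 * K * H t)"
    proof (intro prod_mono conjI)
      fix i assume i: "i \<in> {1..d}"
      show "0 \<le> (\<Sum>v\<in>B a i. G1 a i v)" using G by (intro sum_nonneg) auto
      consider "i = 1" | "i = 2 \<or> i = 3" | "i = d" "i \<noteq> 1" "i \<noteq> 2" "i \<noteq> 3"
        | "i \<noteq> d" "i \<noteq> 1" "i \<noteq> 2" "i \<noteq> 3" by blast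
      then show "(\<Sum>v\<in>B a i. G1 a i v) \<le> (if i = 1 then 1 else if i = 2 \<or> i = 3 then 4 * sqrt (H t) else 3 * K * H t)"
      proof cases
        case 1 then show ?thesis by (simp add: B_def G1_def)
      next
        case 2
        then have "B a i = {int (H t)..<2 * int (H t)}" using d4 by (auto simp: B_def)
        then show ?thesis using 2 sum_inverse_sqrt_dist_le[of "c a i" "H t"] by (auto simp: G1_def)
      next
        case 3
        have "real (card (B a i)) \<le> 2 * (K * H t) + 1"
          unfolding B_def using 3 card_int_Icc_le(2)[of "K * H t" 0] KH by auto
        then show ?thesis using 3 KH by (simp add: G1_def)
      next
        case 4
        have "real (H t) \<le> 3 * K * H t" using K_ge_1 by (simp add: mult_le_cancel_right1)
        then show ?thesis using 4 by (simp add: G1_def B_def)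
      qed
    qed
    also have "\<dots> = 16 * (3 * K) ^ (d - 3) * real (H t) ^ (d - 2)"
    proof -
      have "{1..d} = {1, 2, 3} \<union> {4..d}" using d4 by auto
      then have "(\<Prod>i\<in>{1..d}. if i = 1 then 1 else if i = 2 \<or> i = 3 then 4 * sqrt (H t) else 3 * K * H t)
        = (4 * sqrt (H t)) * (4 * sqrt (H t)) * (3 * K * H t) ^ (d - 3)"
        by (simp add: prod.union_disjoint)
      also have "\<dots> = 16 * (3 * K) ^ (d - 3) * (H t * real (H t) ^ (d - 3))"
        by (simp add: power_mult_distrib)
      also have "H t * real (H t) ^ (d - 3) = real (H t) ^ (d - 2)"
      proof -
        have "d - 2 = Suc (d - 3)" using d4 by simp
        then show ?thesis by (simp only: power_Suc)
      qed
      finally show ?thesis .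
    qed
    finally show "(\<Sum>r\<in>(\<Pi>\<^sub>E i\<in>{1..d}. B a i). W a r)
      \<le> 1 / H s * (16 * (3 * K) ^ (d - 3) * real (H t) ^ (d - 2)) + 3 ^ d"
      by (simp add: mult_left_mono divide_right_mono)
  qed (use \<delta> in auto)
  \<comment> \<open>The nearly parallel vectors contribute \<open>3 ^ d * H t\<close>, which is
    affordable since \<open>H s \<le> H t ^ (d - 2)\<close>.\<close>
  also have "\<dots> \<le> 2 * \<delta> * (2 * real R) ^ (d - 2) * ((16 * (3 * K) ^ (d - 3) + 3 ^ d) * real (H t) ^ (d - 1) / H s)"
  proof (intro mult_left_mono)
    have e: "real (H t) ^ (d - 1) = H t * real (H t) ^ (d - 2)"
    proof -
      have "d - 1 = Suc (d - 2)" using d4 by simp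
      then show ?thesis by (simp only: power_Suc)
    qed
    have "real (H s) * 1 \<le> real (H t) ^ (d - 2)"
    proof -
      have "real (H s) \<le> real (H t) ^ 1" using Hst by simp
      also have "\<dots> \<le> real (H t) ^ (d - 2)" using H_ge_1[of t] d4 by (intro power_increasing) auto
      finally show ?thesis by simp
    qed
    then have "1 \<le> real (H t) ^ (d - 2) / H s" using H_pos[of s] by (simp add: pos_le_divide_eq)
    then have "real (H t) * 3 ^ d * 1 \<le> real (H t) * 3 ^ d * (real (H t) ^ (d - 2) / H s)" by (intro mult_left_mono) auto
    then show "(\<Sum>a\<in>{int (H t)..<2 * int (H t)}. 1 / H s * (16 * (3 * K) ^ (d - 3) * real (H t) ^ (d - 2)) + 3 ^ d)
      \<le> (16 * (3 * K) ^ (d - 3) + 3 ^ d) * real (H t) ^ (d - 1) / H s"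
      unfolding e by (simp add: algebra_simps add_divide_distrib)
  qed (use \<delta> in auto)
  finally show ?thesis by (simp add: mult_ac)
qed

section \<open>Pair sums for \<open>k = 1\<close>\<close>

lemma d_eq_2: "k = 1 \<Longrightarrow> d = 2"
  unfolding d_def by simp

text \<open>In dimension two there is a single minor, and \<open>pairset\<close> confines it to the quotient of
  \<open>y (r 1 - q 1)\<close> by a number between \<open>1/R\<close> and \<open>R\<close>, up to \<open>\<delta>\<close>.\<close>

lemma pairset_dim2:
  fixes \<delta> :: real
  assumes "k = 1" and ne: "pairset q r \<delta> \<noteq> {}" and \<delta>: "\<delta> \<ge> 0"
  defines "m \<equiv> q 2 * r 1 - r 2 * q 1" and "D \<equiv> r 1 - q 1"
  shows "\<bar>real_of_int m\<bar> \<le> R * (\<bar>y\<bar> * \<bar>real_of_int D\<bar> + \<delta>)" and "\<bar>y\<bar> * \<bar>real_of_int D\<bar> \<le> R * \<bar>real_of_int m\<bar> + \<delta>"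
    and "m \<noteq> 0 \<Longrightarrow> measure M' (pairset q r \<delta>) \<le> 2 * \<delta> / \<bar>real_of_int m\<bar>"
proof -
  note d2 = d_eq_2[OF assms(1)]
  obtain x where "x \<in> pairset q r \<delta>" using ne by blast
  then have x: "1 / R \<le> \<bar>x 2\<bar>" "\<bar>x 2\<bar> \<le> R" and le: "\<bar>x 2 * m - y * D\<bar> \<le> \<delta>"
    unfolding pairset_def Q'_def m_def D_def d2 by auto
  have yD: "\<bar>y * D\<bar> = \<bar>y\<bar> * \<bar>real_of_int D\<bar>" by (simp add: abs_mult)
  have "1 / R * \<bar>real_of_int m\<bar> \<le> \<bar>x 2\<bar> * \<bar>real_of_int m\<bar>" using x by (intro mult_right_mono) auto
  also have "\<dots> = \<bar>x 2 * m\<bar>" by (simp add: abs_mult)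
  also have "\<dots> \<le> \<bar>y\<bar> * \<bar>real_of_int D\<bar> + \<delta>" using le yD by linarith
  finally show "\<bar>real_of_int m\<bar> \<le> R * (\<bar>y\<bar> * \<bar>real_of_int D\<bar> + \<delta>)" using R by (simp add: pos_divide_le_eq mult.commute)
  have "\<bar>x 2 * m\<bar> \<le> R * \<bar>real_of_int m\<bar>" using x by (simp add: abs_mult mult_right_mono)
  then show "\<bar>y\<bar> * \<bar>real_of_int D\<bar> \<le> R * \<bar>real_of_int m\<bar> + \<delta>" using le yD by linarith
  show "measure M' (pairset q r \<delta>) \<le> 2 * \<delta> / \<bar>real_of_int m\<bar>" if "m \<noteq> 0"
    using measure_pairset_le_slab[of 2 q r \<delta>] that \<delta> unfolding m_def d2 by simp
qed

lemma S_dim2_eqI: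
  assumes "k = 1" "q \<in> S s" "r \<in> S t" "q 2 * r 1 - r 2 * q 1 = 0"
  shows "q = r"
proof (rule S_eqI[OF assms(2,3)])
  fix i assume "i \<in> {2..d}"
  then have "i = 2" using d_eq_2[OF assms(1)] by simp
  then show "q i * r 1 - r i * q 1 = 0" using assms(4) by simp
qed

text \<open>The single minor is an integer of modulus at most \<open>R * \<delta> < 1\<close>, hence
  0, which would force \<open>q = r\<close>. With the truncation, strips of one level therefore do
  not overlap in \<open>Q\<close>.\<close>

lemma pairset_dim2_homogeneous_empty:
  fixes \<delta> :: real
  assumes k1: "k = 1" and "y = 0" and q: "q \<in> S s" and r: "r \<in> S t" "q \<noteq> r" and \<delta>: "0 \<le> \<delta>" "R * \<delta> < 1"
  shows "pairset q r \<delta> = {}"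
proof (rule ccontr)
  assume "pairset q r \<delta> \<noteq> {}"
  from pairset_dim2(1)[OF k1 this \<delta>(1)] have "\<bar>real_of_int (q 2 * r 1 - r 2 * q 1)\<bar> < 1"
    using assms(2) \<delta>(2) by simp
  then have "q 2 * r 1 - r 2 * q 1 = 0" by linarith
  then show False using S_dim2_eqI[OF k1 q r(1)] r(2) by blast
qed

text \<open>For fixed \<open>q\<close>, primitivity makes \<open>r\<close> unique modulo \<open>q\<close> once the minor is given.\<close>

lemma pairset_sum_dim2_homogeneous:
  fixes \<delta> :: real
  assumes k1: "k = 1" and y0: "y = 0" and st: "s \<le> t" and q: "q \<in> S s" and \<delta>: "0 \<le> \<delta>"
  shows "(\<Sum>r\<in>S t - {q}. measure M' (pairset q r \<delta>)) \<le> 12 * real R ^ 2 * \<delta> * H t / H s"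
proof -
  note q1 = S_first[OF q]
  have Hst: "H s \<le> H t" using st by (simp add: H_def)
  note d2 = d_eq_2[OF k1]
  let ?m = "\<lambda>r. q 2 * r 1 - r 2 * q 1"
  \<comment> \<open>The minor fixes \<open>r 1\<close> modulo \<open>q 1\<close>; the quotient
    supplies the rest, and it is at most \<open>2 * H t / H s\<close>.\<close>
  let ?\<phi> = "\<lambda>r. (?m r, r 1 div q 1)"
  define A where "A = {r \<in> S t - {q}. pairset q r \<delta> \<noteq> {}}"
  define B where "B = {m::int. m \<noteq> 0 \<and> \<bar>real_of_int m\<bar> \<le> R * \<delta>} \<times> {0..\<lfloor>2 * real (H t) / real (H s)\<rfloor>}"
  have finB: "finite B" unfolding B_def using card_nonzero_int_le(1)[of "R * \<delta>"] \<delta> by simp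
  have "(\<Sum>r\<in>S t - {q}. measure M' (pairset q r \<delta>)) = (\<Sum>r\<in>A. measure M' (pairset q r \<delta>))"
    unfolding A_def using finite_S by (intro sum.mono_neutral_right) auto
  \<comment> \<open>The measure is bounded trivially. The factor \<open>\<delta>\<close> comes from
    the number of admissible minors, whereas summing their inverses would lose the
    logarithm.\<close>
  also have "\<dots> \<le> (\<Sum>b\<in>B. 2 * real R)"
  proof (rule sum_le_sum_inj_on[where \<phi>="?\<phi>"])
    show "inj_on ?\<phi> A"
    proof (rule inj_onI)
      fix r r' assume rr: "r \<in> A" "r' \<in> A" "?\<phi> r = ?\<phi> r'"
      then have r: "r \<in> S t" "r' \<in> S t" by (auto simp: A_def)
      have eq: "q 2 * (r 1 - r' 1) = q 1 * (r 2 - r' 2)" using rr(3) by (simp add: algebra_simps)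
      then have "q 1 dvd q 2 * (r 1 - r' 1)" by simp
      then have "q 1 dvd r 1 - r' 1" by (simp only: coprime_dvd_mult_right_iff[OF S_coprime[OF q]])
      then have "r 1 mod q 1 = r' 1 mod q 1" by (simp add: mod_eq_dvd_iff)
      then have 1: "r 1 = r' 1" using rr(3) by (metis div_mult_mod_eq snd_conv)
      then have 2: "r 2 = r' 2" using eq q1(3) by simp
      have "r i = r' i" if "i \<in> {1..d}" for i
      proof -
        have "i = 1 \<or> i = 2" using that d2 by auto
        then show ?thesis using 1 2 by blast
      qed
      moreover have "r \<in> extensional {1..d}" "r' \<in> extensional {1..d}"
        using r by (auto simp: S_def integer_points_def PiE_def)
      ultimately show "r = r'" by (intro extensionalityI) auto
    qed
    show "?\<phi> ` A \<subseteq> B"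
    proof safe
      fix r assume r: "r \<in> A"
      then have rS: "r \<in> S t" "r \<noteq> q" and ne: "pairset q r \<delta> \<noteq> {}" by (auto simp: A_def)
      note r1 = S_first[OF rS(1)]
      have "?m r \<noteq> 0" using S_dim2_eqI[OF k1 q rS(1)] rS(2) by blast
      moreover have "\<bar>real_of_int (?m r)\<bar> \<le> R * \<delta>" using pairset_dim2(1)[OF k1 ne \<delta>] y0 by simp
      moreover have "0 \<le> r 1 div q 1" using q1 r1 by (simp add: pos_imp_zdiv_nonneg_iff)
      moreover have "r 1 div q 1 \<le> \<lfloor>2 * real (H t) / H s\<rfloor>"
      proof -
        have "real_of_int (r 1 div q 1) \<le> real_of_int (r 1) / q 1" by (rule real_of_int_div4)
        also have "\<dots> \<le> 2 * real (H t) / H s"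
          using q1 r1 H_pos[of s] by (intro frac_le) auto
        finally show ?thesis by (simp add: le_floor_iff)
      qed
      ultimately show "?\<phi> r \<in> B" by (auto simp: B_def)
    qed
    show "measure M' (pairset q r \<delta>) \<le> 2 * real R" if "r \<in> A" for r
      using measure_pairset_le_box[of q r \<delta>] d2 by simp
  qed (use finB in auto)
  also have "\<dots> = real (card {m::int. m \<noteq> 0 \<and> \<bar>real_of_int m\<bar> \<le> R * \<delta>}) * real (card {0..\<lfloor>2 * real (H t) / real (H s)\<rfloor>}) * (2 * real R)"
    by (simp add: B_def card_cartesian_product)
  also have "\<dots> \<le> 2 * (R * \<delta>) * (3 * (H t / H s)) * (2 * real R)"
  proof (intro mult_mono)
    have "1 \<le> real (H t) / H s" using Hst H_pos[of s] by (simp add: pos_le_divide_eq)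
    then show "real (card {0..\<lfloor>2 * real (H t) / H s\<rfloor>}) \<le> 3 * (real (H t) / H s)" by simp linarith
  qed (use card_nonzero_int_le(2)[of "R * \<delta>"] \<delta> in auto)
  also have "\<dots> = 12 * real R ^ 2 * \<delta> * H t / H s" by (simp add: power2_eq_square)
  finally show ?thesis .
qed

text \<open>For \<open>s < t\<close> the difference \<open>r 1 - q 1\<close> has the size of
  \<open>H t\<close>, so the minor is comparable to \<open>\<bar>y\<bar> * H t\<close> from both
  sides. The lower bound makes each measure small; the upper bound leaves of order
  \<open>H t / H s\<close> values of \<open>r 2\<close> for each \<open>r 1\<close>.\<close>

lemma pairset_sum_dim2_inhomogeneous_cross:
  fixes \<delta> :: real
  assumes k1: "k = 1" and y: "y \<noteq> 0" and st: "s < t" and q: "q \<in> S s"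
    and \<delta>: "0 \<le> \<delta>" "8 * \<delta> \<le> \<bar>y\<bar> * H t"
  shows "(\<Sum>r\<in>S t - {q}. measure M' (pairset q r \<delta>))
    \<le> (8 * R * \<bar>y\<bar> + 1) * (8 * R / \<bar>y\<bar>) * \<delta> * H t / H s"
proof -
  note q1 = S_first[OF q]
  note d2 = d_eq_2[OF k1]
  have Hst: "4 * H s \<le> H t"
  proof -
    have "(4::nat) ^ Suc s \<le> 4 ^ t" using st by (intro power_increasing) auto
    then show ?thesis by (simp add: H_def)
  qed
  \<comment> \<open>The upper bound \<open>4 * R * \<bar>y\<bar> * H t\<close> for the minor,
    divided by \<open>q 1 \<ge> H s\<close>.\<close>
  define X where "X = 4 * R * \<bar>y\<bar> * H t / H s"
  have X: "X \<ge> 0" by (simp add: X_def)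
  define A where "A = {r \<in> S t - {q}. pairset q r \<delta> \<noteq> {}}"
  define B where "B = (SIGMA a:{int (H t)..<2 * int (H t)}. {b::int. \<bar>real_of_int b - q 2 * real_of_int a / q 1\<bar> \<le> X})"
  have fin: "finite {b::int. \<bar>real_of_int b - z\<bar> \<le> X}" for z using card_int_Icc_le(1)[OF X] .
  have "(\<Sum>r\<in>S t - {q}. measure M' (pairset q r \<delta>)) = (\<Sum>r\<in>A. measure M' (pairset q r \<delta>))"
    unfolding A_def using finite_S by (intro sum.mono_neutral_right) auto
  also have "\<dots> \<le> (\<Sum>b\<in>B. 8 * R * \<delta> / (\<bar>y\<bar> * H t))"
  proof (rule sum_le_sum_inj_on[where \<phi>="\<lambda>r. (r 1, r 2)"])
    show "inj_on (\<lambda>r. (r 1, r 2)) A"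
    proof (rule inj_onI)
      fix r r' assume rr: "r \<in> A" "r' \<in> A" "(r 1, r 2) = (r' 1, r' 2)"
      have "r i = r' i" if "i \<in> {1..d}" for i
      proof -
        have "i = 1 \<or> i = 2" using that d2 by auto
        then show ?thesis using rr(3) by blast
      qed
      moreover have "r \<in> extensional {1..d}" "r' \<in> extensional {1..d}"
        using rr by (auto simp: A_def S_def integer_points_def PiE_def)
      ultimately show "r = r'" by (intro extensionalityI) auto
    qed
    have main: "\<bar>real_of_int (r 2) - q 2 * real_of_int (r 1) / q 1\<bar> \<le> X \<and>
        measure M' (pairset q r \<delta>) \<le> 8 * R * \<delta> / (\<bar>y\<bar> * H t)" if r: "r \<in> A" for r
    proof -
      have rS: "r \<in> S t" and ne: "pairset q r \<delta> \<noteq> {}" using r by (auto simp: A_def)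
      note r1 = S_first[OF rS]
      define m where "m = q 2 * r 1 - r 2 * q 1"
      define D where "D = \<bar>real_of_int (r 1 - q 1)\<bar>"
      \<comment> \<open>Here the ratio 4 between levels enters:
        \<open>q 1 < 2 * H s \<le> H t / 2\<close>.\<close>
      have D: "H t \<le> 2 * D" "D \<le> 2 * H t" using q1 r1 Hst by (auto simp: D_def)
      have yD: "\<bar>y\<bar> * H t \<le> 2 * (\<bar>y\<bar> * D)" "\<bar>y\<bar> * D \<le> 2 * (\<bar>y\<bar> * H t)"
        using mult_left_mono[OF D(1), of "\<bar>y\<bar>"] mult_left_mono[OF D(2), of "\<bar>y\<bar>"] by (auto simp: mult_ac)
      have up: "\<bar>real_of_int m\<bar> \<le> R * (\<bar>y\<bar> * D + \<delta>)" and lo: "\<bar>y\<bar> * D \<le> R * \<bar>real_of_int m\<bar> + \<delta>"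
        using pairset_dim2(1,2)[OF k1 ne \<delta>(1)] unfolding m_def D_def by blast+
      have "R * \<bar>real_of_int m\<bar> \<ge> \<bar>y\<bar> * H t / 4" using lo yD \<delta>(2) by linarith
      then have lo': "\<bar>y\<bar> * H t / (4 * R) \<le> \<bar>real_of_int m\<bar>"
        using R by (simp add: pos_divide_le_eq mult.commute mult.left_commute)
      have yH: "\<bar>y\<bar> * H t > 0" using y H_pos[of t] by simp
      then have "0 < \<bar>y\<bar> * H t / (4 * R)" using R by simp
      with lo' have m0: "m \<noteq> 0" by auto
      have "measure M' (pairset q r \<delta>) \<le> 2 * \<delta> / \<bar>real_of_int m\<bar>"
        using pairset_dim2(3)[OF k1 ne \<delta>(1)] m0 by (simp add: m_def)
      also have "\<dots> \<le> 2 * \<delta> / (\<bar>y\<bar> * H t / (4 * R))"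
        using lo' \<delta>(1) \<open>0 < \<bar>y\<bar> * H t / (4 * R)\<close> by (intro frac_le) simp_all
      also have "\<dots> = 8 * R * \<delta> / (\<bar>y\<bar> * H t)" by simp
      finally have 1: "measure M' (pairset q r \<delta>) \<le> 8 * R * \<delta> / (\<bar>y\<bar> * H t)" .
      have "\<bar>real_of_int m\<bar> \<le> R * (4 * (\<bar>y\<bar> * H t))"
        using up yD \<delta> by (elim order_trans, intro mult_left_mono) linarith+
      moreover have "\<bar>real_of_int m\<bar> = \<bar>real_of_int (r 2) - q 2 * real_of_int (r 1) / q 1\<bar> * q 1"
      proof -
        have "real_of_int m = - ((real_of_int (r 2) - q 2 * real_of_int (r 1) / q 1) * q 1)"
          using q1 by (simp add: m_def algebra_simps)
        then show ?thesis using q1 by (simp add: abs_mult)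
      qed
      moreover have "\<bar>real_of_int (r 2) - q 2 * real_of_int (r 1) / q 1\<bar> * H s
          \<le> \<bar>real_of_int (r 2) - q 2 * real_of_int (r 1) / q 1\<bar> * q 1"
        using q1 by (intro mult_left_mono) auto
      ultimately have "\<bar>real_of_int (r 2) - q 2 * real_of_int (r 1) / q 1\<bar> * H s \<le> R * (4 * (\<bar>y\<bar> * H t))"
        by linarith
      then have "\<bar>real_of_int (r 2) - q 2 * real_of_int (r 1) / q 1\<bar> \<le> X"
        using H_pos[of s] unfolding X_def by (subst pos_le_divide_eq) (auto simp: mult_ac)
      with 1 show ?thesis by blast
    qed
    show "(\<lambda>r. (r 1, r 2)) ` A \<subseteq> B"
    proof safe
      fix r assume r: "r \<in> A"
      then have "int (H t) \<le> r 1" "r 1 < 2 * int (H t)" using d_ge by (auto simp: A_def S_def)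
      then show "(r 1, r 2) \<in> B" using main[OF r] by (simp add: B_def)
    qed
    show "measure M' (pairset q r \<delta>) \<le> 8 * R * \<delta> / (\<bar>y\<bar> * H t)" if "r \<in> A" for r
      using main[OF that] by blast
  qed (use \<delta> fin in \<open>auto simp: B_def\<close>)
  also have "\<dots> = real (card B) * (8 * R * \<delta> / (\<bar>y\<bar> * H t))" by simp
  also have "\<dots> \<le> H t * ((8 * R * \<bar>y\<bar> + 1) * (H t / H s)) * (8 * R * \<delta> / (\<bar>y\<bar> * H t))"
  proof (intro mult_right_mono)
    have "real (card B) = (\<Sum>a\<in>{int (H t)..<2 * int (H t)}. real (card {b::int. \<bar>real_of_int b - q 2 * real_of_int a / q 1\<bar> \<le> X}))"
      unfolding B_def using fin by (simp add: card_SigmaI)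
    also have "\<dots> \<le> (\<Sum>a\<in>{int (H t)..<2 * int (H t)}. 2 * X + 1)"
      by (intro sum_mono card_int_Icc_le X)
    also have "\<dots> = H t * (2 * X + 1)" by simp
    also have "\<dots> \<le> H t * ((8 * R * \<bar>y\<bar> + 1) * (H t / H s))"
    proof (intro mult_left_mono)
      have "1 \<le> real (H t) / H s" using Hst H_pos[of s] by (simp add: pos_le_divide_eq)
      moreover have "2 * X = 8 * R * \<bar>y\<bar> * (H t / H s)" by (simp add: X_def)
      ultimately show "2 * X + 1 \<le> (8 * R * \<bar>y\<bar> + 1) * (H t / H s)"
        unfolding distrib_right by linarith
    qed auto
    finally show "real (card B) \<le> H t * ((8 * R * \<bar>y\<bar> + 1) * (H t / H s))" .
  qed (use \<delta> in auto)
  also have "\<dots> = (8 * R * \<bar>y\<bar> + 1) * (8 * R / \<bar>y\<bar>) * \<delta> * H t / H s"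
    using H_pos[of t] by (simp add: mult_ac)
  finally show ?thesis .
qed

text \<open>For \<open>s = t\<close> one sums over the difference vector \<open>(D, e) = r - q\<close> first: the strip condition
  forces \<open>q\<close> to be almost parallel to it, which leaves boundedly many \<open>q 2\<close> for given
  \<open>q 1\<close>, \<open>D\<close> and \<open>e\<close>.\<close>

lemma pairset_sum_dim2_inhomogeneous_same:
  fixes \<delta> :: real
  assumes k1: "k = 1" and y: "y \<noteq> 0" and \<delta>: "0 \<le> \<delta>" "R * \<delta> < 1" "2 * \<delta> \<le> \<bar>y\<bar>"
  shows "(\<Sum>q\<in>S t. \<Sum>r\<in>S t - {q}. measure M' (pairset q r \<delta>))
    \<le> (2 * (K + 2 * R * \<bar>y\<bar>) + 1) * (4 * R * \<bar>y\<bar> + 1) * (4 * R / \<bar>y\<bar>) * \<delta> * H t ^ 2"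
proof -
  note d2 = d_eq_2[OF k1]
  \<comment> \<open>A bound for \<open>\<bar>e\<bar> / \<bar>D\<bar>\<close>: in
    \<open>q 1 * e = q 2 * D - m\<close> one has \<open>\<bar>q 2\<bar> \<le> K * H t\<close> and
    \<open>\<bar>m\<bar> \<le> Z * \<bar>D\<bar>\<close>.\<close>
  define c where "c = K + 2 * R * \<bar>y\<bar>"
  have c: "c \<ge> 0" using K_pos by (simp add: c_def)
  define Z where "Z = 2 * R * \<bar>y\<bar>"
  have Z: "Z \<ge> 0" by (simp add: Z_def)
  define J where "J = {int (H t)..<2 * int (H t)}"
  define A where "A = {(q, r) \<in> S t \<times> S t. q \<noteq> r \<and> pairset q r \<delta> \<noteq> {}}"
  define P where "P = (SIGMA a:J. J - {a})"
  define F where "F = (\<lambda>(a::int, b::int). {e::int. \<bar>real_of_int e - 0\<bar> \<le> c * \<bar>b - a\<bar>})"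
  define G where "G = (\<lambda>((a::int, b::int), e::int). {v::int. \<bar>real_of_int v - real_of_int a * e / (b - a)\<bar> \<le> Z})"
  define B where "B = (SIGMA x:(SIGMA ab:P. F ab). G x)"
  have finJ: "finite J" by (simp add: J_def)
  have finP: "finite P" unfolding P_def using finJ by auto
  have finF: "finite (F ab)" for ab 
  proof (cases ab)
    case (Pair a b)
    have "0 \<le> c * \<bar>b - a\<bar>" using c by simp
    from card_int_Icc_le(1)[OF this, of 0] show ?thesis unfolding F_def Pair by simp
  qed
  have finG: "finite (G x)" for x unfolding G_def using card_int_Icc_le(1)[OF Z] by (auto split: prod.split)
  have finB: "finite B" unfolding B_def using finP finF finG by auto
  define g where "g = (\<lambda>(((a::int, b::int), e::int), v::int). 4 * R * \<delta> / (\<bar>y\<bar> * \<bar>b - a\<bar>))"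
  have g0: "0 \<le> g x" for x unfolding g_def using \<delta> by (auto split: prod.split)
  have "(\<Sum>q\<in>S t. \<Sum>r\<in>S t - {q}. measure M' (pairset q r \<delta>))
      = (\<Sum>(q, r)\<in>(SIGMA q:S t. S t - {q}). measure M' (pairset q r \<delta>))"
    using finite_S by (subst sum.Sigma) auto
  also have "\<dots> = (\<Sum>(q, r)\<in>A. measure M' (pairset q r \<delta>))"
    using finite_S by (intro sum.mono_neutral_right finite_SigmaI) (auto simp: A_def)
  also have "\<dots> \<le> (\<Sum>x\<in>B. g x)"
  proof (rule sum_le_sum_inj_on[where \<phi>="\<lambda>(q, r). (((q 1, r 1), r 2 - q 2), q 2)"])
    have eqI: "q = r" if "q \<in> S t" "r \<in> S t" "q 1 = r 1" "q 2 = r 2" for q r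
    proof -
      have "q i = r i" if "i \<in> {1..d}" for i
      proof -
        have "i = 1 \<or> i = 2" using that d2 by auto
        then show ?thesis using \<open>q 1 = r 1\<close> \<open>q 2 = r 2\<close> by blast
      qed
      moreover have "q \<in> extensional {1..d}" "r \<in> extensional {1..d}"
        using that by (auto simp: S_def integer_points_def PiE_def)
      ultimately show ?thesis by (intro extensionalityI) auto
    qed
    show "inj_on (\<lambda>(q, r). (((q 1, r 1), r 2 - q 2), q 2)) A"
    proof (rule inj_onI, clarify)
      fix q r q' r' :: "nat \<Rightarrow> int"
      assume *: "(q, r) \<in> A" "(q', r') \<in> A" "q 1 = q' 1" "r 1 = r' 1" "r 2 - q 2 = r' 2 - q' 2" "q 2 = q' 2"
      then have "q \<in> S t" "r \<in> S t" "q' \<in> S t" "r' \<in> S t" by (simp_all add: A_def)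
      moreover have "r 2 = r' 2" using * by simp
      ultimately show "q = q' \<and> r = r'" using * eqI by blast
    qed
    have main: "(((q 1, r 1), r 2 - q 2), q 2) \<in> B \<and>
        measure M' (pairset q r \<delta>) \<le> g (((q 1, r 1), r 2 - q 2), q 2)" if qr: "(q, r) \<in> A" for q r
    proof -
      have S: "q \<in> S t" "r \<in> S t" and ne: "q \<noteq> r" "pairset q r \<delta> \<noteq> {}" using qr by (simp_all add: A_def)
      note q1 = S_first[OF S(1)] and r1 = S_first[OF S(2)]
      define m where "m = q 2 * r 1 - r 2 * q 1"
      define D where "D = r 1 - q 1"
      define e where "e = r 2 - q 2"
      have mDe: "m = q 2 * D - q 1 * e" by (simp add: m_def D_def e_def algebra_simps)
      have up: "\<bar>real_of_int m\<bar> \<le> R * (\<bar>y\<bar> * \<bar>real_of_int D\<bar> + \<delta>)"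
        and lo: "\<bar>y\<bar> * \<bar>real_of_int D\<bar> \<le> R * \<bar>real_of_int m\<bar> + \<delta>"
        using pairset_dim2(1,2)[OF k1 ne(2) \<delta>(1)] unfolding m_def D_def by blast+
      \<comment> \<open>With equal first entries the minor would be below 1 in modulus, hence 0, and
        \<open>q = r\<close>.\<close>
      have D0: "D \<noteq> 0"
      proof
        assume "D = 0"
        then have "\<bar>real_of_int m\<bar> < 1" using up \<delta> by simp
        then have "m = 0" by linarith
        then show False using S_dim2_eqI[OF k1 S] ne by (simp add: m_def)
      qed
      then have "1 \<le> \<bar>D\<bar>" by linarith
      then have D1: "1 \<le> \<bar>real_of_int D\<bar>" by linarith
      have yD: "\<bar>y\<bar> * 1 \<le> \<bar>y\<bar> * \<bar>real_of_int D\<bar>" using D1 by (intro mult_left_mono) auto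
      have yDpos: "0 < \<bar>y\<bar> * \<bar>real_of_int D\<bar>" using y D0 by simp
      have "\<bar>y\<bar> * \<bar>real_of_int D\<bar> / 2 \<le> R * \<bar>real_of_int m\<bar>" using lo yD \<delta> by linarith
      then have lo': "\<bar>y\<bar> * \<bar>real_of_int D\<bar> / (2 * R) \<le> \<bar>real_of_int m\<bar>"
        using R by (simp add: pos_divide_le_eq mult.commute mult.left_commute)
      have pos: "0 < \<bar>y\<bar> * \<bar>real_of_int D\<bar> / (2 * R)" using yDpos R by simp
      with lo' have m0: "m \<noteq> 0" by auto
      have "measure M' (pairset q r \<delta>) \<le> 2 * \<delta> / \<bar>real_of_int m\<bar>"
        using pairset_dim2(3)[OF k1 ne(2) \<delta>(1)] m0 by (simp add: m_def)
      also have "\<dots> \<le> 2 * \<delta> / (\<bar>y\<bar> * \<bar>real_of_int D\<bar> / (2 * R))"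
        using lo' \<delta>(1) pos by (intro frac_le) simp_all
      also have "\<dots> = g (((q 1, r 1), r 2 - q 2), q 2)" by (simp add: g_def D_def)
      finally have 1: "measure M' (pairset q r \<delta>) \<le> g (((q 1, r 1), r 2 - q 2), q 2)" .
      have up': "\<bar>real_of_int m\<bar> \<le> Z * \<bar>real_of_int D\<bar>"
      proof -
        have "R * (\<bar>y\<bar> * \<bar>real_of_int D\<bar> + \<delta>) \<le> R * (2 * (\<bar>y\<bar> * \<bar>real_of_int D\<bar>))"
          using yD \<delta> by (intro mult_left_mono) linarith+
        then show ?thesis using up by (simp add: Z_def mult_ac)
      qed
      have q2: "\<bar>real_of_int (q 2)\<bar> \<le> K * H t" using S(1) d2 by (simp add: S_def)
      have "real (H t) * \<bar>real_of_int e\<bar> \<le> q 1 * \<bar>real_of_int e\<bar>" using q1 by (intro mult_right_mono) auto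
      also have "\<dots> = \<bar>real_of_int (q 2 * D - m)\<bar>" using q1 unfolding mDe by (simp add: abs_mult)
      also have "\<dots> \<le> \<bar>real_of_int (q 2)\<bar> * \<bar>real_of_int D\<bar> + \<bar>real_of_int m\<bar>"
        by (simp add: abs_mult[symmetric])
      also have "\<dots> \<le> K * H t * \<bar>real_of_int D\<bar> + Z * \<bar>real_of_int D\<bar> * H t"
      proof (intro add_mono mult_right_mono q2)
        have "Z * \<bar>real_of_int D\<bar> * 1 \<le> Z * \<bar>real_of_int D\<bar> * H t"
          using Z H_ge_1[of t] by (intro mult_left_mono) auto
        then show "\<bar>real_of_int m\<bar> \<le> Z * \<bar>real_of_int D\<bar> * H t" using up' by linarith
      qed auto
      also have "\<dots> = real (H t) * (c * \<bar>real_of_int D\<bar>)" by (simp add: c_def Z_def algebra_simps)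
      finally have e: "\<bar>real_of_int e\<bar> \<le> c * \<bar>real_of_int D\<bar>"
        using H_pos[of t] by (subst (asm) mult_le_cancel_left_pos) auto
      have "real_of_int m = (real_of_int (q 2) - real_of_int (q 1) * e / D) * D"
        using D0 by (simp add: mDe algebra_simps)
      then have "\<bar>real_of_int (q 2) - real_of_int (q 1) * e / D\<bar> * \<bar>real_of_int D\<bar> \<le> Z * \<bar>real_of_int D\<bar>"
        using up' by (simp only: abs_mult)
      then have v: "\<bar>real_of_int (q 2) - real_of_int (q 1) * e / D\<bar> \<le> Z"
        using D1 by (subst (asm) mult_le_cancel_right_pos) auto
      have "q 1 \<in> J" "r 1 \<in> J" using S d_ge by (auto simp: J_def S_def)
      moreover have "r 1 \<noteq> q 1" using D0 by (simp add: D_def)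
      ultimately have "(((q 1, r 1), r 2 - q 2), q 2) \<in> B"
        using e v unfolding B_def P_def F_def G_def D_def e_def by simp
      with 1 show ?thesis by blast
    qed
    show "(\<lambda>(q, r). (((q 1, r 1), r 2 - q 2), q 2)) ` A \<subseteq> B"
    proof (rule image_subsetI)
      fix x assume "x \<in> A"
      then show "(case x of (q, r) \<Rightarrow> (((q 1, r 1), r 2 - q 2), q 2)) \<in> B"
        using main[of "fst x" "snd x"] by (simp add: case_prod_beta)
    qed
    show "(case x of (q, r) \<Rightarrow> measure M' (pairset q r \<delta>)) \<le> g (case x of (q, r) \<Rightarrow> (((q 1, r 1), r 2 - q 2), q 2))"
      if "x \<in> A" for x
      using main[of "fst x" "snd x"] that by (simp add: case_prod_beta)
  qed (use finB g0 in auto)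
  also have "\<dots> = (\<Sum>ab\<in>P. \<Sum>e\<in>F ab. \<Sum>v\<in>G (ab, e). g ((ab, e), v))"
  proof -
    have "(\<Sum>x\<in>B. g x) = (\<Sum>x\<in>(SIGMA ab:P. F ab). \<Sum>v\<in>G x. g (x, v))"
      unfolding B_def using finP finF finG by (subst sum.Sigma) auto
    also have "\<dots> = (\<Sum>ab\<in>P. \<Sum>e\<in>F ab. \<Sum>v\<in>G (ab, e). g ((ab, e), v))"
      using finP finF by (subst sum.Sigma) (auto simp: case_prod_beta)
    finally show ?thesis .
  qed
  also have "\<dots> \<le> (\<Sum>ab\<in>P. (2 * c + 1) * (2 * Z + 1) * (4 * R * \<delta> / \<bar>y\<bar>))"
  proof (intro sum_mono)
    fix ab assume ab: "ab \<in> P"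
    obtain a b where [simp]: "ab = (a, b)" by (cases ab)
    have "a \<noteq> b" using ab by (auto simp: P_def)
    then have "1 \<le> \<bar>b - a\<bar>" by linarith
    then have ab1: "1 \<le> \<bar>real_of_int b - a\<bar>" by linarith
    let ?w = "4 * R * \<delta> / (\<bar>y\<bar> * \<bar>real_of_int b - a\<bar>)"
    have w0: "0 \<le> ?w" using \<delta> by simp
    have "(\<Sum>e\<in>F ab. \<Sum>v\<in>G (ab, e). g ((ab, e), v)) = (\<Sum>e\<in>F ab. real (card (G (ab, e))) * ?w)"
      by (simp add: g_def)
    also have "\<dots> \<le> (\<Sum>e\<in>F ab. (2 * Z + 1) * ?w)"
    proof (intro sum_mono mult_right_mono w0)
      fix e show "real (card (G (ab, e))) \<le> 2 * Z + 1"
        unfolding G_def using card_int_Icc_le(2)[OF Z] by simp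
    qed
    also have "\<dots> = real (card (F ab)) * ((2 * Z + 1) * ?w)" by simp
    \<comment> \<open>The number of \<open>e\<close> grows like \<open>\<bar>b - a\<bar>\<close> and
      cancels the same factor in the denominator of \<open>?w\<close>, so no logarithm
      arises.\<close>
    also have "\<dots> \<le> ((2 * c + 1) * \<bar>real_of_int b - a\<bar>) * ((2 * Z + 1) * ?w)"
    proof (intro mult_right_mono)
      have "real (card (F ab)) \<le> 2 * (c * \<bar>real_of_int b - a\<bar>) + 1"
        unfolding F_def using card_int_Icc_le(2)[of "c * \<bar>real_of_int b - a\<bar>" 0] c by simp
      also have "\<dots> \<le> (2 * c + 1) * \<bar>real_of_int b - a\<bar>" using ab1 by (simp add: algebra_simps)
      finally show "real (card (F ab)) \<le> (2 * c + 1) * \<bar>real_of_int b - a\<bar>" .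
    qed (rule mult_nonneg_nonneg[OF _ w0], use Z in simp)
    also have "\<dots> = (2 * c + 1) * (2 * Z + 1) * (4 * R * \<delta> / \<bar>y\<bar>)" using ab1 by simp
    finally show "(\<Sum>e\<in>F ab. \<Sum>v\<in>G (ab, e). g ((ab, e), v)) \<le> (2 * c + 1) * (2 * Z + 1) * (4 * R * \<delta> / \<bar>y\<bar>)" .
  qed
  also have "\<dots> = real (card P) * ((2 * c + 1) * (2 * Z + 1) * (4 * R * \<delta> / \<bar>y\<bar>))" by simp
  also have "\<dots> \<le> real (H t) ^ 2 * ((2 * c + 1) * (2 * Z + 1) * (4 * R * \<delta> / \<bar>y\<bar>))"
  proof (intro mult_right_mono)
    have "card P \<le> card (J \<times> J)" unfolding P_def using finJ by (intro card_mono) auto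
    then have "real (card P) \<le> real (card (J \<times> J))" by (rule of_nat_mono)
    then show "real (card P) \<le> real (H t) ^ 2" by (simp add: J_def card_cartesian_product power2_eq_square)
  qed (use c Z \<delta> in auto)
  also have "\<dots> = (2 * (K + 2 * R * \<bar>y\<bar>) + 1) * (4 * R * \<bar>y\<bar> + 1) * (4 * R / \<bar>y\<bar>) * \<delta> * H t ^ 2"
    by (simp add: c_def Z_def)
  finally show ?thesis .
qed

text \<open>For \<open>k = 1\<close>, \<open>y \<noteq> 0\<close> one has
  \<open>p s \<le> w s\<close>, so smallness of the weights makes
  \<open>\<delta> = 4 * H t * p s\<close> negligible against
  \<open>\<bar>y\<bar> * H t\<close>.\<close>

lemma pairset_sum_cross:
  assumes small: "\<And>t. k = 1 \<Longrightarrow> y \<noteq> 0 \<Longrightarrow> 32 * w t \<le> \<bar>y\<bar>"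
  shows "\<exists>B\<ge>0. \<forall>s t. \<forall>q\<in>S s. s < t \<longrightarrow> (\<Sum>r\<in>S t - {q}. measure M' (pairset q r (4 * real (H t) * p s)))
    \<le> B * (4 * real (H t) * p s) * real (H t) ^ (d - 1) / H s"
proof -
  have \<delta>: "0 \<le> 4 * real (H t) * p s" for s t using p_nonneg[of s] by simp
  consider "k \<ge> 2" | "k = 1" "y = 0" | "k = 1" "y \<noteq> 0" using k by linarith
  then show ?thesis
  proof cases
    case 1
    then show ?thesis using pairset_sum_high[OF 1 less_imp_le _ \<delta>] K_pos
      by (intro exI[of _ "2 * (2 * real R) ^ (d - 2) * (16 * (3 * K) ^ (d - 3) + 3 ^ d)"]) auto
  next
    case 2
    then show ?thesis using pairset_sum_dim2_homogeneous[OF 2 less_imp_le _ \<delta>] d_eq_2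
      by (intro exI[of _ "12 * real R ^ 2"]) auto
  next
    case 3
    have "8 * (4 * real (H t) * p s) \<le> \<bar>y\<bar> * H t" for s t
    proof -
      have "p s * 1 \<le> p s * H s" using p_nonneg[of s] H_ge_1[of s] by (intro mult_left_mono) auto
      also have "\<dots> = w s" using d_eq_2[OF 3(1)] by (simp add: w_def)
      finally have "32 * p s \<le> \<bar>y\<bar>" using small[OF 3, of s] by linarith
      then have "H t * (32 * p s) \<le> H t * \<bar>y\<bar>" by (intro mult_left_mono) auto
      then show ?thesis by (simp add: mult_ac)
    qed
    then show ?thesis using pairset_sum_dim2_inhomogeneous_cross[OF 3 _ _ \<delta>] d_eq_2[OF 3(1)]
      by (intro exI[of _ "(8 * R * \<bar>y\<bar> + 1) * (8 * R / \<bar>y\<bar>)"]) auto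
  qed
qed

text \<open>The ranges of the first entry at different levels do not meet, so pairs from different
  levels have no diagonal.\<close>

lemma S_disjoint:
  assumes "s < t" "q \<in> S s" shows "q \<notin> S t"
proof
  assume "q \<in> S t"
  from S_first[OF this] S_first[OF assms(2)] have "real (H t) < 2 * real (H s)" by linarith
  moreover have "4 * H s \<le> H t"
  proof -
    have "(4::nat) ^ Suc s \<le> 4 ^ t" using assms(1) by (intro power_increasing) auto
    then show ?thesis by (simp add: H_def)
  qed
  then have "4 * real (H s) \<le> real (H t)" by linarith
  ultimately show False by linarith
qed

text \<open>Off the diagonal the bound is quadratic in \<open>w t\<close>, and
  \<open>w t \<le> 1\<close> makes it linear. For \<open>k = 1\<close> the elimination radius is
  exactly \<open>4 * w t\<close>, so \<open>8 * R * w t \<le> 1\<close> keeps \<open>R\<close> times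
  it below 1.\<close>

lemma pair_sum_same:
  assumes small: "\<And>t. k = 1 \<Longrightarrow> 8 * R * w t \<le> 1" "\<And>t. k = 1 \<Longrightarrow> y \<noteq> 0 \<Longrightarrow> 32 * w t \<le> \<bar>y\<bar>"
  shows "\<exists>C\<ge>0. \<forall>t. (\<Sum>q\<in>S t. \<Sum>r\<in>S t - {q}. measure M (E t q \<inter> E t r \<inter> Q)) \<le> C * w t"
proof -
  have \<delta>: "0 \<le> 4 * real (H t) * p s" for s t using p_nonneg[of s] by simp
  have ww: "C * (w t * w t) \<le> C * w t" if "C \<ge> 0" for C t
    using mult_left_mono[OF w_le_1[of t] w_nonneg[of t]] that by (intro mult_left_mono) auto
  have w2: "4 * real (H t) * p t = 4 * w t" and Rw: "R * (4 * w t) < 1" if "k = 1" for t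
    using small(1)[OF that, of t] d_eq_2[OF that] w_nonneg[of t] by (simp_all add: w_def mult_ac)
  consider "k \<ge> 2" | "k = 1" "y = 0" | "k = 1" "y \<noteq> 0" using k by linarith
  then show ?thesis
  proof cases
    case 1
    define B where "B = 2 * (2 * real R) ^ (d - 2) * (16 * (3 * K) ^ (d - 3) + 3 ^ d)"
    have B: "B \<ge> 0" using K_pos by (simp add: B_def)
    have "(\<Sum>q\<in>S t. \<Sum>r\<in>S t - {q}. measure M (E t q \<inter> E t r \<inter> Q)) \<le> 24 * K * B * (w t * w t)" for t
    proof (rule pair_sum_le[OF order_refl _ B])
      fix q assume "q \<in> S t"
      from pairset_sum_high[OF 1 order_refl this \<delta>[of t t]]
      show "(\<Sum>r\<in>S t - {q}. measure M' (pairset q r (4 * real (H t) * p t)))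
          \<le> B * (4 * real (H t) * p t) * real (H t) ^ (d - 1) / real (H t)"
        by (simp only: B_def)
    qed
    moreover have "24 * K * B \<ge> 0" using B K_pos by simp
    ultimately show ?thesis using order_trans[OF _ ww] by blast
  next
    case 2
    have "(\<Sum>q\<in>S t. \<Sum>r\<in>S t - {q}. measure M (E t q \<inter> E t r \<inter> Q)) \<le> 24 * K * 0 * (w t * w t)" for t
    proof (intro pair_sum_le)
      fix q assume q: "q \<in> S t"
      have "measure M' (pairset q r (4 * real (H t) * p t)) = 0" if "r \<in> S t - {q}" for r
      proof -
        have "r \<in> S t" "q \<noteq> r" using that by auto
        then have "pairset q r (4 * w t) = {}"
          using w_nonneg[of t] by (intro pairset_dim2_homogeneous_empty[OF 2 q _ _ _ Rw[OF 2(1)]]) auto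
        then show ?thesis unfolding w2[OF 2(1)] by simp
      qed
      then show "(\<Sum>r\<in>S t - {q}. measure M' (pairset q r (4 * real (H t) * p t))) \<le> 0 * (4 * real (H t) * p t) * real (H t) ^ (d - 1) / real (H t)"
        by simp
    qed auto
    then show ?thesis by (intro exI[of _ 0]) auto
  next
    case 3
    define B where "B = (2 * (K + 2 * R * \<bar>y\<bar>) + 1) * (4 * R * \<bar>y\<bar> + 1) * (4 * R / \<bar>y\<bar>)"
    have B: "B \<ge> 0" using K_pos by (simp add: B_def)
    have "(\<Sum>q\<in>S t. \<Sum>r\<in>S t - {q}. measure M (E t q \<inter> E t r \<inter> Q)) \<le> 8 * B * (w t * w t)" for t
    proof -
      have pH: "p t = w t / H t" using d_eq_2[OF 3(1)] H_pos[of t] by (simp add: w_def)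
      have "(\<Sum>q\<in>S t. \<Sum>r\<in>S t - {q}. measure M (E t q \<inter> E t r \<inter> Q))
          \<le> (\<Sum>q\<in>S t. \<Sum>r\<in>S t - {q}. 2 * p t / H t * measure M' (pairset q r (4 * real (H t) * p t)))"
        by (intro sum_mono measure_pair_le) auto
      also have "\<dots> = 2 * p t / H t * (\<Sum>q\<in>S t. \<Sum>r\<in>S t - {q}. measure M' (pairset q r (4 * w t)))"
        by (simp only: sum_distrib_left[symmetric] w2[OF 3(1)])
      also have "\<dots> \<le> 2 * p t / H t * (B * (4 * w t) * H t ^ 2)"
        using pairset_sum_dim2_inhomogeneous_same[OF 3, of "4 * w t" t] w_nonneg[of t] Rw[OF 3(1), of t] small(2)[OF 3, of t] p_nonneg[of t]
        by (intro mult_left_mono) (auto simp: B_def)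
      also have "\<dots> = 8 * B * (w t * w t)"
        using H_pos[of t] unfolding pH by (simp add: power2_eq_square)
      finally show ?thesis .
    qed
    moreover have "8 * B \<ge> 0" using B by simp
    ultimately show ?thesis using order_trans[OF _ ww] by blast
  qed
qed

lemma AE_Q_hits:
  assumes small: "\<And>t. k = 1 \<Longrightarrow> 8 * R * w t \<le> 1" "\<And>t. k = 1 \<Longrightarrow> y \<noteq> 0 \<Longrightarrow> 32 * w t \<le> \<bar>y\<bar>"
    and div: "filterlim (\<lambda>N. \<Sum>t<N. w t) at_top sequentially"
  shows "AE \<alpha> in M. \<alpha> \<in> Q \<longrightarrow> (\<forall>T. \<exists>t\<ge>T. \<exists>q\<in>S t. \<alpha> \<in> E t q)"
proof -
  obtain B where B: "B \<ge> 0" "\<And>s t q. q \<in> S s \<Longrightarrow> s < t \<Longrightarrow>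
      (\<Sum>r\<in>S t - {q}. measure M' (pairset q r (4 * real (H t) * p s))) \<le> B * (4 * real (H t) * p s) * real (H t) ^ (d - 1) / H s"
    using pairset_sum_cross[OF small(2)] by blast
  obtain C where C: "C \<ge> 0" "\<And>t. (\<Sum>q\<in>S t. \<Sum>r\<in>S t - {q}. measure M (E t q \<inter> E t r \<inter> Q)) \<le> C * w t"
    using pair_sum_same[OF small] by blast
  define B' where "B' = 24 * K * B"
  define C' where "C' = C + 6 * K * (2 * real R) ^ (d - 1)"
  have BC: "B' \<ge> 0" "C' \<ge> 0" using B(1) C(1) K_pos by (simp_all add: B'_def C'_def)
  define \<U> where "\<U> = {U. U \<in> sets M \<and> U \<subseteq> Q \<and> (\<exists>n. saturated {1..d} 1 n U)}"
  have one: "1 \<in> {1..d}" by simp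
  show ?thesis
  proof (rule limsup_full_measure[where C = "B' + C'" and c = "1 / (4 * R * 8 ^ k)" and \<U> = \<U> and w = w])
    fix s t :: nat assume st: "s < t"
    have "(\<Sum>q\<in>S s. \<Sum>r\<in>S t. measure M (E s q \<inter> E t r \<inter> Q))
        = (\<Sum>q\<in>S s. \<Sum>r\<in>S t - {q}. measure M (E s q \<inter> E t r \<inter> Q))"
      using S_disjoint[OF st] by (intro sum.cong) auto
    also have "\<dots> \<le> B' * (w s * w t)"
      unfolding B'_def using st B by (intro pair_sum_le) auto
    also have "\<dots> \<le> (B' + C') * (w s * w t)"
      using BC w_nonneg by (intro mult_right_mono) auto
    finally show "(\<Sum>q\<in>S s. \<Sum>r\<in>S t. measure M (E s q \<inter> E t r \<inter> Q)) \<le> (B' + C') * (w s * w t)" .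
  next
    fix t
    have "(\<Sum>q\<in>S t. \<Sum>r\<in>S t. measure M (E t q \<inter> E t r \<inter> Q))
        = (\<Sum>q\<in>S t. measure M (E t q \<inter> E t q \<inter> Q) + (\<Sum>r\<in>S t - {q}. measure M (E t q \<inter> E t r \<inter> Q)))"
      using finite_S by (intro sum.cong refl sum.remove) auto
    also have "\<dots> \<le> C' * w t"
      using diagonal_sum[of t] C(2)[of t] by (simp add: sum.distrib C'_def distrib_right)
    also have "\<dots> \<le> (B' + C') * w t" using BC w_nonneg by (intro mult_right_mono) auto
    finally show "(\<Sum>q\<in>S t. \<Sum>r\<in>S t. measure M (E t q \<inter> E t r \<inter> Q)) \<le> (B' + C') * w t" .
  next
    fix U assume "U \<in> \<U>"
    then show "\<forall>\<^sub>F t in sequentially. 1 / (4 * R * 8 ^ k) * w t * measure M U \<le> (\<Sum>q\<in>S t. measure M (E t q \<inter> U))"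
      using first_moment by (auto simp: \<U>_def)
  next
    fix A \<eta> assume A: "A \<in> sets M" "A \<subseteq> Q" and \<eta>: "(0::real) < \<eta>"
    obtain U n where U: "U \<in> sets M" "saturated {1..d} 1 n U" "measure M (Q \<inter> sym_diff A U) < \<eta>"
      using saturated_dense[OF one Q_fmeasurable A(1) \<eta>] by blast
    \<comment> \<open>Needed so that cutting the approximating set down to \<open>Q\<close>
      preserves its saturation.\<close>
    have "saturated {1..d} 1 0 Q"
    proof (unfold saturated_def, intro ballI allI impI)
      fix \<alpha> and z :: real assume \<alpha>: "\<alpha> \<in> space M" and "\<lfloor>2 ^ 0 * z\<rfloor> = \<lfloor>2 ^ 0 * \<alpha> 1\<rfloor>"
      then have fl: "\<lfloor>z\<rfloor> = \<lfloor>\<alpha> 1\<rfloor>" by simp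
      have "- real R \<le> v \<longleftrightarrow> - int R \<le> \<lfloor>v\<rfloor>" "v < real R \<longleftrightarrow> \<lfloor>v\<rfloor> < int R" for v :: real
        by (simp_all add: le_floor_iff floor_less_iff)
      then have "(- real R \<le> z \<and> z < real R) \<longleftrightarrow> (- real R \<le> \<alpha> 1 \<and> \<alpha> 1 < real R)" using fl by simp
      moreover have "\<alpha>(1 := z) \<in> space M" using \<alpha> by (auto simp: space_PiM PiE_def extensional_def)
      ultimately show "\<alpha>(1 := z) \<in> Q \<longleftrightarrow> \<alpha> \<in> Q" using \<alpha> d_ge unfolding Q_def by auto
    qed
    then have "saturated {1..d} 1 n Q" by (rule saturated_mono) simp
    then have "saturated {1..d} 1 n (U \<inter> Q)" using U(2) by (auto simp: saturated_def)
    then have "U \<inter> Q \<in> \<U>" using U(1) sets_Q by (auto simp: \<U>_def)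
    moreover have "sym_diff A (U \<inter> Q) = Q \<inter> sym_diff A U" using A(2) by blast
    ultimately show "\<exists>U\<in>\<U>. measure M (sym_diff A U) < \<eta>" using U(3) by (intro bexI[of _ "U \<inter> Q"]) auto
  next
    show "0 < 1 / (4 * R * 8 ^ k :: real)" using R by simp
  next
    show "0 \<le> B' + C'" using BC by simp
  qed (use sets_Q emeasure_Q finite_S sets_E w_nonneg div in \<open>auto simp: \<U>_def\<close>)
qed

end

section \<open>Almost everywhere approximation\<close>

theorem corollary1p5:
  fixes k :: nat and \<psi> :: "nat \<Rightarrow> real" and y :: real
  assumes "k \<ge> 1"
    and "\<And>n. n \<ge> 1 \<Longrightarrow> \<psi> n > 0"
    and "antimono_on {1..} (\<lambda>n. real n ^ (2 * k - 2) * \<psi> n)"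
    and "filterlim (\<lambda>N. \<Sum>j=1..N. real j ^ (2 * k - 2) * \<psi> j) at_top sequentially"
  shows "AE \<alpha> in lebesgue_dim (2 * k).
    infinite {q \<in> integer_points (2 * k).
      (\<exists>i\<in>{1..2 * k - 1}. q i \<noteq> 0) \<and>
      (\<forall>i\<in>{1..k}. gcd (q (2 * i - 1)) (q (2 * i)) = 1) \<and>
      \<bar>linear_form (2 * k) \<alpha> q - y\<bar> \<le> \<psi> (height (2 * k - 1) q)}"
proof -
  define f where "f n = real n ^ (2 * k - 2) * \<psi> n" for n
  have f_dec: "f n \<le> f m" if "1 \<le> m" "m \<le> n" for m n
    using assms(3) that by (auto simp: monotone_on_def f_def)
  have \<psi>_dec: "\<psi> n \<le> \<psi> m" if mn: "1 \<le> m" "m \<le> n" for m n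
  proof -
    have "real n ^ (2 * k - 2) * \<psi> n \<le> real m ^ (2 * k - 2) * \<psi> m" using f_dec[OF mn] by (simp add: f_def)
    also have "\<dots> \<le> real n ^ (2 * k - 2) * \<psi> m"
      using mn assms(2)[OF mn(1)] by (intro mult_right_mono power_mono) auto
    finally show ?thesis using mn by (subst (asm) mult_le_cancel_left_pos) auto
  qed
  define hits where "hits \<alpha> = {q \<in> integer_points (2 * k).
      (\<exists>i\<in>{1..2 * k - 1}. q i \<noteq> 0) \<and>
      (\<forall>i\<in>{1..k}. gcd (q (2 * i - 1)) (q (2 * i)) = 1) \<and>
      \<bar>linear_form (2 * k) \<alpha> q - y\<bar> \<le> \<psi> (height (2 * k - 1) q)}" for \<alpha>
  let ?M = "\<Pi>\<^sub>M i\<in>{1..2 * k}. (lborel :: real measure)"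
  \<comment> \<open>The region \<open>Q\<close> belonging to \<open>R\<close>, stated outside the
    locale since \<open>p\<close>, and with it the interpretation, will depend on
    \<open>R\<close>.\<close>
  define good where "good R = {\<alpha>. - real R \<le> \<alpha> 1 \<and> \<alpha> 1 < real R \<and>
    (\<forall>i\<in>{2..2 * k}. \<bar>\<alpha> i\<bar> \<le> real R) \<and> 1 / real R \<le> \<bar>\<alpha> (2 * k)\<bar>}" for R :: nat
  have AE_good: "AE \<alpha> in ?M. \<alpha> \<in> good R \<longrightarrow> infinite (hits \<alpha>)" if R: "R \<ge> 1" for R
  proof -
    \<comment> \<open>The three bounds are those required of \<open>w\<close>:
      \<open>w t \<le> 1\<close>, \<open>8 * R * w t \<le> 1\<close>, and
      \<open>32 * w t \<le> \<bar>y\<bar>\<close> if \<open>y \<noteq> 0\<close>.\<close>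
    define \<epsilon> where "\<epsilon> = min (min 1 (1 / (8 * real R))) (if y = 0 then 1 else \<bar>y\<bar> / 32)"
    have \<epsilon>: "\<epsilon> > 0" "\<epsilon> \<le> 1" "8 * real R * \<epsilon> \<le> 1" "y \<noteq> 0 \<Longrightarrow> 32 * \<epsilon> \<le> \<bar>y\<bar>"
    proof -
      have "\<epsilon> \<le> 1 / (8 * real R)" by (simp add: \<epsilon>_def)
      then show "8 * real R * \<epsilon> \<le> 1" using R by (simp add: field_simps)
      show "32 * \<epsilon> \<le> \<bar>y\<bar>" if "y \<noteq> 0" using that by (simp add: \<epsilon>_def min_def)
      show "\<epsilon> \<le> 1" unfolding \<epsilon>_def by (intro min.coboundedI1) simp
    qed (use R in \<open>auto simp: \<epsilon>_def\<close>)
    \<comment> \<open>The first entry is a lower bound for \<open>\<psi>\<close> at every height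
      occurring at level \<open>t\<close>; the second caps the weight at
      \<open>\<epsilon>\<close>.\<close>
    define p where "p t = min (\<psi> (2 * 4 ^ t)) (\<epsilon> / (4 ^ t) ^ (2 * k - 1))" for t :: nat
    have p_pos: "0 \<le> p t" for t
      using assms(2)[of "2 * 4 ^ t"] \<epsilon>(1) by (simp add: p_def)
    have p_w: "p t * (4 ^ t) ^ (2 * k - 1) = min ((4 ^ t) ^ (2 * k - 1) * \<psi> (2 * 4 ^ t)) \<epsilon>" for t
      unfolding p_def by (subst min_mult_distrib_right) (auto simp: mult.commute)
    interpret F: block_coprime_forms k R y p
    proof
      show "p t \<le> p s" if "s \<le> t" for s t
        unfolding p_def
      proof (intro min.mono \<psi>_dec divide_left_mono)
        show "(4 ^ s) ^ (2 * k - 1) \<le> ((4::real) ^ t) ^ (2 * k - 1)"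
          using that by (intro power_mono power_increasing) auto
      qed (use that \<epsilon> in auto)
      show "p t * (4 ^ t) ^ (2 * k - 1) \<le> 1" for t unfolding p_w using \<epsilon> by simp
    qed (use assms(1) R p_pos in auto)
    have w: "F.w t = min ((4 ^ t) ^ (2 * k - 1) * \<psi> (2 * 4 ^ t)) \<epsilon>" for t
      using p_w[of t] by (simp add: F.w_def F.H_def F.d_def)
    \<comment> \<open>Up to a constant the untruncated weight is the condensed term of the given
      divergent series.\<close>
    have u: "(4 ^ t) ^ (2 * k - 1) * \<psi> (2 * 4 ^ t) = (1 / 2 ^ (2 * k - 2)) * (4 ^ t * f (2 * 4 ^ t))" for t
    proof -
      have "2 * k - 1 = Suc (2 * k - 2)" using assms(1) by simp
      then show ?thesis by (simp add: f_def power_mult_distrib)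
    qed
    have f0: "0 \<le> f n" if "n \<ge> 1" for n using assms(2)[OF that] by (simp add: f_def)
    have "\<not> summable (\<lambda>t. 4 ^ t * f (2 * 4 ^ t))"
      using assms(4) f0 f_dec by (intro condensation_4_filterlim) (auto simp: f_def)
    then have "\<not> summable (\<lambda>t. (1 / 2 ^ (2 * k - 2)) * (4 ^ t * f (2 * 4 ^ t)))"
      by (subst summable_cmult_iff) simp
    then have "\<not> summable F.w"
      unfolding w[abs_def] u using \<epsilon> f0 by (intro not_summable_min) auto
    then have div: "filterlim (\<lambda>N. \<Sum>t<N. F.w t) at_top sequentially"
      using not_summable_iff_filterlim_at_top F.w_nonneg by blast
    have w_le: "F.w t \<le> \<epsilon>" for t unfolding w by simp
    have "AE \<alpha> in F.M. \<alpha> \<in> F.Q \<longrightarrow> (\<forall>T. \<exists>t\<ge>T. \<exists>q\<in>F.S t. \<alpha> \<in> F.E t q)"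
    proof (rule F.AE_Q_hits[OF _ _ div])
      fix t
      have "8 * real R * F.w t \<le> 8 * real R * \<epsilon>" using w_le by (intro mult_left_mono) auto
      then show "8 * R * F.w t \<le> 1" using \<epsilon> by simp
      show "32 * F.w t \<le> \<bar>y\<bar>" if "y \<noteq> 0" using w_le[of t] \<epsilon>(4)[OF that] by linarith
    qed
    then show ?thesis
      unfolding F.d_def
    proof (rule AE_mp, intro AE_I2 impI)
      fix \<alpha> assume \<alpha>: "\<alpha> \<in> space ?M" "\<alpha> \<in> good R"
        and hit: "\<alpha> \<in> F.Q \<longrightarrow> (\<forall>T. \<exists>t\<ge>T. \<exists>q\<in>F.S t. \<alpha> \<in> F.E t q)"
      have "\<alpha> \<in> F.Q" using \<alpha> by (simp add: F.Q_def good_def F.d_def)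
      with hit have hit: "\<exists>t\<ge>T. \<exists>q\<in>F.S t. \<alpha> \<in> F.E t q" for T by blast
      have in_hits: "q \<in> hits \<alpha>" if q: "q \<in> F.S t" and E: "\<alpha> \<in> F.E t q" for q t
      proof -
        have qi: "int (F.H t) \<le> q i" "q i < 2 * int (F.H t)" if "i \<in> {1..2 * k - 1}" for i
          using q that by (auto simp: F.S_def F.d_def)
        have one: "1 \<in> {1..2 * k - 1}" using assms(1) by auto
        have "q 1 \<noteq> 0" using F.S_first(3)[OF q] by simp
        let ?A = "(\<lambda>i. \<bar>q i\<bar>) ` {1..2 * k - 1}"
        have "Max ?A \<in> ?A" using one by (intro Max_in) auto
        then obtain i where i: "i \<in> {1..2 * k - 1}" "Max ?A = \<bar>q i\<bar>" by blast
        then have "height (2 * k - 1) q = nat (q i)" using qi(1)[OF i(1)] by (simp add: height_def)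
        with qi[OF i(1)] F.H_pos[of t] have "1 \<le> height (2 * k - 1) q" "height (2 * k - 1) q \<le> 2 * F.H t"
          by linarith+
        then have "1 \<le> height (2 * k - 1) q" "height (2 * k - 1) q \<le> 2 * 4 ^ t"
          by (simp_all add: F.H_def)
        from \<psi>_dec[OF this] have "p t \<le> \<psi> (height (2 * k - 1) q)" by (simp add: p_def)
        moreover have "\<bar>linear_form (2 * k) \<alpha> q - y\<bar> \<le> p t" using E by (simp add: F.E_def F.d_def)
        ultimately show ?thesis using q one \<open>q 1 \<noteq> 0\<close> unfolding hits_def F.S_def F.d_def by auto
      qed
      show "infinite (hits \<alpha>)"
      proof
        assume fin: "finite (hits \<alpha>)"
        \<comment> \<open>A bound for \<open>q 1\<close> over all hits; a hit at a level
          \<open>t \<ge> N\<close> has \<open>q 1 \<ge> 4 ^ t > N\<close>.\<close>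
        define N where "N = (\<Sum>q\<in>hits \<alpha>. nat (q 1))"
        obtain t q where tq: "t \<ge> N" "q \<in> F.S t" "\<alpha> \<in> F.E t q" using hit by blast
        have "nat (q 1) \<le> N"
          unfolding N_def using fin in_hits[OF tq(2,3)] by (intro member_le_sum) auto
        moreover have "real (F.H t) \<le> q 1" by (rule F.S_first(1)[OF tq(2)])
        moreover have "t < F.H t" unfolding F.H_def by (rule power_gt_expt) simp
        ultimately show False using tq(1) by linarith
      qed
    qed
  qed
  have "AE \<alpha> in ?M. \<forall>R\<in>{1..}. \<alpha> \<in> good R \<longrightarrow> infinite (hits \<alpha>)"
    by (rule AE_ball_countable[THEN iffD2]) (auto intro: AE_good)
  \<comment> \<open>The countably many regions \<open>good R\<close> cover everything except this
    null hyperplane.\<close>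
  moreover have "AE \<alpha> in ?M. \<alpha> (2 * k) \<noteq> 0"
    using assms(1) by (intro AE_PiM_component_nonzero) auto
  ultimately have "AE \<alpha> in ?M. infinite (hits \<alpha>)"
  proof eventually_elim
    case (elim \<alpha>)
    obtain n1 where n1: "(\<Sum>i\<in>{1..2 * k}. \<bar>\<alpha> i\<bar>) < real n1" using reals_Archimedean2 by blast
    obtain n2 where n2: "1 / \<bar>\<alpha> (2 * k)\<bar> < real n2" using reals_Archimedean2 by blast
    define R where "R = Suc (max n1 n2)"
    have "\<bar>\<alpha> i\<bar> < real R" if "i \<in> {1..2 * k}" for i
      using member_le_sum[of i "{1..2 * k}" "\<lambda>i. \<bar>\<alpha> i\<bar>"] that n1 by (simp add: R_def)
    moreover have "1 / real R \<le> \<bar>\<alpha> (2 * k)\<bar>"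
    proof -
      have "1 / \<bar>\<alpha> (2 * k)\<bar> \<le> real R" using n2 by (simp add: R_def)
      then show ?thesis using elim(2) by (simp add: divide_le_eq R_def mult.commute)
    qed
    ultimately have "\<alpha> \<in> good R" using assms(1) by (force simp: good_def abs_less_iff intro: less_imp_le)
    then show ?case using elim(1) by (auto simp: R_def)
  qed
  then show ?thesis unfolding lebesgue_dim_def hits_def by (rule AE_completion)
qed

end
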